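(* Let $\mathbb{K}$, $\mathcal{S}$, ${\rm mult}(\mathscr{B}(\mathcal{S}))$ and $J_1^L,J_2^L$ be as in the context. There exists a non-empty Zariski open subset $\Omega_{\mathcal{S}}$ of the group of projective transformations of $\mathbb{P}^2(\mathbb{K})$ such that for every $L\in\Omega_{\mathcal{S}}$, $${\rm mult}(\mathscr{B}(\mathcal{S}))=\deg_{\overline t}\Big({\rm Content}_{\overline x}\big({\rm Res}_{t_3}(J_1^L,J_2^L)\big)\Big).$$
   Context: $\mathbb{K}$ is an algebraically closed field of characteristic zero. $\mathcal{S}=(s_1:s_2:s_3):\mathbb{P}^2(\mathbb{K})\dashrightarrow\mathbb{P}^2(\mathbb{K})$ is a dominant rational map with $s_i\in\mathbb{K}[t_1,t_2,t_3]$ homogeneous of the same degree, $\gcd(s_1,s_2,s_3)=1$, and $s_i(0,0,1)\ne0$ for all $i$. $\mathscr{B}(\mathcal{S})$ is the set of common zeros of the $s_i$ in $\mathbb{P}^2(\mathbb{K})$. With indeterminates $\overline x=(x_1,x_2,x_3)$, $\overline y=(y_1,y_2,y_3)$ and $\mathbb{F}$ the algebraic closure of $\mathbb{K}(\overline x,\overline y)$, $V_1=\sum x_is_i$, $V_2=\sum y_is_i$, and ${\rm mult}(\mathscr{B}(\mathcal{S}))=\sum_{A\in\mathscr{B}(\mathcal{S})}{\rm mult}_A(\mathscr{C}(V_1),\mathscr{C}(V_2))$ (intersection multiplicities in $\mathbb{P}^2(\mathbb{F})$). For a projective transformation $L=(L_1:L_2:L_3)$ of $\mathbb{P}^2(\mathbb{K})$,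 with $L_i(\mathcal{S})=L_i(s_1,s_2,s_3)$, $J_1^L=x_3L_1(\mathcal{S})-x_1L_3(\mathcal{S})$ and $J_2^L=x_3L_2(\mathcal{S})-x_2L_3(\mathcal{S})$. ${\rm Res}_{t_3}$ is the resultant w.r.t. $t_3$; ${\rm Content}_{\overline x}(R)$ is the gcd in $\mathbb{K}[t_1,t_2]$ of the coefficients of $R$ as a polynomial in $\overline x$; $\deg_{\overline t}$ is the degree in $t_1,t_2$. *)

theory Defs
  imports "HOL-Algebra.Algebraic_Closure_Type" "Subresultants.Resultant_Prelim"
          "HOL-Library.Extended_Nat" "HOL-Library.Poly_Mapping"
begin

text \<open>A polynomial p :: 'a poly poly poly encodes a polynomial in t1 (innermost),
  t2 (middle), t3 (outermost).\<close>

definition eval3 :: "'a::comm_semiring_1 poly poly poly \<Rightarrow> 'a \<Rightarrow> 'a \<Rightarrow> 'a \<Rightarrow> 'a" where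
  "eval3 p a1 a2 a3 = poly (map_poly (\<lambda>q. poly (map_poly (\<lambda>r. poly r a1) q) a2) p) a3"

definition coeff3 :: "'a::zero poly poly poly \<Rightarrow> nat \<Rightarrow> nat \<Rightarrow> nat \<Rightarrow> 'a" where
  "coeff3 p i j k = coeff (coeff (coeff p k) j) i"

definition homogeneous3 :: "'a::zero poly poly poly \<Rightarrow> nat \<Rightarrow> bool" where
  "homogeneous3 p d \<longleftrightarrow> (\<forall>i j k. coeff3 p i j k \<noteq> 0 \<longrightarrow> i + j + k = d)"

definition const3 :: "'a::zero \<Rightarrow> 'a poly poly poly" where
  "const3 c = [:[:[:c:]:]:]"

text \<open>Each point of P^2(K) is represented by its unique normalized representative:
  first nonzero coordinate equal to 1.\<close>
definition proj_rep :: "'a::{zero,one} \<Rightarrow> 'a \<Rightarrow> 'a \<Rightarrow> bool" where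
  "proj_rep a1 a2 a3 \<longleftrightarrow> a1 = 1 \<or> (a1 = 0 \<and> a2 = 1) \<or> (a1 = 0 \<and> a2 = 0 \<and> a3 = 1)"

definition base_points ::
  "'a::comm_semiring_1 poly poly poly \<Rightarrow> 'a poly poly poly \<Rightarrow> 'a poly poly poly \<Rightarrow> ('a \<times> 'a \<times> 'a) set" where
  "base_points s1 s2 s3 = {(a1, a2, a3). proj_rep a1 a2 a3 \<and>
       eval3 s1 a1 a2 a3 = 0 \<and> eval3 s2 a1 a2 a3 = 0 \<and> eval3 s3 a1 a2 a3 = 0}"

text \<open>The rational map S = (s1:s2:s3) is dominant: its image (on the complement of
  the base locus) is Zariski dense in P^2, i.e. not contained in the zero set of
  any nonzero form.\<close>
definition dominant3 :: "'a::comm_semiring_1 poly poly poly \<Rightarrow> 'a poly poly poly \<Rightarrow> 'a poly poly poly \<Rightarrow> bool" where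
  "dominant3 s1 s2 s3 \<longleftrightarrow>
     (\<forall>F. F \<noteq> 0 \<and> (\<exists>e. homogeneous3 F e) \<longrightarrow>
        (\<exists>a1 a2 a3. \<not> (eval3 s1 a1 a2 a3 = 0 \<and> eval3 s2 a1 a2 a3 = 0 \<and> eval3 s3 a1 a2 a3 = 0) \<and>
           eval3 F (eval3 s1 a1 a2 a3) (eval3 s2 a1 a2 a3) (eval3 s3 a1 a2 a3) \<noteq> 0))"

definition eval2 :: "'a::comm_semiring_1 poly poly \<Rightarrow> 'a \<Rightarrow> 'a \<Rightarrow> 'a" where
  "eval2 p a b = poly (map_poly (\<lambda>r. poly r a) p) b"

definition const2 :: "'a::zero \<Rightarrow> 'a poly poly" where
  "const2 c = [:[:c:]:]"

text \<open>h (a polynomial, viewed in the local ring O_(a,b)) lies in the ideal (f,g) O_(a,b)\<close>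
definition in_loc_ideal :: "'a::field poly poly \<Rightarrow> 'a poly poly \<Rightarrow> 'a \<Rightarrow> 'a \<Rightarrow> 'a poly poly \<Rightarrow> bool" where
  "in_loc_ideal f g a b h \<longleftrightarrow> (\<exists>p q w. eval2 w a b \<noteq> 0 \<and> w * h = p * f + q * g)"

text \<open>The list us of fractions u/v (v(a,b) \<noteq> 0), elements of O_(a,b), is linearly
  independent over the field modulo (f,g) O_(a,b).  A linear combination
  \<Sum> c_i u_i/v_i equals N / \<Prod> v_j with the numerator N below.\<close>
definition loc_indep :: "'a::field poly poly \<Rightarrow> 'a poly poly \<Rightarrow> 'a \<Rightarrow> 'a \<Rightarrow> ('a poly poly \<times> 'a poly poly) list \<Rightarrow> bool" where
  "loc_indep f g a b us \<longleftrightarrow>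
     (\<forall>uv \<in> set us. eval2 (snd uv) a b \<noteq> 0) \<and>
     (\<forall>c. (\<exists>i<length us. c i \<noteq> 0) \<longrightarrow>
        \<not> in_loc_ideal f g a b
          (\<Sum>i<length us. const2 (c i) * fst (us ! i) * (\<Prod>j\<in>{..<length us} - {i}. snd (us ! j))))"

text \<open>dim_F O_(a,b)/(f,g), possibly infinite\<close>
definition int_mult_aff :: "'a::field poly poly \<Rightarrow> 'a poly poly \<Rightarrow> 'a \<Rightarrow> 'a \<Rightarrow> enat" where
  "int_mult_aff f g a b = Sup {enat (length us) | us. loc_indep f g a b us}"

definition dehom1 :: "'a::comm_semiring_1 poly poly poly \<Rightarrow> 'a poly poly" where
  "dehom1 p = map_poly (map_poly (\<lambda>r. poly r 1)) p"   (* vars t2, t3 *)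
definition dehom2 :: "'a::comm_semiring_1 poly poly poly \<Rightarrow> 'a poly poly" where
  "dehom2 p = map_poly (\<lambda>q. poly q 1) p"                (* vars t1, t3 *)
definition dehom3 :: "'a::comm_semiring_1 poly poly poly \<Rightarrow> 'a poly poly" where
  "dehom3 p = poly p 1"                                  (* vars t1, t2 *)

definition int_mult_proj :: "'a::field poly poly poly \<Rightarrow> 'a poly poly poly \<Rightarrow> 'a \<Rightarrow> 'a \<Rightarrow> 'a \<Rightarrow> enat" where
  "int_mult_proj F G a1 a2 a3 =
     (if a1 \<noteq> 0 then int_mult_aff (dehom1 F) (dehom1 G) (a2 / a1) (a3 / a1)
      else if a2 \<noteq> 0 then int_mult_aff (dehom2 F) (dehom2 G) (a1 / a2) (a3 / a2)
      else int_mult_aff (dehom3 F) (dehom3 G) (a1 / a3) (a2 / a3))"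

text \<open>K[x1,x2,x3,y1,y2,y3]: x1 innermost, y3 outermost.\<close>
type_synonym 'k polyXY = "'k poly poly poly poly poly poly"
type_synonym 'k FF = "'k polyXY fract alg_closure"

definition constXY :: "'k::zero \<Rightarrow> 'k polyXY" where
  "constXY c = [:[:[:[:[:[:c:]:]:]:]:]:]"

definition varXY :: "nat \<Rightarrow> 'k::comm_semiring_1 polyXY" where
  "varXY n = (if n = 0 then [:[:[:[:[:[:0, 1:]:]:]:]:]:]
     else if n = 1 then [:[:[:[:[:0, 1 :: 'k poly:]:]:]:]:]
     else if n = 2 then [:[:[:[:0, 1 :: 'k poly poly:]:]:]:]
     else if n = 3 then [:[:[:0, 1 :: 'k poly poly poly:]:]:]
     else if n = 4 then [:[:0, 1 :: 'k poly poly poly poly:]:]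
     else [:0, 1 :: 'k poly poly poly poly poly:])"

definition embF :: "'k::field \<Rightarrow> 'k FF" where
  "embF c = to_ac (to_fract (constXY c))"

text \<open>x_i = X (i-1), y_i = Y (i-1), i = 1,2,3, as elements of F\<close>
definition xF :: "nat \<Rightarrow> 'k::field FF" where "xF i = to_ac (to_fract (varXY i))"
definition yF :: "nat \<Rightarrow> 'k::field FF" where "yF i = to_ac (to_fract (varXY (i + 3)))"

definition liftF :: "'k::field poly poly poly \<Rightarrow> 'k FF poly poly poly" where
  "liftF p = map_poly (map_poly (map_poly embF)) p"

definition V1 :: "'k::field poly poly poly \<Rightarrow> 'k poly poly poly \<Rightarrow> 'k poly poly poly \<Rightarrow> 'k FF poly poly poly" where
  "V1 s1 s2 s3 = const3 (xF 0) * liftF s1 + const3 (xF 1) * liftF s2 + const3 (xF 2) * liftF s3"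
definition V2 :: "'k::field poly poly poly \<Rightarrow> 'k poly poly poly \<Rightarrow> 'k poly poly poly \<Rightarrow> 'k FF poly poly poly" where
  "V2 s1 s2 s3 = const3 (yF 0) * liftF s1 + const3 (yF 1) * liftF s2 + const3 (yF 2) * liftF s3"

definition mult_base :: "'k::field poly poly poly \<Rightarrow> 'k poly poly poly \<Rightarrow> 'k poly poly poly \<Rightarrow> enat" where
  "mult_base s1 s2 s3 = (\<Sum>(a1, a2, a3) \<in> base_points s1 s2 s3.
      int_mult_proj (V1 s1 s2 s3) (V2 s1 s2 s3) (embF a1) (embF a2) (embF a3))"

text \<open>A projective transformation L is given by a 3x3 matrix M (entries M i j, i,j<3)
  with nonzero determinant: L_i(u) = \<Sum>_j M i j * u_j.\<close>
definition det3 :: "(nat \<Rightarrow> nat \<Rightarrow> 'a::comm_ring_1) \<Rightarrow> 'a" where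
  "det3 M = M 0 0 * (M 1 1 * M 2 2 - M 1 2 * M 2 1)
          - M 0 1 * (M 1 0 * M 2 2 - M 1 2 * M 2 0)
          + M 0 2 * (M 1 0 * M 2 1 - M 1 1 * M 2 0)"

definition eval_mat_poly :: "(((nat \<times> nat) \<Rightarrow>\<^sub>0 nat) \<Rightarrow>\<^sub>0 'a::comm_semiring_1) \<Rightarrow> (nat \<Rightarrow> nat \<Rightarrow> 'a) \<Rightarrow> 'a" where
  "eval_mat_poly P M = (\<Sum>e\<in>Poly_Mapping.keys P. Poly_Mapping.lookup P e *
       (\<Prod>ij\<in>{0..<3} \<times> {0..<3}. M (fst ij) (snd ij) ^ Poly_Mapping.lookup e ij))"

definition LS :: "(nat \<Rightarrow> nat \<Rightarrow> 'a::comm_semiring_1) \<Rightarrow> nat \<Rightarrow> 'a poly poly poly \<Rightarrow> 'a poly poly poly \<Rightarrow> 'a poly poly poly \<Rightarrow> 'a poly poly poly" where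
  "LS M i s1 s2 s3 = const3 (M i 0) * s1 + const3 (M i 1) * s2 + const3 (M i 2) * s3"

text \<open>Ring K[t1,t2,x1,x2,x3] (t1 innermost, x3 outermost); J's are polynomials in t3 over it.\<close>
type_synonym 'k polyTX = "'k poly poly poly poly poly"

definition liftTX :: "'k::zero poly poly \<Rightarrow> 'k polyTX" where
  "liftTX q = [:[:[:q:]:]:]"

definition varX :: "nat \<Rightarrow> 'k::comm_semiring_1 polyTX" where
  "varX n = (if n = 0 then [:[:[:0, 1 :: 'k poly poly:]:]:]
     else if n = 1 then [:[:0, 1 :: 'k poly poly poly:]:]
     else [:0, 1 :: 'k poly poly poly poly:])"

definition liftJ :: "'k::zero poly poly poly \<Rightarrow> 'k polyTX poly" where
  "liftJ p = map_poly liftTX p"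

definition J1 :: "(nat \<Rightarrow> nat \<Rightarrow> 'k::comm_ring_1) \<Rightarrow> 'k poly poly poly \<Rightarrow> 'k poly poly poly \<Rightarrow> 'k poly poly poly \<Rightarrow> 'k polyTX poly" where
  "J1 M s1 s2 s3 = [:varX 2:] * liftJ (LS M 0 s1 s2 s3) - [:varX 0:] * liftJ (LS M 2 s1 s2 s3)"
definition J2 :: "(nat \<Rightarrow> nat \<Rightarrow> 'k::comm_ring_1) \<Rightarrow> 'k poly poly poly \<Rightarrow> 'k poly poly poly \<Rightarrow> 'k poly poly poly \<Rightarrow> 'k polyTX poly" where
  "J2 M s1 s2 s3 = [:varX 2:] * liftJ (LS M 1 s1 s2 s3) - [:varX 1:] * liftJ (LS M 2 s1 s2 s3)"

definition content_x :: "'k::field_gcd polyTX \<Rightarrow> 'k poly poly" where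
  "content_x R = Gcd {coeff (coeff (coeff R k) j) i | i j k. True}"

definition deg_t :: "'k::zero poly poly \<Rightarrow> nat" where
  "deg_t p = Max (insert 0 {i + j | i j. coeff (coeff p j) i \<noteq> 0})"

end

theory Submission
  imports Defs "Subresultants.Subresultant_Gcd"
begin

text \<open>
  The forms \<open>J1\<close>, \<open>J2\<close> span the members of the net \<open>\<mu> \<cdot> S\<close> with \<open>\<mu>\<close> orthogonal to \<open>M\<^sup>-\<^sup>1 x\<close>,
  and \<open>V1\<close>, \<open>V2\<close> span those with \<open>\<mu>\<close> orthogonal to the cross product of \<open>x\<close> and \<open>y\<close>. Substituting
  for \<open>x\<close> the generic point \<open>\<xi> = M (x \<times> y)\<close> of \<open>F\<^sup>3\<close>, whose coordinates are algebraically independent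
  over \<open>K\<close>, both pairs generate the same ideal. Hence the only genericity needed of \<open>M\<close> is that the
  leading coefficients of \<open>J1\<close> and \<open>J2\<close> in \<open>t3\<close> do not vanish.

  Both coordinate charts reduce the claim to two polynomials \<open>f\<close>, \<open>g\<close> in \<open>k[u][v]\<close>, with \<open>f\<close> monic in \<open>v\<close> up
  to a constant: the order of the resultant at \<open>u = a\<close> is the codimension of the ideal \<open>(f, g)\<close> localized at
  the line \<open>u = a\<close>. Indeed the resultant is the determinant of the Sylvester matrix, whose columns span
  \<open>(f, g)\<close>, and dividing a column by \<open>u - a\<close> lowers both numbers by one. That codimension is in turn
  the sum of the local intersection multiplicities on the line, as adding to an ideal a common
  eigenvector of \<open>u\<close> and \<open>v\<close> with eigenvalues \<open>(a, b)\<close> lowers by one the codimension and the local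
  codimension at \<open>(a, b)\<close>, and changes no other one. On a line defined over \<open>K\<close> every common zero
  of \<open>J1\<close> and \<open>J2\<close> is a base point, and the order of the resultant is that of its content.
\<close>

text \<open>Why two charts suffice: the lines u = a are lines through (0:0:1), which is no base
  point because \<open>s1\<close> does not vanish there. So every base point lies on exactly one
  line t2 = a t1 (chart t1 = 1) or on t1 = 0 (chart t2 = 1). Correspondingly the content C, a form
  in t1 and t2, has degree equal to the degree of C(1, t2) plus the order at 0 of C(t1, 1). Why the
  content has the order of the resultant at a in K: its cofactor Q has x-coefficients without common
  zero on P^1(K), since such a zero would give a common linear factor. At each K-point Q is thus a
  nonzero polynomial in x over K, and these do not vanish at the generic point. Why the resultant is
  nonzero: otherwise every one of the infinitely many lines would carry a common zero of
  \<open>J1\<close> and \<open>J2\<close>, hence a base point, whereas gcd 1 allows base points on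
  finitely many lines only. Why the Sylvester matrix spans the ideal: remainders modulo f itself
  have too few coefficients. Working modulo v^(deg g) f leaves exactly deg f + deg g of them, the
  size of the matrix.\<close>

no_notation fps_nth (infixl "$" 75)

subsection \<open>Codimension\<close>

definition subspace2 :: "'a::field poly poly set \<Rightarrow> bool" where
  "subspace2 J \<longleftrightarrow> 0 \<in> J \<and> (\<forall>x\<in>J. \<forall>y\<in>J. x + y \<in> J) \<and> (\<forall>c. \<forall>x\<in>J. const2 c * x \<in> J)"

text \<open>Linear independence of the classes modulo \<open>J\<close>, stated without forming a
  quotient space. \<open>codim\<close> below is then the dimension of that quotient, possibly
  infinite.\<close>

definition indep_mod :: "'a::field poly poly set \<Rightarrow> 'a poly poly set \<Rightarrow> bool" where
  "indep_mod J B \<longleftrightarrow> finite B \<and>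
     (\<forall>c. (\<Sum>b\<in>B. const2 (c b) * b) \<in> J \<longrightarrow> (\<forall>b\<in>B. c b = 0))"

definition codim :: "'a::field poly poly set \<Rightarrow> enat" where
  "codim J = Sup {enat (card B) | B. indep_mod J B}"

lemma const2_0 [simp]: "const2 0 = 0"
  by (simp add: const2_def)

lemma const2_1 [simp]: "const2 (1::'a::comm_semiring_1) = 1"
  by (simp add: const2_def pCons_one)

lemma const2_add: "const2 (a + b :: 'a::comm_semiring_1) = const2 a + const2 b"
  by (simp add: const2_def)

lemma const2_diff: "const2 (a - b :: 'a::comm_ring_1) = const2 a - const2 b"
  by (simp add: const2_def)

lemma const2_uminus: "const2 (- b :: 'a::comm_ring_1) = - const2 b"
  by (simp add: const2_def)

lemma const2_mult: "const2 (a * b :: 'a::comm_semiring_1) = const2 a * const2 b"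
  by (simp add: const2_def)

lemma subspace2_diff:
  assumes "subspace2 J" "x \<in> J" "y \<in> J"
  shows "x - y \<in> J"
proof -
  have "x + const2 (-1) * y \<in> J"
    using assms unfolding subspace2_def by blast
  then show ?thesis by (simp add: const2_uminus)
qed

lemma subspace2_const_cancel:
  assumes "subspace2 J" "const2 c * x \<in> J" "c \<noteq> 0"
  shows "x \<in> J"
proof -
  have "const2 (inverse c) * (const2 c * x) \<in> J"
    using assms unfolding subspace2_def by blast
  also have "const2 (inverse c) * (const2 c * x) = x"
    using assms(3) by (simp add: mult.assoc [symmetric] flip: const2_mult)
  finally show ?thesis .
qed

lemma indep_modD:
  assumes "indep_mod J B" "(\<Sum>b\<in>B. const2 (c b) * b) \<in> J" "b \<in> B"
  shows "c b = 0"
  using assms unfolding indep_mod_def by blast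

text \<open>\<open>J'\<close> is \<open>J\<close> plus the line spanned by \<open>s\<close>.
  Adjoining \<open>s\<close> turns a family independent modulo \<open>J'\<close> into one
  independent modulo \<open>J\<close>, and conversely at most one element has to be dropped. Every
  finite codimension below is counted by iterating this step.\<close>

lemma codim_step:
  fixes s :: "'a::field poly poly"
  assumes J: "subspace2 J" and s: "s \<notin> J"
    and J': "\<And>h. h \<in> J' \<longleftrightarrow> (\<exists>c. h - const2 c * s \<in> J)"
  shows "codim J = codim J' + 1"
proof (rule antisym)
  show "codim J' + 1 \<le> codim J"
  proof -
    have *: "enat (card B) + 1 \<le> codim J" if B: "indep_mod J' B" for B
    proof -
      have sB: "s \<notin> B"
      proof
        assume "s \<in> B"
        have "s \<in> J'" using J J' [of s] by (auto intro!: exI [of _ 1] simp: subspace2_def)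
        moreover have "(\<Sum>b\<in>B. const2 (if b = s then 1 else 0) * b) = s"
        proof -
          have "(\<Sum>b\<in>B. const2 (if b = s then 1 else 0) * b) = (\<Sum>b\<in>B. if b = s then b else 0)"
            by (intro sum.cong) auto
          also have "\<dots> = s"
            using B \<open>s \<in> B\<close> by (simp add: indep_mod_def)
          finally show ?thesis .
        qed
        ultimately have "(\<Sum>b\<in>B. const2 (if b = s then 1 else 0) * b) \<in> J'" by simp
        then have "\<forall>b\<in>B. (if b = s then 1 else 0::'a) = 0"
          using B unfolding indep_mod_def by (auto dest!: spec [of _ "\<lambda>b. if b = s then 1 else 0"])
        then show False using \<open>s \<in> B\<close> by auto
      qed
      have "indep_mod J (insert s B)"
        unfolding indep_mod_def
      proof (intro conjI allI impI ballI)
        show "finite (insert s B)" using B by (simp add: indep_mod_def)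
        fix c b assume c: "(\<Sum>b\<in>insert s B. const2 (c b) * b) \<in> J" and b: "b \<in> insert s B"
        have eq: "(\<Sum>b\<in>insert s B. const2 (c b) * b) = const2 (c s) * s + (\<Sum>b\<in>B. const2 (c b) * b)"
          using B sB by (simp add: indep_mod_def)
        have "(\<Sum>b\<in>B. const2 (c b) * b) \<in> J'"
          unfolding J' by (rule exI [of _ "- c s"]) (use c eq in \<open>simp add: const2_uminus add.commute\<close>)
        then have 0: "\<forall>b\<in>B. c b = 0" using B unfolding indep_mod_def by blast
        then have "const2 (c s) * s \<in> J" using c eq by simp
        then have "c s = 0" using subspace2_const_cancel [OF J] s by blast
        with 0 b show "c b = 0" by auto
      qed
      then have "enat (card (insert s B)) \<le> codim J"
        unfolding codim_def by (intro Sup_upper) auto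
      then show ?thesis
        using B sB by (simp add: indep_mod_def eSuc_enat [symmetric] eSuc_plus_1)
    qed
    show ?thesis
    proof (cases "codim J")
      case (enat n)
      have "n \<ge> 1" using * [of "{}"] enat
        by (auto simp: indep_mod_def one_enat_def zero_enat_def)
      have "codim J' \<le> enat (n - 1)"
        unfolding codim_def
      proof (rule Sup_least, clarify)
        fix B assume "indep_mod J' B"
        from * [OF this] show "enat (card B) \<le> enat (n - 1)"
          unfolding enat by (simp add: one_enat_def)
      qed
      then have "codim J' + 1 \<le> enat (n - 1) + 1" by (rule add_right_mono)
      then show ?thesis using \<open>n \<ge> 1\<close> unfolding enat by (simp add: one_enat_def)
    qed simp
  qed
  show "codim J \<le> codim J' + 1"
    unfolding codim_def [of J]
  proof (rule Sup_least, clarify)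
    fix B assume B: "indep_mod J B"
    have fin: "finite B" using B by (simp add: indep_mod_def)
    have up: "enat (card A) \<le> codim J'" if "indep_mod J' A" for A
      unfolding codim_def by (rule Sup_upper) (use that in auto)
    show "enat (card B) \<le> codim J' + 1"
    proof (cases "indep_mod J' B")
      case True
      from up [OF this] have "enat (card B) + 0 \<le> codim J' + 1" by (rule add_mono) simp
      then show ?thesis by simp
    next
      case False
      then obtain c b0 where c: "(\<Sum>b\<in>B. const2 (c b) * b) \<in> J'" and b0: "b0 \<in> B" "c b0 \<noteq> 0"
        using fin unfolding indep_mod_def by blast
      from c obtain \<alpha> where \<alpha>: "(\<Sum>b\<in>B. const2 (c b) * b) - const2 \<alpha> * s \<in> J"
        unfolding J' by blast
      have "\<alpha> \<noteq> 0"
        using \<alpha> B b0 unfolding indep_mod_def by auto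
      \<comment> \<open>A relation \<open>d\<close> among the remaining elements lies in
        \<open>J\<close> up to \<beta> \<open>s\<close>, and \<open>c\<close> up to \<alpha>
        \<open>s\<close>. Subtracting \<beta> / \<alpha> times the latter cancels \<open>s\<close>.
        The resulting relation modulo \<open>J\<close> is trivial; at \<open>b0\<close>, where
        \<open>d\<close> counts as 0, this forces \<beta> = 0, and then \<open>d\<close>
        vanishes.\<close>
      have "indep_mod J' (B - {b0})"
        unfolding indep_mod_def
      proof (intro conjI allI impI)
        show "finite (B - {b0})" using fin by simp
        fix d assume "(\<Sum>b\<in>B - {b0}. const2 (d b) * b) \<in> J'"
        then obtain \<beta> where \<beta>: "(\<Sum>b\<in>B - {b0}. const2 (d b) * b) - const2 \<beta> * s \<in> J"
          unfolding J' by blast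
        let ?d = "\<lambda>b. if b = b0 then 0 else d b"
        have d: "(\<Sum>b\<in>B - {b0}. const2 (d b) * b) = (\<Sum>b\<in>B. const2 (?d b) * b)"
          using fin by (intro sum.mono_neutral_cong_left) auto
        have "((\<Sum>b\<in>B. const2 (?d b) * b) - const2 \<beta> * s)
                - const2 (\<beta> / \<alpha>) * ((\<Sum>b\<in>B. const2 (c b) * b) - const2 \<alpha> * s) \<in> J"
        proof (rule subspace2_diff [OF J])
          show "(\<Sum>b\<in>B. const2 (?d b) * b) - const2 \<beta> * s \<in> J" using \<beta> d by simp
          show "const2 (\<beta> / \<alpha>) * ((\<Sum>b\<in>B. const2 (c b) * b) - const2 \<alpha> * s) \<in> J"
            using \<alpha> J unfolding subspace2_def by blast
        qed
        also have "((\<Sum>b\<in>B. const2 (?d b) * b) - const2 \<beta> * s)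
                - const2 (\<beta> / \<alpha>) * ((\<Sum>b\<in>B. const2 (c b) * b) - const2 \<alpha> * s)
              = (\<Sum>b\<in>B. const2 (?d b - \<beta> / \<alpha> * c b) * b)"
        proof -
          have "const2 (\<beta> / \<alpha>) * const2 \<alpha> = const2 \<beta>"
            using \<open>\<alpha> \<noteq> 0\<close> by (simp flip: const2_mult)
          then have "const2 (\<beta> / \<alpha>) * (const2 \<alpha> * s) = const2 \<beta> * s"
            by (simp only: mult.assoc [symmetric])
          have "(\<Sum>b\<in>B. const2 (?d b - \<beta> / \<alpha> * c b) * b)
                  = (\<Sum>b\<in>B. const2 (?d b) * b - const2 (\<beta> / \<alpha>) * (const2 (c b) * b))"
            by (simp only: const2_diff const2_mult left_diff_distrib mult.assoc)
          also have "\<dots> = (\<Sum>b\<in>B. const2 (?d b) * b) - const2 (\<beta> / \<alpha>) * (\<Sum>b\<in>B. const2 (c b) * b)"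
            by (simp only: sum_subtractf sum_distrib_left)
          finally show ?thesis
            using \<open>const2 (\<beta> / \<alpha>) * (const2 \<alpha> * s) = const2 \<beta> * s\<close>
            by (simp only: right_diff_distrib) (simp add: algebra_simps)
        qed
        finally have *: "\<forall>b\<in>B. ?d b - \<beta> / \<alpha> * c b = 0"
          using indep_modD [OF B, where c = "\<lambda>b. ?d b - \<beta> / \<alpha> * c b"] by blast
        then have "\<beta> = 0" using b0 \<open>\<alpha> \<noteq> 0\<close> by force
        then show "\<forall>b\<in>B - {b0}. d b = 0" using * by (auto split: if_splits)
      qed
      from up [OF this] have "enat (card B - 1) \<le> codim J'"
        using fin b0 by simp
      then have "enat (card B - 1) + 1 \<le> codim J' + 1" by (rule add_right_mono)
      moreover have "card B > 0" using fin b0 by (auto simp: card_gt_0_iff)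
      ultimately show ?thesis by (simp add: one_enat_def)
    qed
  qed
qed

lemma codim_UNIV [simp]: "codim (UNIV :: 'a::field poly poly set) = 0"
proof -
  have "card B = 0" if "indep_mod UNIV B" for B :: "'a poly poly set"
    using that unfolding indep_mod_def by (auto dest: spec [of _ "\<lambda>_. 1"])
  then have "codim (UNIV :: 'a poly poly set) \<le> 0"
    unfolding codim_def by (intro Sup_least) (auto simp: zero_enat_def)
  then show ?thesis by simp
qed

section \<open>Local intersection multiplicity as a codimension\<close>

lemma eval2_mult: "eval2 (p * q :: 'a::comm_ring_1 poly poly) a b = eval2 p a b * eval2 q a b"
proof -
  interpret map_poly_comm_ring_hom "\<lambda>r. poly r a" ..
  show ?thesis by (simp add: eval2_def hom_mult)
qed

lemma eval2_1 [simp]: "eval2 (1 :: 'a::comm_ring_1 poly poly) a b = 1"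
  by (simp add: eval2_def)

lemma subspace2_in_loc_ideal: "subspace2 {h. in_loc_ideal f g a b h}"
  unfolding subspace2_def
proof (safe)
  show "in_loc_ideal f g a b 0"
    unfolding in_loc_ideal_def by (intro exI [of _ 0] exI [of _ 1]) auto
next
  fix x y assume "in_loc_ideal f g a b x" "in_loc_ideal f g a b y"
  then obtain p q w p' q' w' where
    1: "eval2 w a b \<noteq> 0" "w * x = p * f + q * g" and
    2: "eval2 w' a b \<noteq> 0" "w' * y = p' * f + q' * g"
    unfolding in_loc_ideal_def by blast
  have "w * w' * (x + y) = w' * (w * x) + w * (w' * y)" by (simp add: algebra_simps)
  also have "\<dots> = (w' * p + w * p') * f + (w' * q + w * q') * g"
    unfolding 1 2 by (simp add: algebra_simps)
  finally show "in_loc_ideal f g a b (x + y)"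
    unfolding in_loc_ideal_def using 1(1) 2(1) eval2_mult [of w w' a b]
    by (intro exI [of _ "w' * p + w * p'"] exI [of _ "w' * q + w * q'"] exI [of _ "w * w'"]) simp
next
  fix c x assume "in_loc_ideal f g a b x"
  then obtain p q w where 1: "eval2 w a b \<noteq> 0" "w * x = p * f + q * g"
    unfolding in_loc_ideal_def by blast
  have "w * (const2 c * x) = const2 c * (w * x)" by (simp add: algebra_simps)
  also have "\<dots> = (const2 c * p) * f + (const2 c * q) * g"
    unfolding 1 by (simp add: algebra_simps)
  finally show "in_loc_ideal f g a b (const2 c * x)"
    unfolding in_loc_ideal_def using 1(1)
    by (intro exI [of _ "const2 c * p"] exI [of _ "const2 c * q"] exI [of _ w]) simp
qed

text \<open>Clearing denominators is harmless: \<open>loc_indep\<close> tests the numerators only.\<close>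

lemma int_mult_aff_eq_codim:
  "int_mult_aff f g a b = codim {h. in_loc_ideal f g a b h}"
proof -
  let ?J = "{h. in_loc_ideal f g a b h}"
  have "{enat (length us) | us. loc_indep f g a b us} = {enat (card B) | B. indep_mod ?J B}"
  proof (intro equalityI subsetI)
    fix n assume "n \<in> {enat (length us) | us. loc_indep f g a b us}"
    then obtain us where n: "n = enat (length us)" and us: "loc_indep f g a b us" by blast
    define u where "u i = fst (us ! i) * (\<Prod>j\<in>{..<length us} - {i}. snd (us ! j))" for i
    have ind: "(\<Sum>i<length us. const2 (c i) * u i) \<notin> ?J" if "i < length us" "c i \<noteq> 0" for c i
      using us that unfolding loc_indep_def u_def by (auto simp: mult.assoc)
    \<comment> \<open>\<open>loc_indep\<close> takes lists and \<open>indep_mod\<close> takes sets: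
      two equal numerators would satisfy a relation with coefficients 1 and -1.\<close>
    have inj: "inj_on u {..<length us}"
    proof (rule inj_onI, rule ccontr)
      fix i j assume ij: "i \<in> {..<length us}" "j \<in> {..<length us}" "u i = u j" "i \<noteq> j"
      let ?c = "\<lambda>k. if k = i then 1 else if k = j then -1 else 0 :: 'a"
      have "(\<Sum>k<length us. const2 (?c k) * u k) = (\<Sum>k\<in>{i, j}. const2 (?c k) * u k)"
        using ij by (intro sum.mono_neutral_right) auto
      also have "\<dots> = 0" using ij by (simp add: const2_uminus)
      finally have "(\<Sum>k<length us. const2 (?c k) * u k) \<in> ?J"
        using subspace2_in_loc_ideal [of f g a b] by (simp only: subspace2_def)
      with ind [of i ?c] ij show False by auto
    qed
    have "indep_mod ?J (u ` {..<length us})"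
      unfolding indep_mod_def
    proof (intro conjI allI impI)
      fix c assume "(\<Sum>b\<in>u ` {..<length us}. const2 (c b) * b) \<in> ?J"
      then have "(\<Sum>i<length us. const2 (c (u i)) * u i) \<in> ?J"
        using inj by (simp add: sum.reindex)
      then show "\<forall>b\<in>u ` {..<length us}. c b = 0"
        using ind [of _ "\<lambda>i. c (u i)"] by blast
    qed simp
    moreover have "card (u ` {..<length us}) = length us"
      using inj by (simp add: card_image)
    ultimately show "n \<in> {enat (card B) | B. indep_mod ?J B}"
      unfolding n by (auto intro!: exI [of _ "u ` {..<length us}"])
  next
    fix n assume "n \<in> {enat (card B) | B. indep_mod ?J B}"
    then obtain B where n: "n = enat (card B)" and B: "indep_mod ?J B" by blast
    obtain bs where bs: "set bs = B" "distinct bs" "length bs = card B"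
      using finite_distinct_list [of B] B by (metis distinct_card indep_mod_def)
    let ?us = "map (\<lambda>b. (b, 1)) bs"
    have "loc_indep f g a b ?us"
      unfolding loc_indep_def
    proof (intro conjI allI impI)
      fix c assume "\<exists>i<length ?us. c i \<noteq> (0::'a)"
      then obtain i where i: "i < length bs" "c i \<noteq> 0" by auto
      define c' where "c' x = c (THE i. i < length bs \<and> bs ! i = x)" for x
      have c': "c' (bs ! i) = c i" if "i < length bs" for i
        unfolding c'_def
        by (rule arg_cong [of _ _ c], rule the_equality)
           (use that bs(2) in \<open>auto simp: nth_eq_iff_index_eq\<close>)
      have "(\<Sum>i<length ?us. const2 (c i) * fst (?us ! i) * (\<Prod>j\<in>{..<length ?us} - {i}. snd (?us ! j)))
              = (\<Sum>i<length bs. const2 (c' (bs ! i)) * (bs ! i))"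
        by (simp add: c')
      also have "\<dots> = (\<Sum>b\<in>B. const2 (c' b) * b)"
        using bs(1,2) by (intro sum.reindex_bij_betw bij_betw_nth) auto
      finally show "\<not> in_loc_ideal f g a b
         (\<Sum>i<length ?us. const2 (c i) * fst (?us ! i) * (\<Prod>j\<in>{..<length ?us} - {i}. snd (?us ! j)))"
        using B i c' [OF i(1)] bs(1) nth_mem [OF i(1)] unfolding indep_mod_def by auto
    qed auto
    then show "n \<in> {enat (length us) | us. loc_indep f g a b us}"
      unfolding n using bs(3) by (auto intro!: exI [of _ ?us])
  qed
  then show ?thesis unfolding int_mult_aff_def codim_def by simp
qed

subsection \<open>Lattices over a univariate polynomial ring\<close>

lemma mult_mat_vec_index:
  assumes "G \<in> carrier_mat N N" "z \<in> carrier_vec N" "i < N"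
  shows "(G *\<^sub>v z) $ i = (\<Sum>k<N. G $$ (i, k) * z $ k)"
  using assms by (simp add: scalar_prod_def row_def lessThan_atLeast0)

lemma mult_mat_vec_smult:
  fixes G :: "'a::comm_ring_1 mat"
  assumes "G \<in> carrier_mat N N" "z \<in> carrier_vec N"
  shows "G *\<^sub>v (k \<cdot>\<^sub>v z) = k \<cdot>\<^sub>v (G *\<^sub>v z)"
  using assms by (intro eq_vecI) auto

text \<open>Describes the column span after a replacement through the old matrix: entry
  \<open>j\<close> of \<open>z\<close> now multiplies \<open>y\<close>, and the other columns are
  untouched.\<close>

lemma replace_col_mult_vec:
  fixes G :: "'a::comm_ring_1 mat"
  assumes G: "G \<in> carrier_mat N N" and z: "z \<in> carrier_vec N" and y: "y \<in> carrier_vec N" and j: "j < N"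
  shows "replace_col G y j *\<^sub>v z = G *\<^sub>v vec N (\<lambda>i. if i = j then 0 else z $ i) + (z $ j) \<cdot>\<^sub>v y"
    (is "?l = ?r")
proof (rule eq_vecI)
  show "dim_vec ?l = dim_vec ?r" using G y by (simp add: replace_col_def)
  fix i assume "i < dim_vec ?r"
  then have i: "i < N" using y by simp
  have rc: "replace_col G y j \<in> carrier_mat N N" using G by (simp add: replace_col_def)
  have "?l $ i = (\<Sum>k<N. replace_col G y j $$ (i, k) * z $ k)"
    by (rule mult_mat_vec_index [OF rc z i])
  also have "\<dots> = (\<Sum>k<N. (if k = j then y $ i * z $ k else G $$ (i, k) * z $ k))"
    using G i by (intro sum.cong) (auto simp: replace_col_def)
  also have "\<dots> = (\<Sum>k<N. G $$ (i, k) * (if k = j then 0 else z $ k) + (if k = j then y $ i * z $ k else 0))"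
    by (intro sum.cong) auto
  also have "\<dots> = (\<Sum>k<N. G $$ (i, k) * (if k = j then 0 else z $ k)) + y $ i * z $ j"
    using j by (simp add: sum.distrib)
  also have "(\<Sum>k<N. G $$ (i, k) * (if k = j then 0 else z $ k))
      = (G *\<^sub>v vec N (\<lambda>i. if i = j then 0 else z $ i)) $ i"
    by (subst mult_mat_vec_index [OF G _ i]) auto
  finally show "?l $ i = ?r $ i"
    using i y G by (simp add: mult.commute)
qed

text \<open>A direct sum decomposition of \<open>k[u][v]\<close> into a free \<open>k[u]\<close>-module with basis \<open>e\<close>
  and the ideal generated by \<open>f\<close>. The set \<open>lat a G\<close> is the localization at \<open>u = a\<close> of the
  lattice spanned by the columns of \<open>G\<close>, plus that ideal.\<close>

locale free_complement =
  fixes N :: nat and e :: "nat \<Rightarrow> 'a::field poly poly" and f :: "'a poly poly"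
  assumes spanning: "\<And>h. \<exists>z p. z \<in> carrier_vec N \<and> h = (\<Sum>i<N. smult (z $ i) (e i)) + p * f"
    and independent: "\<And>z p. z \<in> carrier_vec N \<Longrightarrow> (\<Sum>i<N. smult (z $ i) (e i)) + p * f = 0 \<Longrightarrow> z = 0\<^sub>v N"
begin

definition \<Phi> :: "'a poly vec \<Rightarrow> 'a poly poly" where
  "\<Phi> z = (\<Sum>i<N. smult (z $ i) (e i))"

definition lat :: "'a \<Rightarrow> 'a poly mat \<Rightarrow> 'a poly poly set" where
  "lat a G = {h. \<exists>w z p. poly w a \<noteq> 0 \<and> z \<in> carrier_vec N \<and> smult w h = \<Phi> (G *\<^sub>v z) + p * f}"

lemma latI:
  assumes "poly w a \<noteq> 0" "z \<in> carrier_vec N" "smult w h = \<Phi> (G *\<^sub>v z) + p * f"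
  shows "h \<in> lat a G"
  using assms unfolding lat_def by blast

lemma latE:
  assumes "h \<in> lat a G"
  obtains w z p where "poly w a \<noteq> 0" "z \<in> carrier_vec N" "smult w h = \<Phi> (G *\<^sub>v z) + p * f"
  using assms unfolding lat_def by blast

lemma \<Phi>_add: "x \<in> carrier_vec N \<Longrightarrow> y \<in> carrier_vec N \<Longrightarrow> \<Phi> (x + y) = \<Phi> x + \<Phi> y"
  by (simp add: \<Phi>_def smult_add_left sum.distrib)

lemma \<Phi>_smult: "x \<in> carrier_vec N \<Longrightarrow> \<Phi> (w \<cdot>\<^sub>v x) = smult w (\<Phi> x)"
  by (simp add: \<Phi>_def smult_sum2)

lemma subspace2_lat:
  assumes G: "G \<in> carrier_mat N N"
  shows "subspace2 (lat a G)"
  unfolding subspace2_def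
proof (intro conjI ballI allI)
  show "0 \<in> lat a G"
    by (rule latI [of 1 _ "0\<^sub>v N" _ _ 0]) (use G in \<open>auto simp: \<Phi>_def\<close>)
next
  fix x y assume "x \<in> lat a G" "y \<in> lat a G"
  then obtain w z p w' z' p' where
    1: "poly w a \<noteq> 0" "z \<in> carrier_vec N" "smult w x = \<Phi> (G *\<^sub>v z) + p * f" and
    2: "poly w' a \<noteq> 0" "z' \<in> carrier_vec N" "smult w' y = \<Phi> (G *\<^sub>v z') + p' * f"
    by (metis latE)
  show "x + y \<in> lat a G"
  proof (rule latI)
    show "poly (w * w') a \<noteq> 0" using 1 2 by simp
    show "w' \<cdot>\<^sub>v z + w \<cdot>\<^sub>v z' \<in> carrier_vec N" using 1 2 by simp
    have "\<Phi> (G *\<^sub>v (w' \<cdot>\<^sub>v z + w \<cdot>\<^sub>v z')) = smult w' (\<Phi> (G *\<^sub>v z)) + smult w (\<Phi> (G *\<^sub>v z'))"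
      using G 1 2 by (simp add: mult_add_distrib_mat_vec [OF G] mult_mat_vec_smult [OF G] \<Phi>_add \<Phi>_smult)
    moreover have "smult (w * w') (x + y) = smult w' (smult w x) + smult w (smult w' y)"
      by (simp add: smult_add_right mult.commute)
    ultimately show "smult (w * w') (x + y) = \<Phi> (G *\<^sub>v (w' \<cdot>\<^sub>v z + w \<cdot>\<^sub>v z')) + (smult w' p + smult w p') * f"
      unfolding 1 2 by (simp add: algebra_simps smult_add_right)
  qed
next
  fix c x assume "x \<in> lat a G"
  then obtain w z p where
    1: "poly w a \<noteq> 0" "z \<in> carrier_vec N" "smult w x = \<Phi> (G *\<^sub>v z) + p * f"
    by (metis latE)
  show "const2 c * x \<in> lat a G"
  proof (rule latI [OF 1(1)])
    show "[:c:] \<cdot>\<^sub>v z \<in> carrier_vec N" using 1 by simp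
    have "smult w (const2 c * x) = smult [:c:] (smult w x)"
      by (simp add: const2_def mult.commute)
    then show "smult w (const2 c * x) = \<Phi> (G *\<^sub>v ([:c:] \<cdot>\<^sub>v z)) + smult [:c:] p * f"
      using G 1 by (simp add: mult_mat_vec_smult [OF G] \<Phi>_smult smult_add_right)
  qed
qed

text \<open>The adjugate shows that \<open>det G\<close> annihilates the quotient by the lattice. If
  the determinant is a unit at u = a, the localized lattice is everything; for the Sylvester matrix
  and \<open>h = 1\<close> the resultant is seen to lie in the ideal.\<close>

lemma smult_det_eq:
  assumes G: "G \<in> carrier_mat N N"
  obtains z p where "z \<in> carrier_vec N" "smult (det G) h = \<Phi> (G *\<^sub>v z) + p * f"
proof -
    obtain z p where z: "z \<in> carrier_vec N" and h: "h = \<Phi> z + p * f"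
      using spanning [of h] unfolding \<Phi>_def by blast
    have adj: "adj_mat G \<in> carrier_mat N N" "G * adj_mat G = det G \<cdot>\<^sub>m 1\<^sub>m N"
      using adj_mat [OF G] by auto
    have "G *\<^sub>v (adj_mat G *\<^sub>v z) = det G \<cdot>\<^sub>v z"
    proof -
      have "G *\<^sub>v (adj_mat G *\<^sub>v z) = (det G \<cdot>\<^sub>m 1\<^sub>m N) *\<^sub>v z"
        using assoc_mult_mat_vec [OF G adj(1) z] adj(2) by simp
      also have "\<dots> = det G \<cdot>\<^sub>v z"
      proof (rule eq_vecI)
        fix i assume "i < dim_vec (det G \<cdot>\<^sub>v z)"
        then have i: "i < N" using z by simp
        have "((det G \<cdot>\<^sub>m 1\<^sub>m N) *\<^sub>v z) $ i = (\<Sum>k<N. (det G \<cdot>\<^sub>m 1\<^sub>m N) $$ (i, k) * z $ k)"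
          by (rule mult_mat_vec_index) (use z i in auto)
        also have "\<dots> = (\<Sum>k<N. if k = i then det G * z $ k else 0)"
          using i by (intro sum.cong) auto
        finally show "((det G \<cdot>\<^sub>m 1\<^sub>m N) *\<^sub>v z) $ i = (det G \<cdot>\<^sub>v z) $ i"
          using i z by simp
      qed (use z in auto)
      finally show ?thesis .
    qed
    then have "smult (det G) h = \<Phi> (G *\<^sub>v (adj_mat G *\<^sub>v z)) + smult (det G) p * f"
      using z by (simp add: h \<Phi>_smult smult_add_right)
    then show ?thesis using adj z by (intro that [of "adj_mat G *\<^sub>v z" "smult (det G) p"]) auto
qed

lemma lat_eq_UNIV:
  assumes "G \<in> carrier_mat N N" "poly (det G) a \<noteq> 0"
  shows "lat a G = UNIV"
proof -
  have "h \<in> lat a G" for h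
    by (rule smult_det_eq [OF assms(1), of h]) (rule latI [OF assms(2)])
  then show ?thesis by auto
qed

text \<open>Induction on the order. If u - a divides the determinant, \<open>G\<close> at u = a
  kills a constant vector \<open>c0\<close>, so u - a divides \<open>G c\<close>. Replacing a column
  \<open>j\<close> with \<open>c0 $ j\<close> nonzero by \<open>y = G c / (u - a)\<close> divides
  the determinant by u - a, up to a constant, and enlarges the lattice by exactly one dimension,
  spanned by the class of \<open>y\<close>.\<close>

lemma codim_lat:
  assumes "G \<in> carrier_mat N N" "det G \<noteq> 0"
  shows "codim (lat a G) = enat (order a (det G))"
  using assms
proof (induction "order a (det G)" arbitrary: G)
  case 0
  then have "poly (det G) a \<noteq> 0" by (simp add: order_eq_0_iff)
  with 0 show ?case by (simp add: lat_eq_UNIV zero_enat_def)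
next
  case (Suc n G)
  note G = Suc.prems(1)
  let ?X = "[:-a, 1:]"
  have "poly (det G) a = 0" using Suc by (metis order_0I nat.distinct(1))
  define G0 where "G0 = map_mat (\<lambda>p. poly p a) G"
  have G0: "G0 \<in> carrier_mat N N" using G by (simp add: G0_def)
  have "det G0 = 0"
  proof -
    have "comm_ring_hom (\<lambda>p. poly p a)" ..
    from comm_ring_hom.hom_det [OF this, of G] show ?thesis
      using \<open>poly (det G) a = 0\<close> by (simp add: G0_def)
  qed
  then obtain c0 where c0: "c0 \<in> carrier_vec N" "c0 \<noteq> 0\<^sub>v N" "G0 *\<^sub>v c0 = 0\<^sub>v N"
    using det_0_iff_vec_prod_zero_field [OF G0] by blast
  then obtain j where j: "j < N" "c0 $ j \<noteq> 0"
    by (metis carrier_vecD eq_vecI index_zero_vec(1) index_zero_vec(2))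
  define c where "c = map_vec (\<lambda>x. [:x:]) c0"
  have c: "c \<in> carrier_vec N" using c0 by (simp add: c_def)
  have Gc: "G *\<^sub>v c \<in> carrier_vec N" using G c by simp
  have root: "poly ((G *\<^sub>v c) $ i) a = 0" if "i < N" for i
  proof -
    have "poly ((G *\<^sub>v c) $ i) a = (\<Sum>k<N. poly (G $$ (i, k)) a * c0 $ k)"
      unfolding mult_mat_vec_index [OF G c that] using c0 by (simp add: poly_sum c_def mult.commute)
    also have "\<dots> = (G0 *\<^sub>v c0) $ i"
      unfolding mult_mat_vec_index [OF G0 c0(1) that] using that G by (simp add: G0_def)
    finally show ?thesis using c0 that by simp
  qed
  define y where "y = vec N (\<lambda>i. (G *\<^sub>v c) $ i div ?X)"
  have y: "y \<in> carrier_vec N" by (simp add: y_def)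
  have Xy: "?X \<cdot>\<^sub>v y = G *\<^sub>v c"
  proof (rule eq_vecI)
    fix i assume "i < dim_vec (G *\<^sub>v c)"
    then have i: "i < N" using G by simp
    have "?X dvd (G *\<^sub>v c) $ i" using root [OF i] by (simp add: poly_eq_0_iff_dvd)
    then show "(?X \<cdot>\<^sub>v y) $ i = (G *\<^sub>v c) $ i"
      using i dvd_mult_div_cancel [of ?X "(G *\<^sub>v c) $ i"]
      by (simp add: y_def del: index_mult_mat_vec mult_pCons_left)
  qed (use G in \<open>simp add: y_def\<close>)
  define G' where "G' = replace_col G y j"
  have G': "G' \<in> carrier_mat N N" using G by (simp add: G'_def replace_col_def)
  have G'z: "G' *\<^sub>v z = G *\<^sub>v vec N (\<lambda>i. if i = j then 0 else z $ i) + (z $ j) \<cdot>\<^sub>v y"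
    if "z \<in> carrier_vec N" for z
    unfolding G'_def by (rule replace_col_mult_vec [OF G that y j(1)])
  \<comment> \<open>Cramer's rule for the same right-hand side \<open>G c\<close>: it is
    \<open>G\<close> times \<open>c\<close> and \<open>G'\<close> times u - a in position
    \<open>j\<close>, and the two matrices agree once column \<open>j\<close> is replaced.\<close>
  have det: "?X * det G' = smult (c0 $ j) (det G)"
  proof -
    let ?x = "vec N (\<lambda>i. if i = j then ?X else 0)"
    have "G' *\<^sub>v ?x = G *\<^sub>v vec N (\<lambda>i. if i = j then 0 else ?x $ i) + (?x $ j) \<cdot>\<^sub>v y"
      by (rule G'z) simp
    also have "vec N (\<lambda>i. if i = j then 0 else ?x $ i) = 0\<^sub>v N" by auto
    also have "(?x $ j) \<cdot>\<^sub>v y = G *\<^sub>v c" using j Xy by simp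
    also have "G *\<^sub>v 0\<^sub>v N + G *\<^sub>v c = G *\<^sub>v c" using G c by (intro eq_vecI) auto
    finally have "G' *\<^sub>v ?x = G *\<^sub>v c" .
    moreover have "replace_col G' b j = replace_col G b j" for b
      by (auto simp: G'_def replace_col_def)
    ultimately have "det (replace_col G' (G' *\<^sub>v ?x) j) = det (replace_col G (G *\<^sub>v c) j)" by simp
    then have "?x $ j * det G' = c $ j * det G"
      using cramer_lemma_mat [OF G', of ?x j] cramer_lemma_mat [OF G c, of j] j by simp
    then show ?thesis using j c0 by (simp add: c_def)
  qed
  have "det G' \<noteq> 0" using det Suc.prems(2) j by auto
  have ord: "order a (det G) = Suc (order a (det G'))"
  proof -
    have "order a (det G) = order a (?X * det G')"
      unfolding det using j by (simp add: order_smult)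
    also have "\<dots> = order a ?X + order a (det G')"
      using \<open>det G' \<noteq> 0\<close> by (intro order_mult) (simp del: mult_pCons_left)
    also have "order a ?X = 1" using order_power_n_n [of a 1] by simp
    finally show ?thesis by simp
  qed
  have IH: "codim (lat a G') = enat n"
    using Suc.hyps(1) [of G'] Suc.hyps(2) G' \<open>det G' \<noteq> 0\<close> ord by simp
  have XY: "smult ?X (\<Phi> y) = \<Phi> (G *\<^sub>v c)"
    using Xy \<Phi>_smult [OF y] by metis
  have "codim (lat a G) = codim (lat a G') + 1"
  proof (rule codim_step [OF subspace2_lat [OF G]])
    \<comment> \<open>Multiplied by u - a, a representation of \<open>y\<close> gives
      \<open>G (w c - (u - a) z) = 0\<close> by independence. As \<open>G\<close> is injective,
      \<open>w c = (u - a) z\<close>, which fails in entry \<open>j\<close> at u = a.\<close>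
    show "\<Phi> y \<notin> lat a G"
    proof
      assume "\<Phi> y \<in> lat a G"
      then obtain w z p where *: "poly w a \<noteq> 0" "z \<in> carrier_vec N" "smult w (\<Phi> y) = \<Phi> (G *\<^sub>v z) + p * f"
        by (rule latE)
      let ?d = "w \<cdot>\<^sub>v c + (- ?X) \<cdot>\<^sub>v z"
      have d: "?d \<in> carrier_vec N" using c * by simp
      have "smult ?X (smult w (\<Phi> y)) = smult w (\<Phi> (G *\<^sub>v c))"
        using XY by (metis smult_smult mult.commute)
      then have "smult w (\<Phi> (G *\<^sub>v c)) = smult ?X (\<Phi> (G *\<^sub>v z)) + smult ?X p * f"
        unfolding * by (simp add: smult_add_right)
      moreover have "\<Phi> (G *\<^sub>v ?d) = smult w (\<Phi> (G *\<^sub>v c)) + smult (- ?X) (\<Phi> (G *\<^sub>v z))"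
        using G c * by (simp add: mult_add_distrib_mat_vec [OF G] mult_mat_vec_smult [OF G] \<Phi>_add \<Phi>_smult)
      ultimately have "\<Phi> (G *\<^sub>v ?d) + smult (- ?X) p * f = 0"
        by (simp only: smult_minus_left minus_mult_left [symmetric]) simp
      then have "G *\<^sub>v ?d = 0\<^sub>v N"
        unfolding \<Phi>_def by (intro independent mult_mat_vec_carrier [OF G d])
      then have "?d = 0\<^sub>v N"
        using det_0_iff_vec_prod_zero [OF G] Suc.prems(2) d by blast
      then have "?d $ j = 0" using j by simp
      then have "w * [:c0 $ j:] + (- ?X) * z $ j = 0"
        using j c0(1) * by (simp add: c_def del: mult_pCons_left mult_pCons_right)
      then have "poly (w * [:c0 $ j:] + (- ?X) * z $ j) a = 0" by simp
      then show False using j * by simp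
    qed
  next
    fix h
    show "h \<in> lat a G' \<longleftrightarrow> (\<exists>\<alpha>. h - const2 \<alpha> * \<Phi> y \<in> lat a G)"
    proof
      assume "h \<in> lat a G'"
      then obtain w z p where *: "poly w a \<noteq> 0" "z \<in> carrier_vec N" "smult w h = \<Phi> (G' *\<^sub>v z) + p * f"
        by (rule latE)
      define z' where "z' = vec N (\<lambda>i. if i = j then 0 else z $ i)"
      have z': "z' \<in> carrier_vec N" by (simp add: z'_def)
      \<comment> \<open>With this scalar u - a divides \<open>z $ j - \<alpha> w\<close>, and
        multiples of \<open>(u - a) y = G c\<close> already lie in the old lattice.\<close>
      define \<alpha> where "\<alpha> = poly (z $ j) a / poly w a"
      have "poly (z $ j - smult \<alpha> w) a = 0" using *(1) by (simp add: \<alpha>_def)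
      then obtain r where r: "z $ j - smult \<alpha> w = ?X * r"
        by (metis poly_eq_0_iff_dvd dvdE)
      have "h - const2 \<alpha> * \<Phi> y \<in> lat a G"
      proof (rule latI [OF *(1)])
        show "z' + r \<cdot>\<^sub>v c \<in> carrier_vec N" using z' c by simp
        have "smult w (h - const2 \<alpha> * \<Phi> y) = smult w h - smult (smult \<alpha> w) (\<Phi> y)"
          by (simp add: smult_diff_right const2_def mult.commute)
        also have "smult w h = \<Phi> (G *\<^sub>v z') + smult (z $ j) (\<Phi> y) + p * f"
          using G'z [OF *(2)] G z' y unfolding * z'_def [symmetric] by (simp add: \<Phi>_add \<Phi>_smult)
        also have "\<Phi> (G *\<^sub>v z') + smult (z $ j) (\<Phi> y) + p * f - smult (smult \<alpha> w) (\<Phi> y)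
            = \<Phi> (G *\<^sub>v z') + smult (z $ j - smult \<alpha> w) (\<Phi> y) + p * f"
          by (simp add: smult_diff_left)
        also have "smult (z $ j - smult \<alpha> w) (\<Phi> y) = smult r (\<Phi> (G *\<^sub>v c))"
          unfolding r XY [symmetric] by (simp only: smult_smult mult.commute)
        finally show "smult w (h - const2 \<alpha> * \<Phi> y) = \<Phi> (G *\<^sub>v (z' + r \<cdot>\<^sub>v c)) + p * f"
          using G z' c by (simp add: mult_add_distrib_mat_vec [OF G] mult_mat_vec_smult [OF G] \<Phi>_add \<Phi>_smult)
      qed
      then show "\<exists>\<alpha>. h - const2 \<alpha> * \<Phi> y \<in> lat a G" ..
    next
      assume "\<exists>\<alpha>. h - const2 \<alpha> * \<Phi> y \<in> lat a G"
      then obtain \<alpha> w z p where *: "poly w a \<noteq> 0" "z \<in> carrier_vec N"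
          "smult w (h - const2 \<alpha> * \<Phi> y) = \<Phi> (G *\<^sub>v z) + p * f"
        by (metis latE)
      \<comment> \<open>Column \<open>j\<close> of \<open>G\<close> is gone in \<open>G'\<close>.
        Subtracting \<open>t c\<close> clears entry \<open>j\<close> of \<open>z\<close>, and the
        lost \<open>t G c = t (u - a) y\<close> returns as part of the coefficient of
        \<open>y\<close>.\<close>
      define t where "t = smult (inverse (c0 $ j)) (z $ j)"
      define z1 where "z1 = z + (- t) \<cdot>\<^sub>v c"
      have z1: "z1 \<in> carrier_vec N" using * c by (simp add: z1_def)
      define z' where "z' = vec N (\<lambda>i. if i = j then t * ?X + smult \<alpha> w else z1 $ i)"
      have z': "z' \<in> carrier_vec N" by (simp add: z'_def)
      have "z1 $ j = 0" using j *(2) c c0(1) by (simp add: z1_def c_def t_def)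
      then have z1': "vec N (\<lambda>i. if i = j then 0 else z' $ i) = z1"
        using z1 by (intro eq_vecI) (auto simp: z'_def)
      show "h \<in> lat a G'"
      proof (rule latI [OF *(1) z'])
        have "smult w (h - const2 \<alpha> * \<Phi> y) = smult w h - smult (smult \<alpha> w) (\<Phi> y)"
          by (simp add: smult_diff_right const2_def mult.commute)
        then have h: "smult w h = \<Phi> (G *\<^sub>v z) + p * f + smult (smult \<alpha> w) (\<Phi> y)"
          unfolding * by (metis diff_add_cancel)
        have "\<Phi> (G' *\<^sub>v z') = \<Phi> (G *\<^sub>v z1) + smult (z' $ j) (\<Phi> y)"
          using G'z [OF z'] G z1 y unfolding z1' by (simp add: \<Phi>_add \<Phi>_smult)
        also have "smult (z' $ j) (\<Phi> y) = smult t (\<Phi> (G *\<^sub>v c)) + smult (smult \<alpha> w) (\<Phi> y)"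
        proof -
          have "z' $ j = t * ?X + smult \<alpha> w" using j by (simp add: z'_def)
          then show ?thesis
            unfolding XY [symmetric] by (simp only: smult_add_left smult_smult)
        qed
        also have "\<Phi> (G *\<^sub>v z1) = \<Phi> (G *\<^sub>v z) - smult t (\<Phi> (G *\<^sub>v c))"
          using G * c by (simp add: z1_def mult_add_distrib_mat_vec [OF G] mult_mat_vec_smult [OF G] \<Phi>_add \<Phi>_smult)
        finally show "smult w h = \<Phi> (G' *\<^sub>v z') + p * f"
          unfolding h by (simp add: algebra_simps)
      qed
    qed
  qed
  then show ?case
    unfolding IH using Suc.hyps(2) by (simp add: one_enat_def)
qed

end

subsection \<open>Codimension and the resultant\<close>

definition line_ideal :: "'a::field poly poly \<Rightarrow> 'a poly poly \<Rightarrow> 'a \<Rightarrow> 'a poly poly set" where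
  "line_ideal f g a = {h. \<exists>w p q. poly w a \<noteq> 0 \<and> smult w h = p * f + q * g}"

text \<open>Pseudo-division scales \<open>h\<close> by a power of the leading coefficient, which is
  a unit here. The remainder is bounded through its coefficients, since for constant
  \<open>f\<close> the remainder 0 does not have degree below \<open>degree f\<close>.\<close>

lemma division_unit_lead_coeff:
  fixes f h :: "'a::field poly poly"
  assumes lc: "lead_coeff f = [:c:]" "c \<noteq> 0"
  obtains q r where "h = q * f + r" "\<And>i. i \<ge> degree f \<Longrightarrow> coeff r i = 0"
proof -
  have f: "f \<noteq> 0" using lc by auto
  obtain q r where qr: "pseudo_divmod h f = (q, r)" by force
  define k where "k = Suc (degree h) - degree f"
  have 1: "smult ([:c:] ^ k) h = f * q + r" "r = 0 \<or> degree r < degree f"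
    using pseudo_divmod [OF f qr] unfolding lc k_def by auto
  have ck: "[:c:] ^ k = [:c ^ k:]" by (simp add: poly_const_pow)
  define d where "d = inverse (c ^ k)"
  have "smult [:d:] (smult [:c ^ k:] h) = h" using lc by (simp add: d_def pCons_one)
  then have "h = smult [:d:] q * f + smult [:d:] r"
    using 1(1) unfolding ck by (simp add: smult_add_right mult.commute)
  moreover have "coeff (smult [:d:] r) i = 0" if "i \<ge> degree f" for i
    using 1(2) that by (auto simp: coeff_eq_0)
  ultimately show ?thesis by (rule that)
qed

lemma poly_eq_sum_monom_rev:
  assumes "\<And>i. i \<ge> n \<Longrightarrow> coeff p i = 0"
  shows "(\<Sum>i<n. monom (coeff p (n - Suc i)) (n - Suc i)) = p"
proof -
  have "(\<Sum>i<n. monom (coeff p (n - Suc i)) (n - Suc i)) = (\<Sum>i<n. monom (coeff p i) i)"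
    by (rule sum.nat_diff_reindex)
  also have "\<dots> = p"
    by (rule poly_eqI) (use assms in \<open>auto simp: coeff_sum not_less\<close>)
  finally show ?thesis .
qed

lemma sum_lessThan_add:
  fixes h :: "nat \<Rightarrow> 'a::comm_monoid_add"
  shows "(\<Sum>i<m + n. h i) = (\<Sum>i<m. h i) + (\<Sum>i<n. h (m + i))"
  by (induction n) (auto simp: add.assoc)

locale sylvester_module =
  fixes f g :: "'a::field poly poly" and c :: 'a
  assumes lc: "lead_coeff f = [:c:]" "c \<noteq> 0"
begin

definition N where "N = degree f + degree g"
text \<open>Descending powers, to match the order of the columns of the Sylvester matrix.\<close>

definition e where "e i = monom (1 :: 'a poly) (N - Suc i)"
text \<open>A multiple of \<open>f\<close> of degree \<open>N\<close>, so that remainders have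
  \<open>N\<close> coefficients and adding the ideal of \<open>f'\<close> does not leave the ideal
  of \<open>f\<close> and \<open>g\<close>.\<close>

definition f' where "f' = monom 1 (degree g) * f"
definition G where "G = transpose_mat (sylvester_mat f g)"
text \<open>The polynomial whose coefficients fill row \<open>i\<close> of the Sylvester matrix: a
  power of v times \<open>f\<close> or \<open>g\<close>. \<open>G\<close> is the transpose because
  \<open>lat\<close> uses columns.\<close>

definition rowp where
  "rowp i = (if i < degree g then monom 1 (degree g - Suc i) * f else monom 1 (N - Suc i) * g)"

lemma G_carrier: "G \<in> carrier_mat N N"
  unfolding G_def N_def by (simp add: sylvester_carrier_mat)

lemma det_G: "det G = resultant f g"
  unfolding G_def resultant_def by (rule det_transpose) (rule sylvester_carrier_mat)

lemma coeff_basis_sum: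
  "coeff (\<Sum>i<N. smult (z $ i) (e i)) k = (if k < N then z $ (N - Suc k) else 0)"
proof -
  have "(\<Sum>i<N. smult (z $ i) (e i)) = (\<Sum>i<N. monom (z $ i) (N - Suc i))"
    by (simp add: e_def smult_monom)
  also have "\<dots> = (\<Sum>i<N. monom (z $ (N - Suc (N - Suc i))) (N - Suc i))"
    by (intro sum.cong) auto
  also have "\<dots> = (\<Sum>i<N. monom (z $ (N - Suc i)) i)"
    by (rule sum.nat_diff_reindex)
  finally show ?thesis by (simp add: coeff_sum)
qed

lemma degree_f': "degree f' = N" and lc_f': "lead_coeff f' = [:c:]"
proof -
  have "f \<noteq> 0" using lc by auto
  then show "degree f' = N"
    by (simp add: f'_def N_def degree_mult_eq degree_monom_eq add.commute)
  show "lead_coeff f' = [:c:]"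
    unfolding f'_def by (simp only: lead_coeff_mult) (simp add: lc degree_monom_eq)
qed

sublocale free_complement N e f'
proof
  fix h :: "'a poly poly"
  obtain q r where qr: "h = q * f' + r" "\<And>i. i \<ge> N \<Longrightarrow> coeff r i = 0"
    using division_unit_lead_coeff [OF lc_f' lc(2)] unfolding degree_f' by metis
  let ?z = "vec N (\<lambda>i. coeff r (N - Suc i))"
  have "r = (\<Sum>i<N. smult (?z $ i) (e i))"
    by (rule poly_eqI, unfold coeff_basis_sum) (use qr(2) in auto)
  then show "\<exists>z p. z \<in> carrier_vec N \<and> h = (\<Sum>i<N. smult (z $ i) (e i)) + p * f'"
    using qr(1) by (intro exI [of _ ?z] exI [of _ q]) (simp add: add.commute)
next
  fix z p assume z: "z \<in> carrier_vec N" and 0: "(\<Sum>i<N. smult (z $ i) (e i)) + p * f' = 0"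
  have "p = 0"
  proof (rule ccontr)
    assume "p \<noteq> 0"
    have f'0: "f' \<noteq> 0" using lc_f' lc(2) by auto
    have "coeff ((\<Sum>i<N. smult (z $ i) (e i)) + p * f') (degree (p * f')) = lead_coeff (p * f')"
      using degree_mult_eq [OF \<open>p \<noteq> 0\<close> f'0] degree_f' by (simp add: coeff_basis_sum)
    then show False using 0 \<open>p \<noteq> 0\<close> f'0 by simp
  qed
  then have "(\<Sum>i<N. smult (z $ i) (e i)) = 0" using 0 by simp
  then have *: "coeff (\<Sum>i<N. smult (z $ i) (e i)) (N - Suc i) = 0" for i by simp
  have "z $ i = 0" if "i < N" for i
    using * [of i] that unfolding coeff_basis_sum by (simp split: if_splits)
  then show "z = 0\<^sub>v N"
    using z by (intro eq_vecI) auto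
qed

lemma coeff_rowp:
  assumes "i < N"
  shows "coeff (rowp i) k = (if k < N then sylvester_mat f g $$ (i, N - Suc k) else 0)"
proof (cases "k < N")
  case True
  then have j: "N - Suc k < degree f + degree g" "i < degree f + degree g"
    using assms by (auto simp: N_def)
  show ?thesis
    unfolding sylvester_index_mat [OF j(2,1)] rowp_def using True assms
    by (auto simp: N_def coeff_monom_mult coeff_eq_0 intro!: arg_cong [of _ _ "coeff f"] arg_cong [of _ _ "coeff g"])
next
  case False
  then show ?thesis using assms
    by (auto simp: rowp_def N_def coeff_monom_mult intro!: coeff_eq_0)
qed

lemma \<Phi>_G:
  assumes z: "z \<in> carrier_vec N"
  shows "\<Phi> (G *\<^sub>v z) = (\<Sum>i<N. smult (z $ i) (rowp i))"
proof (rule poly_eqI)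
  fix k
  show "coeff (\<Phi> (G *\<^sub>v z)) k = coeff (\<Sum>i<N. smult (z $ i) (rowp i)) k"
  proof (cases "k < N")
    case True
    then have "(G *\<^sub>v z) $ (N - Suc k) = (\<Sum>i<N. sylvester_mat f g $$ (i, N - Suc k) * z $ i)"
      by (subst mult_mat_vec_index [OF G_carrier z]) (auto simp: G_def N_def)
    then show ?thesis
      unfolding \<Phi>_def coeff_basis_sum using True
      by (simp add: coeff_sum coeff_rowp mult.commute del: index_mult_mat_vec)
  next
    case False
    then show ?thesis
      unfolding \<Phi>_def coeff_basis_sum by (simp add: coeff_sum coeff_rowp)
  qed
qed

text \<open>The first \<open>degree g\<close> entries of \<open>z\<close> form the cofactor of
  \<open>f\<close> and the others that of \<open>g\<close>: the lattice consists of the combinations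
  with cofactors of degree below \<open>degree g\<close> and \<open>degree f\<close>.\<close>

lemma \<Phi>_G':
  assumes z: "z \<in> carrier_vec N"
  shows "\<Phi> (G *\<^sub>v z) = (\<Sum>i<degree g. monom (z $ i) (degree g - Suc i)) * f
     + (\<Sum>i<degree f. monom (z $ (degree g + i)) (degree f - Suc i)) * g"
proof -
  have "\<Phi> (G *\<^sub>v z) = (\<Sum>i<degree g + degree f. smult (z $ i) (rowp i))"
    unfolding \<Phi>_G [OF z] by (simp add: N_def add.commute)
  also have "\<dots> = (\<Sum>i<degree g. smult (z $ i) (rowp i))
      + (\<Sum>i<degree f. smult (z $ (degree g + i)) (rowp (degree g + i)))"
    by (rule sum_lessThan_add)
  also have "(\<Sum>i<degree g. smult (z $ i) (rowp i)) = (\<Sum>i<degree g. monom (z $ i) (degree g - Suc i)) * f"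
    by (simp add: rowp_def sum_distrib_right smult_monom flip: mult_smult_left)
  also have "(\<Sum>i<degree f. smult (z $ (degree g + i)) (rowp (degree g + i)))
      = (\<Sum>i<degree f. monom (z $ (degree g + i)) (degree f - Suc i)) * g"
    by (simp add: rowp_def sum_distrib_right smult_monom N_def flip: mult_smult_left)
  finally show ?thesis .
qed

text \<open>Any combination \<open>p * f + q * g\<close> can be brought to bounded cofactors: reduce
  \<open>q\<close> modulo \<open>f\<close>, moving the quotient into \<open>p\<close>, then reduce
  \<open>p\<close> modulo v^(deg g), where the quotient contributes a multiple of
  \<open>f'\<close>.\<close>

lemma lat_eq_line_ideal: "lat a G = line_ideal f g a"
proof (intro equalityI subsetI)
  fix h assume "h \<in> lat a G"
  then obtain w z p where *: "poly w a \<noteq> 0" "z \<in> carrier_vec N" "smult w h = \<Phi> (G *\<^sub>v z) + p * f'"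
    by (rule latE)
  then have "smult w h = ((\<Sum>i<degree g. monom (z $ i) (degree g - Suc i)) + p * monom 1 (degree g)) * f
     + (\<Sum>i<degree f. monom (z $ (degree g + i)) (degree f - Suc i)) * g"
    by (simp add: \<Phi>_G' f'_def algebra_simps)
  with * show "h \<in> line_ideal f g a" unfolding line_ideal_def by blast
next
  fix h assume "h \<in> line_ideal f g a"
  then obtain w p q where *: "poly w a \<noteq> 0" "smult w h = p * f + q * g"
    unfolding line_ideal_def by blast
  obtain q0 q1 where q: "q = q0 * f + q1" "\<And>i. i \<ge> degree f \<Longrightarrow> coeff q1 i = 0"
    using division_unit_lead_coeff [OF lc] by metis
  define p' where "p' = p + q0 * g"
  define n where "n = degree g"
  have lcm: "lead_coeff (monom 1 n :: 'a poly poly) = [:1:]"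
    by (simp add: degree_monom_eq pCons_one)
  obtain p2 p1 where p: "p' = p2 * monom 1 n + p1" "\<And>i. i \<ge> n \<Longrightarrow> coeff p1 i = 0"
    by (rule division_unit_lead_coeff [OF lcm, of p']) (auto simp: degree_monom_eq)
  define z where "z = vec N (\<lambda>i. if i < n then coeff p1 (n - Suc i) else coeff q1 (N - Suc i))"
  have z: "z \<in> carrier_vec N" by (simp add: z_def)
  have 1: "(\<Sum>i<n. monom (z $ i) (n - Suc i)) = p1"
    using p(2) by (subst poly_eq_sum_monom_rev [symmetric, of n p1])
      (auto simp: z_def N_def n_def intro!: sum.cong)
  have 2: "(\<Sum>i<degree f. monom (z $ (n + i)) (degree f - Suc i)) = q1"
    using q(2) by (subst poly_eq_sum_monom_rev [symmetric, of "degree f" q1])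
      (auto simp: z_def N_def n_def intro!: sum.cong)
  have "smult w h = \<Phi> (G *\<^sub>v z) + p2 * f'"
    unfolding \<Phi>_G' [OF z] n_def [symmetric] 1 2 *
    using p(1) by (simp add: p'_def q(1) f'_def n_def algebra_simps)
       (metis (no_types, lifting) add.assoc distrib_left mult.commute)
  with * z show "h \<in> lat a G" by (intro latI)
qed

lemma codim_line_ideal:
  assumes "resultant f g \<noteq> 0"
  shows "codim (line_ideal f g a) = enat (order a (resultant f g))"
  using codim_lat [OF G_carrier] assms unfolding det_G lat_eq_line_ideal by simp

lemma resultant_in_ideal: "\<exists>p q. [:resultant f g:] = p * f + q * g"
proof -
  obtain z p where z: "z \<in> carrier_vec N" "smult (det G) 1 = \<Phi> (G *\<^sub>v z) + p * f'"
    using smult_det_eq [OF G_carrier] by blast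
  then have "[:resultant f g:] = ((\<Sum>i<degree g. monom (z $ i) (degree g - Suc i)) + p * monom 1 (degree g)) * f
     + (\<Sum>i<degree f. monom (z $ (degree g + i)) (degree f - Suc i)) * g"
    by (simp add: \<Phi>_G' f'_def algebra_simps det_G)
  then show ?thesis by blast
qed

end

subsection \<open>Decomposition into local multiplicities\<close>

definition ideal2 :: "'a::field poly poly set \<Rightarrow> bool" where
  "ideal2 J \<longleftrightarrow> 0 \<in> J \<and> (\<forall>x\<in>J. \<forall>y\<in>J. x + y \<in> J) \<and> (\<forall>t. \<forall>x\<in>J. t * x \<in> J)"

text \<open>The contraction to k[u][v] of the extension of \<open>J\<close> to the local ring at (a,
  b). Staying in the polynomial ring keeps \<open>codim\<close> applicable.\<close>

definition loc :: "'a::field \<Rightarrow> 'a \<Rightarrow> 'a poly poly set \<Rightarrow> 'a poly poly set" where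
  "loc a b J = {h. \<exists>w. eval2 w a b \<noteq> 0 \<and> w * h \<in> J}"

lemma ideal2_subspace2: "ideal2 J \<Longrightarrow> subspace2 J"
  unfolding ideal2_def subspace2_def by blast

lemma ideal2_add: "ideal2 J \<Longrightarrow> x \<in> J \<Longrightarrow> y \<in> J \<Longrightarrow> x + y \<in> J"
  unfolding ideal2_def by blast

lemma ideal2_mult: "ideal2 J \<Longrightarrow> x \<in> J \<Longrightarrow> t * x \<in> J"
  unfolding ideal2_def by blast

lemma ideal2_diff: "ideal2 J \<Longrightarrow> x \<in> J \<Longrightarrow> y \<in> J \<Longrightarrow> x - y \<in> J"
  by (rule subspace2_diff [OF ideal2_subspace2])

lemma eval2_altdef: "eval2 h a b = poly (poly h [:b:]) a"
proof -
  have "comm_semiring_hom (\<lambda>r. poly r a)" ..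
  from comm_semiring_hom.poly_map_poly [OF this, of h "[:b:]"] show ?thesis
    by (simp add: eval2_def)
qed

lemma eval2_const2 [simp]: "eval2 (const2 c) a b = c"
  by (simp add: eval2_altdef const2_def)

lemma eval2_add: "eval2 (p + q) a b = eval2 p a b + eval2 q a b"
  by (simp add: eval2_altdef)

lemma taylor2:
  fixes h :: "'a::field poly poly"
  shows "\<exists>q r. h = q * [:-[:b:], 1:] + r * [:[:-a, 1:]:] + const2 (eval2 h a b)"
proof -
  have "poly (h - [:poly h [:b:]:]) [:b:] = 0" by simp
  then obtain q where q: "h - [:poly h [:b:]:] = [:-[:b:], 1:] * q"
    by (metis poly_eq_0_iff_dvd dvdE)
  have "poly (poly h [:b:] - [:eval2 h a b:]) a = 0" by (simp add: eval2_altdef)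
  then obtain r where r: "poly h [:b:] - [:eval2 h a b:] = [:-a, 1:] * r"
    by (metis poly_eq_0_iff_dvd dvdE)
  have "h = q * [:-[:b:], 1:] + [:poly h [:b:]:]"
    using q by (metis diff_add_cancel mult.commute)
  also have "[:poly h [:b:]:] = [:[:-a, 1:] * r:] + const2 (eval2 h a b)"
    using r unfolding const2_def by (metis add_0_right add_pCons diff_add_cancel)
  also have "[:[:-a, 1:] * r:] = [:r:] * [:[:-a, 1:]:]"
    by (simp add: mult.commute)
  finally show ?thesis by (metis add.assoc)
qed

text \<open>h - h(a, b) lies in the maximal ideal generated by u - a and v - b, both of which send
  \<open>s\<close> into \<open>J\<close>.\<close>

lemma mult_eigen:
  fixes s :: "'a::field poly poly"
  assumes J: "ideal2 J" and "[:-[:b:], 1:] * s \<in> J" "[:[:-a, 1:]:] * s \<in> J"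
  shows "h * s - const2 (eval2 h a b) * s \<in> J"
proof -
  obtain q r where "h = q * [:-[:b:], 1:] + r * [:[:-a, 1:]:] + const2 (eval2 h a b)"
    using taylor2 by blast
  then have "h * s - const2 (eval2 h a b) * s = q * ([:-[:b:], 1:] * s) + r * ([:[:-a, 1:]:] * s)"
    by (metis (no_types, lifting) add_diff_cancel_right' distrib_right mult.assoc)
  also have "\<dots> \<in> J"
    by (rule ideal2_add [OF J ideal2_mult [OF J assms(2)] ideal2_mult [OF J assms(3)]])
  finally show ?thesis .
qed

text \<open>A nonzero polynomial in v sends \<open>s\<close> into \<open>J\<close>. Its linear
  factors are split off one by one; the last product still outside \<open>J\<close> is an
  eigenvector of v.\<close>

lemma eigenvector_exists_aux:
  fixes p :: "'a::alg_closed_field poly"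
  assumes J: "ideal2 J" and "p \<noteq> 0" "s \<notin> J" "map_poly (\<lambda>c. [:c:]) p * s \<in> J"
  shows "\<exists>b t. t * s \<notin> J \<and> [:-[:b:], 1:] * (t * s) \<in> J"
  using assms(2-)
proof (induction "degree p" arbitrary: p)
  case 0
  then obtain c where "p = [:c:]" by (metis degree_eq_zeroE)
  with 0 have "const2 c * s \<in> J" "c \<noteq> 0" by (auto simp: const2_def)
  then have "s \<in> J" by (metis subspace2_const_cancel ideal2_subspace2 J)
  with 0 show ?case by simp
next
  case (Suc n)
  then obtain b where "poly p b = 0" using alg_closed_imp_poly_has_root [of p] by auto
  then obtain p' where p': "p = [:-b, 1:] * p'" by (metis poly_eq_0_iff_dvd dvdE)
  have "p' \<noteq> 0" using Suc p' by auto
  have deg: "n = degree p'"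
    using Suc.hyps(2) \<open>p' \<noteq> 0\<close> unfolding p' by (subst (asm) degree_mult_eq) auto
  let ?t = "map_poly (\<lambda>c. [:c:]) p'"
  have "map_poly (\<lambda>c. [:c:]) p = map_poly (\<lambda>c. [:c:]) [:-b, 1:] * ?t"
  proof -
    interpret map_poly_comm_ring_hom "\<lambda>c. [:c:] :: 'a poly" ..
    show ?thesis unfolding p' by (rule hom_mult)
  qed
  also have "map_poly (\<lambda>c. [:c:]) [:-b, 1:] = [:-[:b:], 1:]"
    by (simp add: map_poly_pCons pCons_one)
  finally have eq: "map_poly (\<lambda>c. [:c:]) p = [:-[:b:], 1:] * ?t" .
  show ?case
  proof (cases "?t * s \<in> J")
    case True
    then show ?thesis using Suc.hyps(1) [OF deg \<open>p' \<noteq> 0\<close> Suc.prems(2)] by blast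
  next
    case False
    moreover have "[:-[:b:], 1:] * (?t * s) \<in> J"
      using Suc.prems(3) unfolding eq by (simp only: mult.assoc)
    ultimately show ?thesis by blast
  qed
qed

text \<open>The last power of u - a outside \<open>J\<close> is an eigenvector of u. On it
  \<open>f\<close> acts as its restriction \<open>fa\<close> to u = a, which is a nonzero polynomial
  in v because the leading coefficient of \<open>f\<close> is a constant. Multiples found by the
  previous lemma stay eigenvectors of u.\<close>

lemma eigenvector_exists:
  fixes J :: "'a::alg_closed_field poly poly set"
  assumes J: "ideal2 J" "J \<noteq> UNIV" and f: "f \<in> J" "lead_coeff f = [:c:]" "c \<noteq> 0"
    and m: "[:[:-a, 1:]:] ^ m \<in> J"
  shows "\<exists>b s. s \<notin> J \<and> [:-[:b:], 1:] * s \<in> J \<and> [:[:-a, 1:]:] * s \<in> J"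
proof -
  let ?X = "[:[:-a, 1:]:]"
  have "1 \<notin> J" using J ideal2_mult [OF J(1), of 1] by auto
  define i where "i = (LEAST i. ?X ^ i \<in> J)"
  have i: "?X ^ i \<in> J" unfolding i_def by (rule LeastI) (rule m)
  have "i \<noteq> 0" using i \<open>1 \<notin> J\<close> by (metis power_0)
  then obtain k where k: "i = Suc k" by (cases i) auto
  define s where "s = ?X ^ k"
  have s: "s \<notin> J" using not_less_Least [of k "\<lambda>i. ?X ^ i \<in> J"] k unfolding i_def s_def by auto
  have Xs: "?X * s \<in> J" using i unfolding k s_def by simp
  define p where "p = map_poly (\<lambda>r. poly r a) f"
  have "coeff p (degree f) = c" using f by (simp add: p_def coeff_map_poly)
  then have "p \<noteq> 0" using f by auto
  define fa where "fa = map_poly (\<lambda>c. [:c:]) p"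
  have "\<exists>q. f - fa = q * ?X"
  proof -
    have "[:-a, 1:] dvd coeff (f - fa) n" for n
      unfolding poly_eq_0_iff_dvd [symmetric] by (simp add: fa_def p_def coeff_map_poly)
    then have "?X dvd f - fa" by (simp add: const_poly_dvd_iff)
    then show ?thesis by (metis dvdE mult.commute)
  qed
  then obtain q where q: "f - fa = q * ?X" by blast
  have "fa * s = s * f - q * (?X * s)"
    by (simp only: mult.assoc [symmetric] q [symmetric]) (simp only: algebra_simps)
  also have "\<dots> \<in> J"
    by (rule ideal2_diff [OF J(1) ideal2_mult [OF J(1) f(1)] ideal2_mult [OF J(1) Xs]])
  finally have "map_poly (\<lambda>c. [:c:]) p * s \<in> J" by (simp add: fa_def)
  from eigenvector_exists_aux [OF J(1) \<open>p \<noteq> 0\<close> s this]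
  obtain b t where "t * s \<notin> J" "[:-[:b:], 1:] * (t * s) \<in> J" by blast
  moreover have "?X * (t * s) \<in> J"
    using ideal2_mult [OF J(1) Xs, of t] by (simp only: mult.left_commute)
  ultimately show ?thesis by blast
qed

text \<open>v - b0 is a unit at (a, b) and sends \<open>s\<close> into \<open>J\<close>, so
  \<open>s\<close> is already in the localization.\<close>

lemma loc_mono_eigen:
  assumes "ideal2 J" "[:-[:b0:], 1:] * s \<in> J" "b \<noteq> b0"
    and J': "\<And>h. h \<in> J' \<longleftrightarrow> (\<exists>c. h - const2 c * s \<in> J)"
  shows "loc a b J' = loc a b J"
proof (intro equalityI subsetI)
  fix h assume "h \<in> loc a b J'"
  then obtain w c where w: "eval2 w a b \<noteq> 0" "w * h - const2 c * s \<in> J"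
    unfolding loc_def using J' by blast
  have "[:-[:b0:], 1:] * (w * h - const2 c * s) + const2 c * ([:-[:b0:], 1:] * s) \<in> J"
    by (rule ideal2_add [OF assms(1) ideal2_mult [OF assms(1) w(2)] ideal2_mult [OF assms(1,2)]])
  also have "[:-[:b0:], 1:] * (w * h - const2 c * s) + const2 c * ([:-[:b0:], 1:] * s) = ([:-[:b0:], 1:] * w) * h"
    by (simp only: algebra_simps)
  finally show "h \<in> loc a b J"
    unfolding loc_def using w(1) assms(3) eval2_mult [of "[:-[:b0:], 1:]" w a b]
    by (intro CollectI exI [of _ "[:-[:b0:], 1:] * w"]) (simp add: eval2_altdef)
next
  fix h assume "h \<in> loc a b J"
  then obtain w where w: "eval2 w a b \<noteq> 0" "w * h \<in> J"
    unfolding loc_def by blast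
  then have "w * h \<in> J'" unfolding J' by (intro exI [of _ 0]) simp
  with w show "h \<in> loc a b J'" unfolding loc_def by blast
qed

lemma subspace2_loc:
  assumes J: "ideal2 J"
  shows "subspace2 (loc a b J)"
  unfolding subspace2_def
proof (intro conjI ballI allI)
  show "0 \<in> loc a b J"
    unfolding loc_def using J by (auto simp: ideal2_def intro!: exI [of _ 1])
next
  fix x y assume "x \<in> loc a b J" "y \<in> loc a b J"
  then obtain w w' where w: "eval2 w a b \<noteq> 0" "w * x \<in> J" "eval2 w' a b \<noteq> 0" "w' * y \<in> J"
    unfolding loc_def by blast
  have "w' * (w * x) + w * (w' * y) \<in> J" 
    by (rule ideal2_add [OF J ideal2_mult [OF J w(2)] ideal2_mult [OF J w(4)]])
  then have "(w * w') * (x + y) \<in> J" by (simp add: algebra_simps)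
  moreover have "eval2 (w * w') a b \<noteq> 0" using w by (simp add: eval2_mult)
  ultimately show "x + y \<in> loc a b J" unfolding loc_def by blast
next
  fix c x assume "x \<in> loc a b J"
  then obtain w where w: "eval2 w a b \<noteq> 0" "w * x \<in> J"
    unfolding loc_def by blast
  have "const2 c * (w * x) \<in> J" by (rule ideal2_mult [OF J w(2)])
  then show "const2 c * x \<in> loc a b J"
    unfolding loc_def using w(1) by (intro CollectI exI [of _ w]) (simp add: algebra_simps)
qed

text \<open>A denominator \<open>w\<close> acts on \<open>s\<close> as the nonzero scalar w(a, b).
  Hence \<open>s\<close> stays outside the localization, and a multiple of \<open>s\<close> modulo
  \<open>J\<close> can be divided by \<open>w\<close> by adjusting its coefficient.\<close>

lemma codim_loc_eigen:
  assumes J: "ideal2 J" and s: "[:-[:b:], 1:] * s \<in> J" "[:[:-a, 1:]:] * s \<in> J" "s \<notin> J"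
    and J': "\<And>h. h \<in> J' \<longleftrightarrow> (\<exists>c. h - const2 c * s \<in> J)"
  shows "codim (loc a b J) = codim (loc a b J') + 1"
proof (rule codim_step [OF subspace2_loc [OF J]])
  note eigen = mult_eigen [OF J s(1,2)]
  show "s \<notin> loc a b J"
  proof
    assume "s \<in> loc a b J"
    then obtain w where w: "eval2 w a b \<noteq> 0" "w * s \<in> J" unfolding loc_def by blast
    have "w * s - (w * s - const2 (eval2 w a b) * s) \<in> J"
      by (rule ideal2_diff [OF J w(2) eigen])
    then have "const2 (eval2 w a b) * s \<in> J" by simp
    then have "s \<in> J" using w(1) subspace2_const_cancel [OF ideal2_subspace2 [OF J]] by blast
    with s show False by blast
  qed
  fix h
  show "h \<in> loc a b J' \<longleftrightarrow> (\<exists>c. h - const2 c * s \<in> loc a b J)"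
  proof
    assume "h \<in> loc a b J'"
    then obtain w \<beta> where w: "eval2 w a b \<noteq> 0" "w * h - const2 \<beta> * s \<in> J"
      unfolding loc_def using J' by blast
    define \<alpha> where "\<alpha> = \<beta> / eval2 w a b"
    have c: "const2 \<alpha> * const2 (eval2 w a b) = const2 \<beta>"
      using w(1) by (simp add: \<alpha>_def flip: const2_mult)
    have "(w * h - const2 \<beta> * s) - const2 \<alpha> * (w * s - const2 (eval2 w a b) * s) \<in> J"
      by (rule ideal2_diff [OF J w(2) ideal2_mult [OF J eigen]])
    also have "(w * h - const2 \<beta> * s) - const2 \<alpha> * (w * s - const2 (eval2 w a b) * s)
        = w * (h - const2 \<alpha> * s) - const2 \<beta> * s + (const2 \<alpha> * const2 (eval2 w a b)) * s"
      by (simp only: algebra_simps)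
    finally have "w * (h - const2 \<alpha> * s) \<in> J" by (simp add: c)
    then show "\<exists>c. h - const2 c * s \<in> loc a b J" unfolding loc_def using w(1) by blast
  next
    assume "\<exists>c. h - const2 c * s \<in> loc a b J"
    then obtain \<alpha> w where w: "eval2 w a b \<noteq> 0" "w * (h - const2 \<alpha> * s) \<in> J"
      unfolding loc_def by blast
    have "w * (h - const2 \<alpha> * s) + const2 \<alpha> * (w * s - const2 (eval2 w a b) * s) \<in> J"
      by (rule ideal2_add [OF J w(2) ideal2_mult [OF J eigen]])
    also have "w * (h - const2 \<alpha> * s) + const2 \<alpha> * (w * s - const2 (eval2 w a b) * s)
        = w * h - const2 (\<alpha> * eval2 w a b) * s"
      by (simp only: algebra_simps const2_mult)
    finally have "w * h \<in> J'" unfolding J' by blast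
    then show "h \<in> loc a b J'" unfolding loc_def using w(1) by blast
  qed
qed

text \<open>Induction on the codimension, adjoining one common eigenvector at a time.
  \<open>Z\<close> may contain points that are no common zeros, and it stays the same while
  \<open>J\<close> grows.\<close>

lemma codim_eq_sum_loc:
  fixes J :: "'a::alg_closed_field poly poly set"
  assumes "ideal2 J" "f \<in> J" "g \<in> J" "lead_coeff f = [:c:]" "c \<noteq> 0" "[:[:-a, 1:]:] ^ m \<in> J"
    and Z: "finite Z" "\<And>b. eval2 f a b = 0 \<Longrightarrow> eval2 g a b = 0 \<Longrightarrow> b \<in> Z"
    and "codim J = enat n"
  shows "(\<Sum>b\<in>Z. codim (loc a b J)) = enat n"
  using assms(1-3,6,9)
proof (induction n arbitrary: J)
  case 0
  have "J = UNIV"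
  proof (rule ccontr)
    assume "J \<noteq> UNIV"
    then obtain s where s: "s \<notin> J" by blast
    define J' where "J' = {h. \<exists>c. h - const2 c * s \<in> J}"
    have "codim J = codim J' + 1"
      by (rule codim_step [OF ideal2_subspace2 [OF 0(1)] s]) (simp add: J'_def)
    with 0 show False by (cases "codim J'") (auto simp: one_enat_def zero_enat_def)
  qed
  then have "loc a b J = UNIV" for b
    unfolding loc_def by (auto intro!: exI [of _ 1])
  then show ?case by (simp flip: zero_enat_def)
next
  case (Suc n)
  note J = \<open>ideal2 J\<close>
  have "J \<noteq> UNIV" using Suc.prems(5) by (auto simp: zero_enat_def)
  from eigenvector_exists [OF J this Suc.prems(2) assms(4,5) Suc.prems(4)]
  obtain b0 s where s: "s \<notin> J" "[:-[:b0:], 1:] * s \<in> J" "[:[:-a, 1:]:] * s \<in> J" by blast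
  note eigen = mult_eigen [OF J s(2,3)]
  define J' where "J' = {h. \<exists>c. h - const2 c * s \<in> J}"
  have J': "h \<in> J' \<longleftrightarrow> (\<exists>c. h - const2 c * s \<in> J)" for h by (simp add: J'_def)
  have JJ': "h \<in> J'" if "h \<in> J" for h
    unfolding J' using that by (intro exI [of _ 0]) simp
  \<comment> \<open>\<open>h * s\<close> is in \<open>J\<close> and equals h(a, b0) \<open>s\<close>
    modulo \<open>J\<close>. Applied to \<open>f\<close> and \<open>g\<close> this places the
    eigenvalue in \<open>Z\<close>.\<close>
  have zero: "eval2 h a b0 = 0" if "h \<in> J" for h
  proof (rule ccontr)
    assume "eval2 h a b0 \<noteq> 0"
    have "s * h - (h * s - const2 (eval2 h a b0) * s) \<in> J"
      by (rule ideal2_diff [OF J ideal2_mult [OF J that] eigen])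
    then have "const2 (eval2 h a b0) * s \<in> J" by (simp add: mult.commute)
    then show False
      using subspace2_const_cancel [OF ideal2_subspace2 [OF J]] s(1) \<open>eval2 h a b0 \<noteq> 0\<close> by blast
  qed
  have b0: "b0 \<in> Z" using Z(2) zero Suc.prems by blast
  have idJ': "ideal2 J'"
    unfolding ideal2_def
  proof (intro conjI ballI allI)
    show "0 \<in> J'" using JJ' J unfolding ideal2_def by blast
  next
    fix x y assume "x \<in> J'" "y \<in> J'"
    then obtain c d where "x - const2 c * s \<in> J" "y - const2 d * s \<in> J" unfolding J' by blast
    then have "(x - const2 c * s) + (y - const2 d * s) \<in> J" by (rule ideal2_add [OF J])
    then have "x + y - const2 (c + d) * s \<in> J" by (simp add: const2_add algebra_simps)
    then show "x + y \<in> J'" unfolding J' by blast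
  next
    fix t x assume "x \<in> J'"
    then obtain c where c: "x - const2 c * s \<in> J" unfolding J' by blast
    have "t * (x - const2 c * s) + const2 c * (t * s - const2 (eval2 t a b0) * s) \<in> J"
      by (rule ideal2_add [OF J ideal2_mult [OF J c] ideal2_mult [OF J eigen]])
    also have "t * (x - const2 c * s) + const2 c * (t * s - const2 (eval2 t a b0) * s)
        = t * x - const2 (c * eval2 t a b0) * s"
      by (simp only: algebra_simps const2_mult)
    finally show "t * x \<in> J'" unfolding J' by blast
  qed
  have "codim J = codim J' + 1"
    by (rule codim_step [OF ideal2_subspace2 [OF J] s(1) J'])
  then have n: "codim J' = enat n"
    using Suc.prems(5) by (cases "codim J'") (auto simp: one_enat_def)
  have IH: "(\<Sum>b\<in>Z. codim (loc a b J')) = enat n"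
    using Suc.prems JJ' by (intro Suc.IH idJ' n) auto
  have "(\<Sum>b\<in>Z. codim (loc a b J)) = codim (loc a b0 J) + (\<Sum>b\<in>Z - {b0}. codim (loc a b J))"
    by (rule sum.remove [OF Z(1) b0])
  also have "(\<Sum>b\<in>Z - {b0}. codim (loc a b J)) = (\<Sum>b\<in>Z - {b0}. codim (loc a b J'))"
    using loc_mono_eigen [OF J s(2) _ J'] by (intro sum.cong) auto
  also have "codim (loc a b0 J) = codim (loc a b0 J') + 1"
    by (rule codim_loc_eigen [OF J s(2,3,1) J'])
  also have "codim (loc a b0 J') + 1 + (\<Sum>b\<in>Z - {b0}. codim (loc a b J')) = (\<Sum>b\<in>Z. codim (loc a b J')) + 1"
    by (simp only: sum.remove [OF Z(1) b0] ac_simps)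
  finally show ?case unfolding IH by (simp add: one_enat_def)
qed

theorem sum_int_mult_aff_eq_order_resultant:
  fixes f g :: "'a::alg_closed_field poly poly"
  assumes lc: "lead_coeff f = [:c:]" "c \<noteq> 0" and res: "resultant f g \<noteq> 0"
    and Z: "finite Z" "\<And>b. eval2 f a b = 0 \<Longrightarrow> eval2 g a b = 0 \<Longrightarrow> b \<in> Z"
  shows "(\<Sum>b\<in>Z. int_mult_aff f g a b) = enat (order a (resultant f g))"
proof -
  interpret sylvester_module f g c by unfold_locales (fact lc)+
  let ?J = "line_ideal f g a"
  have ideal: "ideal2 ?J"
    unfolding ideal2_def
  proof (intro conjI ballI allI)
    show "0 \<in> ?J"
      unfolding line_ideal_def by (intro CollectI exI [of _ 1] exI [of _ 0]) simp
  next
    fix x y assume "x \<in> ?J" "y \<in> ?J"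
    then obtain w p q w' p' q' where *: "poly w a \<noteq> 0" "smult w x = p * f + q * g"
        "poly w' a \<noteq> 0" "smult w' y = p' * f + q' * g"
      unfolding line_ideal_def by blast
    have "smult (w * w') (x + y) = smult w' (smult w x) + smult w (smult w' y)"
      by (simp add: smult_add_right mult.commute)
    also have "\<dots> = (smult w' p + smult w p') * f + (smult w' q + smult w q') * g"
      unfolding * by (simp add: algebra_simps smult_add_right)
    finally have "smult (w * w') (x + y) = \<dots>" .
    moreover have "poly (w * w') a \<noteq> 0" using * by simp
    ultimately show "x + y \<in> ?J" unfolding line_ideal_def by blast
  next
    fix t x assume "x \<in> ?J"
    then obtain w p q where *: "poly w a \<noteq> 0" "smult w x = p * f + q * g"
      unfolding line_ideal_def by blast
    have "smult w (t * x) = t * smult w x" by simp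
    also have "\<dots> = (t * p) * f + (t * q) * g" unfolding * by (simp add: algebra_simps)
    finally show "t * x \<in> ?J" using *(1) unfolding line_ideal_def by blast
  qed
  have f: "f \<in> ?J"
    unfolding line_ideal_def by (intro CollectI exI [of _ 1] exI [of _ 0]) simp
  have g: "g \<in> ?J"
    unfolding line_ideal_def by (rule CollectI, rule exI [of _ 1], rule exI [of _ 0], rule exI [of _ 1]) simp
  \<comment> \<open>The resultant lies in the ideal, and its part prime to u - a is a permitted
    denominator.\<close>
  have pow: "[:[:-a, 1:]:] ^ order a (resultant f g) \<in> ?J"
  proof -
    obtain w where w: "resultant f g = [:-a, 1:] ^ order a (resultant f g) * w" "poly w a \<noteq> 0"
      using order_decomp [OF res] by (metis poly_eq_0_iff_dvd)
    obtain p q where pq: "[:resultant f g:] = p * f + q * g" using resultant_in_ideal by blast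
    have "smult w ([:[:-a, 1:]:] ^ order a (resultant f g)) = [:resultant f g:]"
      using w(1) by (simp add: poly_const_pow mult.commute)
    with w(2) pq show ?thesis unfolding line_ideal_def by auto
  qed
  \<comment> \<open>Denominators in u alone that do not vanish at \<open>a\<close> are units at
    every (a, b), so localizing at the line first changes nothing.\<close>
  have "loc a b ?J = {h. in_loc_ideal f g a b h}" for b
  proof (intro equalityI subsetI)
    fix h assume "h \<in> loc a b ?J"
    then obtain w w' p q where *: "eval2 w a b \<noteq> 0" "poly w' a \<noteq> 0" "smult w' (w * h) = p * f + q * g"
      unfolding loc_def line_ideal_def by blast
    have "([:w':] * w) * h = p * f + q * g" using *(3) by simp
    moreover have "eval2 ([:w':] * w) a b \<noteq> 0"
      using *(1,2) unfolding eval2_mult by (simp add: eval2_altdef)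
    ultimately show "h \<in> {h. in_loc_ideal f g a b h}" unfolding in_loc_ideal_def by blast
  next
    fix h assume "h \<in> {h. in_loc_ideal f g a b h}"
    then obtain p q w where *: "eval2 w a b \<noteq> 0" "w * h = p * f + q * g"
      unfolding in_loc_ideal_def by blast
    then have "w * h \<in> ?J"
      unfolding line_ideal_def by (intro CollectI exI [of _ 1] exI [of _ p] exI [of _ q]) simp
    with * show "h \<in> loc a b ?J" unfolding loc_def by blast
  qed
  then have "int_mult_aff f g a b = codim (loc a b ?J)" for b
    by (simp add: int_mult_aff_eq_codim)
  moreover have "(\<Sum>b\<in>Z. codim (loc a b ?J)) = enat (order a (resultant f g))"
    by (rule codim_eq_sum_loc [OF ideal f g lc pow Z codim_line_ideal [OF res]])
  ultimately show ?thesis by simp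
qed

subsection \<open>Homogeneity\<close>

text \<open>Here \<open>P e x\<close> means that \<open>x\<close> is homogeneous of degree
  \<open>e\<close>. Only closure properties are recorded, which is what a determinant expansion
  uses, so one resultant lemma serves all the nested polynomial rings.\<close>

definition graded :: "(int \<Rightarrow> 'a::comm_ring_1 \<Rightarrow> bool) \<Rightarrow> bool" where
  "graded P \<longleftrightarrow> (\<forall>e. P e 0) \<and> P 0 1 \<and> (\<forall>e x y. P e x \<longrightarrow> P e y \<longrightarrow> P e (x + y)) \<and>
     (\<forall>e x. P e x \<longrightarrow> P e (- x)) \<and> (\<forall>e e' x y. P e x \<longrightarrow> P e' y \<longrightarrow> P (e + e') (x * y))"

lemma graded_0: "graded P \<Longrightarrow> P e 0"
  and graded_1: "graded P \<Longrightarrow> P 0 1"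
  and graded_add: "graded P \<Longrightarrow> P e x \<Longrightarrow> P e y \<Longrightarrow> P e (x + y)"
  and graded_uminus: "graded P \<Longrightarrow> P e x \<Longrightarrow> P e (- x)"
  and graded_mult: "graded P \<Longrightarrow> P e x \<Longrightarrow> P e' y \<Longrightarrow> P (e + e') (x * y)"
  unfolding graded_def by blast+

lemma graded_diff: "graded P \<Longrightarrow> P e x \<Longrightarrow> P e y \<Longrightarrow> P e (x - y)"
  using graded_add [of P e x "- y"] graded_uminus [of P e y] by simp

lemma graded_sum:
  assumes "graded P" "\<And>i. i \<in> A \<Longrightarrow> P e (h i)"
  shows "P e (\<Sum>i\<in>A. h i)"
  using assms(2) by (induction A rule: infinite_finite_induct)
    (auto intro: graded_0 [OF assms(1)] graded_add [OF assms(1)])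

lemma graded_prod:
  assumes "graded P" "\<And>i. i \<in> A \<Longrightarrow> P (e i) (h i)"
  shows "P (\<Sum>i\<in>A. e i) (\<Prod>i\<in>A. h i)"
  using assms(2) by (induction A rule: infinite_finite_induct)
    (auto intro: graded_1 [OF assms(1)] graded_mult [OF assms(1)])

definition gr0 :: "int \<Rightarrow> 'a::zero \<Rightarrow> bool" where
  "gr0 e c \<longleftrightarrow> c = 0 \<or> e = 0"

text \<open>\<open>w\<close> is the weight of the new variable: 1 for the t's and 0 for the x's.
  Degrees are integers, so that the difference can be negative, where \<open>gr0\<close> admits only
  0.\<close>

definition gr_poly :: "nat \<Rightarrow> (int \<Rightarrow> 'a::zero \<Rightarrow> bool) \<Rightarrow> int \<Rightarrow> 'a poly \<Rightarrow> bool" where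
  "gr_poly w P e p \<longleftrightarrow> (\<forall>i. P (e - int (w * i)) (coeff p i))"

lemma graded_gr0: "graded (gr0 :: int \<Rightarrow> 'a::comm_ring_1 \<Rightarrow> bool)"
  unfolding graded_def gr0_def by auto

lemma graded_gr_poly:
  assumes P: "graded P"
  shows "graded (gr_poly w P)"
  unfolding graded_def
proof (intro conjI allI impI)
  show "gr_poly w P e 0" for e using graded_0 [OF P] by (simp add: gr_poly_def)
  show "gr_poly w P 0 1"
    using graded_0 [OF P] graded_1 [OF P] by (simp add: gr_poly_def coeff_1)
  show "gr_poly w P e (x + y)" if "gr_poly w P e x" "gr_poly w P e y" for e x y
    using that graded_add [OF P] by (simp add: gr_poly_def)
  show "gr_poly w P e (- x)" if "gr_poly w P e x" for e x
    using that graded_uminus [OF P] by (simp add: gr_poly_def)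
  show "gr_poly w P (e + e') (x * y)" if x: "gr_poly w P e x" and y: "gr_poly w P e' y" for e e' x y
    unfolding gr_poly_def coeff_mult
  proof (intro allI graded_sum [OF P])
    fix n i :: nat assume "i \<in> {..n}"
    then have "e - int (w * i) + (e' - int (w * (n - i))) = e + e' - int (w * n)"
      by (simp add: of_nat_diff algebra_simps)
    moreover have "P (e - int (w * i) + (e' - int (w * (n - i)))) (coeff x i * coeff y (n - i))"
      using x y unfolding gr_poly_def by (intro graded_mult [OF P]) auto
    ultimately show "P (e + e' - int (w * n)) (coeff x i * coeff y (n - i))" by (simp only:)
  qed
qed

text \<open>Entry (i, j) of the Sylvester matrix has weight j - i, increased by n =
  \<open>degree g\<close> in the m = \<open>degree f\<close> rows belonging to \<open>g\<close>.
  Along a permutation the differences cancel, so every product has weight m n.\<close>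

lemma graded_resultant:
  assumes P: "graded P"
    and f: "\<And>k. P (int (degree f) - int k) (coeff f k)"
    and g: "\<And>k. P (int (degree g) - int k) (coeff g k)"
  shows "P (int (degree f * degree g)) (resultant f g)"
proof -
  define m n N where "m = degree f" and "n = degree g" and "N = m + n"
  let ?S = "sylvester_mat f g"
  let ?\<omega> = "\<lambda>i j. int j - int i + (if i < n then 0 else int n)"
  have entry: "P (?\<omega> i j) (?S $$ (i, j))" if ij: "i < N" "j < N" for i j
  proof -
    have ij': "i < degree f + degree g" "j < degree f + degree g"
      using ij by (auto simp: N_def m_def n_def)
    show ?thesis
    proof (cases "i < n")
      case True
      have "P (int j - int i) (coeff f (m + i - j))" if "i \<le> j" "j - i \<le> m"
        using f [of "m + i - j"] that unfolding m_def [symmetric] by (simp add: of_nat_diff)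
      then show ?thesis
        unfolding sylvester_index_mat [OF ij'] using True graded_0 [OF P]
        by (auto simp: m_def n_def)
    next
      case False
      have "P (int j - int i + int n) (coeff g (i - j))" if "j \<le> i"
        using g [of "i - j"] that unfolding n_def [symmetric] by (simp add: of_nat_diff algebra_simps)
      then show ?thesis
        unfolding sylvester_index_mat [OF ij'] using False graded_0 [OF P]
        by (auto simp: m_def n_def)
    qed
  qed
  have "P (int (m * n)) (signof \<pi> * (\<Prod>i = 0..<N. ?S $$ (i, \<pi> i)))" if \<pi>: "\<pi> permutes {0..<N}" for \<pi>
  proof -
    have "P (\<Sum>i = 0..<N. ?\<omega> i (\<pi> i)) (\<Prod>i = 0..<N. ?S $$ (i, \<pi> i))"
      using permutes_in_image [OF \<pi>] by (intro graded_prod [OF P] entry) auto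
    also have "(\<Sum>i = 0..<N. ?\<omega> i (\<pi> i)) = int (m * n)"
    proof -
      have "(\<Sum>i = 0..<N. int (\<pi> i)) = (\<Sum>i = 0..<N. int i)"
        using sum.permute [OF \<pi>, of int] by (simp add: o_def)
      moreover have "(\<Sum>i = 0..<N. if i < n then 0 else int n) = (\<Sum>i = n..<N. int n)"
        by (intro sum.mono_neutral_cong_right) auto
      ultimately show ?thesis
        by (simp add: sum.distrib sum_subtractf N_def)
    qed
    finally have "P (int (m * n)) (\<Prod>i = 0..<N. ?S $$ (i, \<pi> i))" .
    then show ?thesis
      using graded_uminus [OF P] by (cases "evenperm \<pi>") (auto simp: sign_def)
  qed
  moreover have "?S \<in> carrier_mat N N"
    unfolding N_def m_def n_def by (rule sylvester_carrier_mat)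
  ultimately have "P (int (m * n)) (det ?S)"
    by (subst det_def') (auto intro!: graded_sum [OF P])
  then show ?thesis by (simp add: resultant_def m_def n_def)
qed

section \<open>Binary forms in t1, t2 and their factors\<close>

definition hom2 :: "int \<Rightarrow> 'a::zero poly poly \<Rightarrow> bool" where
  "hom2 = gr_poly 1 (gr_poly 1 gr0)"

lemma graded_hom2: "graded (hom2 :: int \<Rightarrow> 'a::comm_ring_1 poly poly \<Rightarrow> bool)"
  unfolding hom2_def by (intro graded_gr_poly graded_gr0)

lemma hom2_iff: "hom2 e p \<longleftrightarrow> (\<forall>i j. coeff (coeff p j) i \<noteq> 0 \<longrightarrow> int i + int j = e)"
proof -
  have "hom2 e p \<longleftrightarrow> (\<forall>j i. coeff (coeff p j) i = 0 \<or> e - int j - int i = 0)"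
    by (simp add: hom2_def gr_poly_def gr0_def)
  moreover have "e - int j - int i = 0 \<longleftrightarrow> int i + int j = e" for i j by auto
  ultimately show ?thesis by blast
qed

lemma hom2_coeff_homogeneous3:
  "homogeneous3 s d \<Longrightarrow> hom2 (int d - int k) (coeff s k)"
  unfolding homogeneous3_def coeff3_def hom2_iff by force

lemma hom2_coeffD: "hom2 (int e) p \<Longrightarrow> i + j \<noteq> e \<Longrightarrow> coeff (coeff p j) i = 0"
  unfolding hom2_iff by (metis of_nat_add of_nat_eq_iff)

lemma hom2_coeff_eq_monom:
  assumes "hom2 (int e) p"
  shows "coeff p j = (if j \<le> e then monom (coeff (coeff p j) (e - j)) (e - j) else 0)"
  using hom2_coeffD [OF assms] by (intro poly_eqI) auto

text \<open>Order at 0 and degree are additive, and order is at most degree. Equality for the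
  product forces equality for both factors.\<close>

lemma monom_factor:
  fixes x y :: "'a::idom poly"
  assumes xy: "x * y = monom c n" and "c \<noteq> 0"
  shows "\<exists>c' k. x = monom c' k"
proof -
  have nz: "x * y \<noteq> 0" using assms by (simp add: monom_eq_0_iff)
  then have "x \<noteq> 0" "y \<noteq> 0" by auto
  have "order 0 x + order 0 y = n"
    using order_mult [OF nz, of 0] xy assms(2) by simp
  moreover have "degree x + degree y = n"
    using degree_mult_eq [OF \<open>x \<noteq> 0\<close> \<open>y \<noteq> 0\<close>] xy assms(2) by (simp add: degree_monom_eq)
  moreover have "order 0 x \<le> degree x" "order 0 y \<le> degree y"
    using order_degree \<open>x \<noteq> 0\<close> \<open>y \<noteq> 0\<close> by auto
  ultimately have k: "order 0 x = degree x" by linarith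
  have "monom 1 (degree x) dvd x"
    using order_1 [of 0 x] unfolding k by (simp add: monom_altdef)
  then have "coeff x i = 0" if "i < degree x" for i
    using that by (simp add: monom_1_dvd_iff')
  then have "x = monom (lead_coeff x) (degree x)"
    by (intro poly_eqI) (auto simp: coeff_eq_0 neq_iff)
  then show ?thesis by blast
qed

text \<open>The substitution \<open>(t1, t2) \<mapsto> (z t1, z t2)\<close>, with \<open>z\<close> outermost, separates the
  homogeneous components.\<close>

definition scale1 :: "'a::idom poly \<Rightarrow> 'a poly poly poly" where
  "scale1 r = poly (map_poly (\<lambda>c. [:[:[:c:]:]:]) r) (monom [:[:0, 1:]:] 1)"

definition scale2 :: "'a::idom poly poly \<Rightarrow> 'a poly poly poly" where
  "scale2 p = poly (map_poly scale1 p) (monom [:0, 1:] 1)"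

lemma monom_1_mult: "monom c 1 * p = pCons 0 (smult c p)"
  by (simp add: monom_Suc monom_0)

lemma comm_ring_hom_scale1: "comm_ring_hom (scale1 :: 'a::idom poly \<Rightarrow> _)"
proof -
  interpret h: comm_ring_hom "\<lambda>c::'a. [:[:[:c:]:]:]"
    by unfold_locales (auto simp: pCons_one)
  interpret m: map_poly_comm_ring_hom "\<lambda>c::'a. [:[:[:c:]:]:]" ..
  show ?thesis
    by unfold_locales (auto simp: scale1_def m.hom_add m.hom_mult)
qed

lemma comm_ring_hom_scale2: "comm_ring_hom (scale2 :: 'a::idom poly poly \<Rightarrow> _)"
proof -
  interpret h: comm_ring_hom "scale1 :: 'a poly \<Rightarrow> _" by (rule comm_ring_hom_scale1)
  interpret m: map_poly_comm_ring_hom "scale1 :: 'a poly \<Rightarrow> _" ..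
  show ?thesis
    by unfold_locales (auto simp: scale2_def m.hom_add m.hom_mult)
qed

lemma scale1_pCons: "scale1 (pCons c r) = [:[:[:c:]:]:] + pCons 0 (smult [:[:0, 1:]:] (scale1 r))"
proof -
  interpret comm_ring_hom "\<lambda>c::'a. [:[:[:c:]:]:]"
    by unfold_locales (auto simp: pCons_one)
  show ?thesis
    unfolding scale1_def map_poly_pCons_hom poly_pCons monom_1_mult by simp
qed

lemma scale2_pCons: "scale2 (pCons r p) = scale1 r + pCons 0 (smult [:0, 1:] (scale2 p))"
proof -
  interpret comm_ring_hom "scale1 :: 'a poly \<Rightarrow> _" by (rule comm_ring_hom_scale1)
  show ?thesis unfolding scale2_def map_poly_pCons_hom poly_pCons monom_1_mult by simp
qed

lemma coeff_scale1:
  "coeff (coeff (coeff (scale1 r) n) j) i = (if j = 0 \<and> n = i then coeff r i else 0)"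
proof (induction r arbitrary: n j i)
  case 0
  then show ?case by (simp add: scale1_def)
next
  case (pCons c r)
  show ?case
    by (cases n; cases j; cases i) (auto simp: scale1_pCons coeff_pCons pCons.IH)
qed

lemma coeff_scale2:
  "coeff (coeff (coeff (scale2 p) n) j) i = (if n = i + j then coeff (coeff p j) i else 0)"
proof (induction p arbitrary: n j i)
  case 0
  then show ?case by (simp add: scale2_def)
next
  case (pCons r p)
  show ?case
    by (cases n; cases j) (auto simp: scale2_pCons coeff_pCons pCons.IH coeff_scale1)
qed

text \<open>\<open>scale2\<close> turns a form of degree D into a monomial of degree D in z, whose
  factors are monomials in z, so that only one homogeneous component of \<open>p\<close> is
  nonzero.\<close>

lemma hom2_factor:
  fixes p q :: "'a::idom poly poly"
  assumes hom: "hom2 (int D) (p * q)" and nz: "p * q \<noteq> 0"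
  shows "\<exists>n. hom2 (int n) p"
proof -
  interpret comm_ring_hom "scale2 :: 'a poly poly \<Rightarrow> _" by (rule comm_ring_hom_scale2)
  have "scale2 p * scale2 q = scale2 (p * q)" by (simp add: hom_mult)
  also have "\<dots> = monom (p * q) D"
    using hom2_coeffD [OF hom] by (intro poly_eqI) (auto simp: coeff_scale2)
  finally obtain c k where "scale2 p = monom c k"
    using monom_factor nz by blast
  then have "coeff (coeff (coeff (scale2 p) (i + j)) j) i = 0" if "i + j \<noteq> k" for i j
    using that by simp
  then have "hom2 (int k) p"
    unfolding hom2_iff coeff_scale2 by (metis of_nat_add)
  then show ?thesis ..
qed

section \<open>Dehomogenization at t1 = 1 and at t2 = 1\<close>

definition \<delta>1 :: "'a::comm_semiring_1 poly poly \<Rightarrow> 'a poly" where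
  "\<delta>1 q = map_poly (\<lambda>r. poly r 1) q"
definition \<delta>2 :: "'a::comm_semiring_1 poly poly \<Rightarrow> 'a poly" where
  "\<delta>2 q = poly q 1"

lemma coeff_\<delta>1:
  assumes "hom2 (int e) (p :: 'a::comm_ring_1 poly poly)"
  shows "coeff (\<delta>1 p) j = (if j \<le> e then coeff (coeff p j) (e - j) else 0)"
proof -
  have "coeff (\<delta>1 p) j = poly (coeff p j) 1" by (simp add: \<delta>1_def coeff_map_poly)
  then show ?thesis by (subst (asm) hom2_coeff_eq_monom [OF assms]) (simp add: poly_monom)
qed

lemma hom2_degree_le: "hom2 (int e) p \<Longrightarrow> degree p \<le> e"
  by (rule degree_le) (auto simp: hom2_coeff_eq_monom)

lemma poly_eq_sum_atMost:
  fixes p :: "'a::comm_semiring_1 poly"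
  assumes "degree p \<le> n"
  shows "poly p x = (\<Sum>i\<le>n. coeff p i * x ^ i)"
  unfolding poly_altdef using assms
  by (intro sum.mono_neutral_left) (auto simp: coeff_eq_0)

lemma coeff_\<delta>2:
  assumes "hom2 (int e) (p :: 'a::comm_ring_1 poly poly)"
  shows "coeff (\<delta>2 p) i = (if i \<le> e then coeff (coeff p (e - i)) i else 0)"
proof -
  have "\<delta>2 p = (\<Sum>j\<le>e. coeff p j * 1 ^ j)"
    unfolding \<delta>2_def by (rule poly_eq_sum_atMost) (rule hom2_degree_le [OF assms])
  then have "coeff (\<delta>2 p) i = (\<Sum>j\<le>e. coeff (coeff p j) i)" by (simp add: coeff_sum)
  also have "\<dots> = (\<Sum>j\<le>e. if j = e - i then (if i \<le> e then coeff (coeff p (e - i)) i else 0) else 0)"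
    using hom2_coeffD [OF assms] by (intro sum.cong) auto
  finally show ?thesis by simp
qed

lemma deg_t_hom2:
  assumes "hom2 (int e) p" "p \<noteq> 0"
  shows "deg_t p = e"
proof -
  obtain i j where "coeff (coeff p j) i \<noteq> 0" using assms(2) by (metis poly_eqI coeff_0)
  moreover have "i + j = e" if "coeff (coeff p j) i \<noteq> 0" for i j
    using hom2_coeffD [OF assms(1)] that by blast
  ultimately have "{i + j | i j. coeff (coeff p j) i \<noteq> 0} = {e}" by auto
  then show ?thesis by (simp add: deg_t_def)
qed

lemma \<delta>1_nonzero:
  assumes "hom2 (int e) (p :: 'a::comm_ring_1 poly poly)" "p \<noteq> 0"
  shows "\<delta>1 p \<noteq> 0"
proof -
  obtain i j where ij: "coeff (coeff p j) i \<noteq> 0" using assms(2) by (metis poly_eqI coeff_0)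
  then have "i + j = e" using hom2_coeffD [OF assms(1)] by blast
  then have "coeff (\<delta>1 p) j \<noteq> 0" using ij by (auto simp: coeff_\<delta>1 [OF assms(1)])
  then show ?thesis by auto
qed

text \<open>The top term of \<open>\<delta>1 p\<close>, of degree n, comes from t1^(e-n) t2^n, which
  carries the lowest power of t1 in \<open>p\<close>. The order of \<open>\<delta>2 p\<close> at 0
  is that power, the multiplicity of the zero (0:1).\<close>

lemma hom2_degree_eq:
  assumes hom: "hom2 (int e) (p :: 'a::idom poly poly)" and "p \<noteq> 0"
  shows "\<delta>2 p \<noteq> 0" "e = degree (\<delta>1 p) + order 0 (\<delta>2 p)"
proof -
  let ?n = "degree (\<delta>1 p)"
  have "coeff (\<delta>1 p) ?n \<noteq> 0" using \<delta>1_nonzero [OF assms] by simp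
  then have n: "?n \<le> e" "coeff (coeff p ?n) (e - ?n) \<noteq> 0"
    by (auto simp: coeff_\<delta>1 [OF hom] split: if_splits)
  have c: "coeff (\<delta>2 p) (e - ?n) \<noteq> 0" using n by (simp add: coeff_\<delta>2 [OF hom])
  then show "\<delta>2 p \<noteq> 0" by auto
  have z: "coeff (\<delta>2 p) i = 0" if "i < e - ?n" for i
  proof -
    have "coeff (\<delta>1 p) (e - i) = 0" using that by (intro coeff_eq_0) simp
    then show ?thesis using that by (auto simp: coeff_\<delta>2 [OF hom] coeff_\<delta>1 [OF hom])
  qed
  have "order 0 (\<delta>2 p) = e - ?n"
  proof (rule order_unique_lemma)
    show "[:- 0, 1:] ^ (e - ?n) dvd \<delta>2 p"
      using z monom_1_dvd_iff' [of "e - ?n" "\<delta>2 p"] by (simp add: monom_altdef)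
    have "\<not> monom 1 (Suc (e - ?n)) dvd \<delta>2 p"
      using c unfolding monom_1_dvd_iff' by blast
    then show "\<not> [:- 0, 1:] ^ Suc (e - ?n) dvd \<delta>2 p"
      by (simp add: monom_altdef del: power_Suc)
  qed
  then show "e = ?n + order 0 (\<delta>2 p)" using n by simp
qed

text \<open>By homogeneity p(t1, a t1) = p(1, a) t1^e, so a root \<open>a\<close> makes t2 - a t1 a
  factor.\<close>

lemma \<delta>1_root_imp_dvd:
  assumes hom: "hom2 (int e) (p :: 'a::idom poly poly)" and "poly (\<delta>1 p) a = 0"
  shows "[:-[:0, a:], 1:] dvd p"
proof -
  have "poly p [:0, a:] = (\<Sum>j\<le>e. coeff p j * [:0, a:] ^ j)"
    by (rule poly_eq_sum_atMost) (rule hom2_degree_le [OF hom])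
  also have "\<dots> = (\<Sum>j\<le>e. monom (coeff (\<delta>1 p) j * a ^ j) e)"
  proof (intro sum.cong refl)
    fix j assume "j \<in> {..e}"
    have "[:0, a:] ^ j = monom (a ^ j) j"
    proof -
      have "[:0, a:] = monom a 1" by (simp add: monom_Suc monom_0)
      then show ?thesis by (simp add: monom_power)
    qed
    then show "coeff p j * [:0, a:] ^ j = monom (coeff (\<delta>1 p) j * a ^ j) e"
      using \<open>j \<in> {..e}\<close> by (subst hom2_coeff_eq_monom [OF hom]) (simp add: coeff_\<delta>1 [OF hom] mult_monom)
  qed
  also have "\<dots> = monom (\<Sum>j\<le>e. coeff (\<delta>1 p) j * a ^ j) e"
    by (simp add: monom_hom.hom_sum)
  also have "(\<Sum>j\<le>e. coeff (\<delta>1 p) j * a ^ j) = poly (\<delta>1 p) a"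
    by (rule poly_eq_sum_atMost [symmetric], rule degree_le) (auto simp: coeff_\<delta>1 [OF hom])
  finally show ?thesis using assms(2) by (simp add: poly_eq_0_iff_dvd)
qed

lemma \<delta>2_root_imp_dvd:
  assumes hom: "hom2 (int e) (p :: 'a::idom poly poly)" and "poly (\<delta>2 p) 0 = 0"
  shows "[:[:0, 1:]:] dvd p"
  unfolding const_poly_dvd_iff
proof
  fix j
  have "coeff (coeff p e) 0 = 0"
    using assms(2) by (simp add: poly_0_coeff_0 coeff_\<delta>2 [OF hom])
  then have "coeff (coeff p j) 0 = 0"
    using hom2_coeffD [OF hom, of 0 j] by (cases "j = e") auto
  then have "poly (coeff p j) 0 = 0" by (simp add: poly_0_coeff_0)
  then show "[:0, 1:] dvd coeff p j" by (simp add: poly_eq_0_iff_dvd)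
qed

subsection \<open>The content\<close>

abbreviation coeffX :: "'a::zero polyTX \<Rightarrow> nat \<Rightarrow> nat \<Rightarrow> nat \<Rightarrow> 'a poly poly" where
  "coeffX R i j k \<equiv> coeff (coeff (coeff R i) j) k"

text \<open>After division by the content the coefficients have no common factor. They are forms, so
  a common zero (1:a) or (0:1) would yield the common factor t2 - a t1 or t1.\<close>

lemma content_x_factor:
  fixes R :: "'k::field_gcd polyTX"
  assumes "R \<noteq> 0" and hom: "\<And>i j k. hom2 (int D) (coeffX R i j k)"
  obtains e Q where "R = liftTX (content_x R) * Q" "content_x R \<noteq> 0" "hom2 (int e) (content_x R)"
    "\<And>a. \<exists>i j k. poly (\<delta>1 (coeffX Q i j k)) a \<noteq> 0"
    "\<exists>i j k. poly (\<delta>2 (coeffX Q i j k)) 0 \<noteq> 0"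
proof -
  define C where "C = content_x R"
  have dvd: "C dvd coeffX R i j k" for i j k
    unfolding C_def content_x_def by (rule Gcd_dvd) blast
  have greatest: "x dvd C" if "\<And>i j k. x dvd coeffX R i j k" for x
    unfolding C_def content_x_def using that by (intro Gcd_greatest) blast
  obtain i0 j0 k0 where nz: "coeffX R i0 j0 k0 \<noteq> 0"
    using \<open>R \<noteq> 0\<close> by (metis poly_eqI coeff_0)
  then have "C \<noteq> 0" using dvd [of i0 j0 k0] by auto
  define Q where "Q = map_poly (map_poly (map_poly (\<lambda>c. c div C))) R"
  have Q: "coeffX R i j k = C * coeffX Q i j k" for i j k
    using dvd [of i j k] by (simp add: Q_def coeff_map_poly)
  have R: "R = liftTX C * Q"
    by (intro poly_eqI) (simp add: liftTX_def Q)
  have "\<exists>e. hom2 (int e) C"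
    using hom2_factor [of D C "coeffX Q i0 j0 k0"] hom [of i0 j0 k0] nz unfolding Q by blast
  then obtain e where e: "hom2 (int e) C" ..
  have homQ: "\<exists>n. hom2 (int n) (coeffX Q i j k)" for i j k
  proof (cases "coeffX Q i j k = 0")
    case True
    then show ?thesis by (simp add: hom2_iff)
  next
    case False
    then show ?thesis
      using hom2_factor [of D "coeffX Q i j k" C] hom [of i j k] \<open>C \<noteq> 0\<close> unfolding Q by (auto simp: mult.commute)
  qed
  have unit: "is_unit x" if "\<And>i j k. x dvd coeffX Q i j k" for x
  proof -
    have "C * x dvd C"
      using that by (intro greatest) (simp add: Q)
    then show ?thesis using \<open>C \<noteq> 0\<close> by (metis dvd_times_left_cancel_iff mult.right_neutral)
  qed
  show ?thesis
  proof (rule that [of Q e])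
    fix a
    show "\<exists>i j k. poly (\<delta>1 (coeffX Q i j k)) a \<noteq> 0"
    proof (rule ccontr)
      assume "\<not> ?thesis"
      then have "[:-[:0, a:], 1:] dvd coeffX Q i j k" for i j k
        using homQ [of i j k] \<delta>1_root_imp_dvd by blast
      then have "is_unit [:-[:0, a:], 1:]" by (rule unit)
      then show False by (auto simp: is_unit_poly_iff)
    qed
  next
    show "\<exists>i j k. poly (\<delta>2 (coeffX Q i j k)) 0 \<noteq> 0"
    proof (rule ccontr)
      assume "\<not> ?thesis"
      then have "[:[:0, 1:]:] dvd coeffX Q i j k" for i j k
        using homQ [of i j k] \<delta>2_root_imp_dvd by blast
      then have "is_unit ([:[:0, 1:]:] :: 'k poly poly)" by (rule unit)
      then show False by (auto simp: is_unit_poly_iff)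
    qed
  qed (use R \<open>C \<noteq> 0\<close> e in \<open>simp_all add: C_def\<close>)
qed

subsection \<open>Evaluation in three variables and generic points\<close>

text \<open>One substitution map for several situations: points of F^3 in polynomials over K,
  univariate polynomials in polynomials over K, and the generic point in polynomials in x over
  K[t1, t2].\<close>

definition ev3 :: "('a::comm_ring_1 \<Rightarrow> 'b::comm_ring_1) \<Rightarrow> (nat \<Rightarrow> 'b) \<Rightarrow> 'a poly poly poly \<Rightarrow> 'b" where
  "ev3 \<sigma> \<xi> R = poly (map_poly (\<lambda>q. poly (map_poly (\<lambda>r. poly (map_poly \<sigma> r) (\<xi> 0)) q) (\<xi> 1)) R) (\<xi> 2)"

lemma comm_ring_hom_poly_map_poly:
  assumes "comm_ring_hom \<sigma>"
  shows "comm_ring_hom (\<lambda>p. poly (map_poly \<sigma> p) x)"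
proof -
  interpret comm_ring_hom \<sigma> by fact
  interpret m: map_poly_comm_ring_hom \<sigma> ..
  show ?thesis by unfold_locales (auto simp: m.hom_add m.hom_mult)
qed

lemma
  assumes "comm_ring_hom h"
  shows hom_0: "h 0 = 0" and hom_1: "h 1 = 1" and hom_plus: "h (x + y) = h x + h y"
    and hom_times: "h (x * y) = h x * h y" and hom_diff: "h (x - y) = h x - h y"
proof -
  interpret comm_ring_hom h by fact
  show "h 0 = 0" "h 1 = 1" "h (x + y) = h x + h y" "h (x * y) = h x * h y" "h (x - y) = h x - h y"
    by (simp_all add: hom_add hom_mult hom_minus)
qed

lemma comm_ring_hom_ev3: "comm_ring_hom \<sigma> \<Longrightarrow> comm_ring_hom (ev3 \<sigma> \<xi>)"
  unfolding ev3_def [abs_def] by (intro comm_ring_hom_poly_map_poly)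

lemma comm_ring_hom_comp:
  assumes "comm_ring_hom \<tau>" "comm_ring_hom \<sigma>"
  shows "comm_ring_hom (\<lambda>x. \<tau> (\<sigma> x))"
proof -
  interpret t: comm_ring_hom \<tau> by fact
  interpret s: comm_ring_hom \<sigma> by fact
  show ?thesis by unfold_locales (auto simp: t.hom_add s.hom_add t.hom_mult s.hom_mult)
qed

lemma hom_poly_map_poly:
  assumes "comm_ring_hom \<tau>" "comm_ring_hom \<sigma>"
  shows "\<tau> (poly (map_poly \<sigma> p) x) = poly (map_poly (\<lambda>r. \<tau> (\<sigma> r)) p) (\<tau> x)"
proof -
  interpret t: comm_ring_hom \<tau> by fact
  interpret s: comm_ring_hom \<sigma> by fact
  have "\<tau> (poly (map_poly \<sigma> p) x) = poly (map_poly \<tau> (map_poly \<sigma> p)) (\<tau> x)"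
    by (rule t.poly_map_poly [symmetric])
  also have "map_poly \<tau> (map_poly \<sigma> p) = map_poly (\<lambda>r. \<tau> (\<sigma> r)) p"
    by (intro poly_eqI) (simp add: coeff_map_poly)
  finally show ?thesis .
qed

lemma hom_ev3:
  assumes \<tau>: "comm_ring_hom \<tau>" and \<sigma>: "comm_ring_hom \<sigma>"
  shows "\<tau> (ev3 \<sigma> \<xi> R) = ev3 (\<lambda>c. \<tau> (\<sigma> c)) (\<lambda>i. \<tau> (\<xi> i)) R"
  unfolding ev3_def
  by (simp only: hom_poly_map_poly [OF \<tau>] comm_ring_hom_poly_map_poly \<sigma>)

lemma ev3_map_poly:
  assumes \<kappa>: "comm_ring_hom \<kappa>" and \<rho>: "comm_ring_hom \<rho>"
  shows "ev3 \<rho> \<xi> (map_poly (map_poly (map_poly \<kappa>)) R) = ev3 (\<lambda>c. \<rho> (\<kappa> c)) \<xi> R"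
proof -
  interpret k: comm_ring_hom \<kappa> by fact
  interpret r: comm_ring_hom \<rho> by fact
  have 0: "map_poly (\<lambda>r. h (g r)) p = map_poly h (map_poly g p)"
    if "h 0 = 0" "g 0 = 0" for h :: "'x::zero \<Rightarrow> 'y::zero" and g :: "'z::zero \<Rightarrow> 'x" and p
    using that by (intro poly_eqI) (simp add: coeff_map_poly)
  show ?thesis
    unfolding ev3_def by (subst 0 [symmetric], simp, simp)+ simp
qed

lemma ev3_monom:
  assumes "comm_ring_hom \<sigma>"
  shows "ev3 \<sigma> \<xi> (monom (monom (monom c i) j) k) = \<sigma> c * \<xi> 0 ^ i * \<xi> 1 ^ j * \<xi> 2 ^ k"
proof -
  interpret comm_ring_hom \<sigma> by fact
  show ?thesis by (simp add: ev3_def map_poly_monom poly_monom)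
qed

lemma ev3_const: "comm_ring_hom \<sigma> \<Longrightarrow> ev3 \<sigma> \<xi> [:[:[:c:]:]:] = \<sigma> c"
  using ev3_monom [of \<sigma> \<xi> c 0 0 0] by (simp add: monom_0)

lemma ev3_id_eq_eval3: "ev3 (\<lambda>x. x) z p = eval3 p (z 0) (z 1) (z 2)"
  by (simp add: eval3_def ev3_def)

lemma eval3_zero_imp_zero:
  fixes p :: "'a::field_char_0 poly poly poly"
  assumes "\<And>a b c. eval3 p a b c = 0"
  shows "p = 0"
proof -
  have "coeff (coeff (coeff p k) j) = coeff 0" for k j
  proof -
    have "poly (coeff (coeff p k) j) a = 0" for a
    proof -
      have "poly (map_poly (\<lambda>r. poly r a) (coeff p k)) b = 0" for b
      proof -
        have "map_poly (\<lambda>q. poly (map_poly (\<lambda>r. poly r a) q) b) p = 0"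
          using assms [of a b] unfolding eval3_def by (intro poly_all_0_iff_0 [THEN iffD1] allI)
        then have "coeff (map_poly (\<lambda>q. poly (map_poly (\<lambda>r. poly r a) q) b) p) k = 0" by simp
        then show ?thesis by (simp add: coeff_map_poly)
      qed
      then have "map_poly (\<lambda>r. poly r a) (coeff p k) = 0"
        by (intro poly_all_0_iff_0 [THEN iffD1] allI)
      then have "coeff (map_poly (\<lambda>r. poly r a) (coeff p k)) j = 0" by simp
      then show ?thesis by (simp add: coeff_map_poly)
    qed
    then have "coeff (coeff p k) j = 0" by (intro poly_all_0_iff_0 [THEN iffD1] allI)
    then show ?thesis by simp
  qed
  then show ?thesis by (intro poly_eqI) simp
qed

section \<open>The generic point and its algebraic independence\<close>

definition cross :: "(nat \<Rightarrow> 'a::comm_ring_1) \<Rightarrow> (nat \<Rightarrow> 'a) \<Rightarrow> nat \<Rightarrow> 'a" where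
  "cross x y i = (if i = 0 then x 1 * y 2 - x 2 * y 1
     else if i = 1 then x 2 * y 0 - x 0 * y 2 else x 0 * y 1 - x 1 * y 0)"

definition matvec :: "(nat \<Rightarrow> nat \<Rightarrow> 'a::comm_ring_1) \<Rightarrow> (nat \<Rightarrow> 'a) \<Rightarrow> nat \<Rightarrow> 'a" where
  "matvec M v i = M i 0 * v 0 + M i 1 * v 1 + M i 2 * v 2"

lemma cross_surj:
  fixes c :: "nat \<Rightarrow> 'a::field"
  shows "\<exists>x y. cross x y 0 = c 0 \<and> cross x y 1 = c 1 \<and> cross x y 2 = c 2"
proof (cases "c 2 = 0")
  case True
  let ?x = "\<lambda>i. if i = 2 then 1 else 0 :: 'a"
  let ?y = "\<lambda>i. if i = 0 then c 1 else if i = 1 then - c 0 else 0"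
  show ?thesis using True by (intro exI [of _ ?x] exI [of _ ?y]) (simp add: cross_def)
next
  case False
  let ?x = "\<lambda>i. if i = 0 then 1 else if i = 1 then 0 else - c 0 / c 2"
  let ?y = "\<lambda>i. if i = 0 then 0 else if i = 1 then c 2 else - c 1"
  show ?thesis using False by (intro exI [of _ ?x] exI [of _ ?y]) (simp add: cross_def)
qed

lemma matvec_surj:
  fixes M :: "nat \<Rightarrow> nat \<Rightarrow> 'a::field"
  assumes "det3 M \<noteq> 0"
  shows "\<exists>c. matvec M c 0 = z0 \<and> matvec M c 1 = z1 \<and> matvec M c 2 = z2"
proof -
  \<comment> \<open>The adjugate of \<open>M\<close> applied to z; dividing by the determinant gives
    the preimage.\<close>
  let ?c = "\<lambda>i. (if i = 0 then (M 1 1 * M 2 2 - M 1 2 * M 2 1) * z0 + (M 0 2 * M 2 1 - M 0 1 * M 2 2) * z1 + (M 0 1 * M 1 2 - M 0 2 * M 1 1) * z2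
     else if i = 1 then (M 1 2 * M 2 0 - M 1 0 * M 2 2) * z0 + (M 0 0 * M 2 2 - M 0 2 * M 2 0) * z1 + (M 0 2 * M 1 0 - M 0 0 * M 1 2) * z2
     else (M 1 0 * M 2 1 - M 1 1 * M 2 0) * z0 + (M 0 1 * M 2 0 - M 0 0 * M 2 1) * z1 + (M 0 0 * M 1 1 - M 0 1 * M 1 0) * z2)"
  have *: "matvec M (\<lambda>i. c i / D) i = matvec M c i / D" for c D i
    by (simp add: matvec_def add_divide_distrib)
  have "matvec M ?c 0 = det3 M * z0" "matvec M ?c 1 = det3 M * z1" "matvec M ?c 2 = det3 M * z2"
    by (simp_all add: matvec_def det3_def algebra_simps)
  then show ?thesis
    using assms by (intro exI [of _ "\<lambda>i. ?c i / det3 M"]) (simp only: *, simp)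
qed

lemma matvec_eq_0:
  fixes M :: "nat \<Rightarrow> nat \<Rightarrow> 'a::field"
  assumes "det3 M \<noteq> 0" "matvec M v 0 = 0" "matvec M v 1 = 0" "matvec M v 2 = 0"
  shows "v 0 = 0" "v 1 = 0" "v 2 = 0"
proof -
  have "det3 M * v 0 = (M 1 1 * M 2 2 - M 1 2 * M 2 1) * matvec M v 0
      + (M 0 2 * M 2 1 - M 0 1 * M 2 2) * matvec M v 1 + (M 0 1 * M 1 2 - M 0 2 * M 1 1) * matvec M v 2"
    by (simp add: matvec_def det3_def algebra_simps)
  then show "v 0 = 0" using assms by simp
  have "det3 M * v 1 = (M 1 2 * M 2 0 - M 1 0 * M 2 2) * matvec M v 0
      + (M 0 0 * M 2 2 - M 0 2 * M 2 0) * matvec M v 1 + (M 0 2 * M 1 0 - M 0 0 * M 1 2) * matvec M v 2"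
    by (simp add: matvec_def det3_def algebra_simps)
  then show "v 1 = 0" using assms by simp
  have "det3 M * v 2 = (M 1 0 * M 2 1 - M 1 1 * M 2 0) * matvec M v 0
      + (M 0 1 * M 2 0 - M 0 0 * M 2 1) * matvec M v 1 + (M 0 0 * M 1 1 - M 0 1 * M 1 0) * matvec M v 2"
    by (simp add: matvec_def det3_def algebra_simps)
  then show "v 2 = 0" using assms by simp
qed

lemma hom_cross: "comm_ring_hom h \<Longrightarrow> h (cross x y i) = cross (\<lambda>i. h (x i)) (\<lambda>i. h (y i)) i"
  by (simp add: cross_def hom_diff hom_times)

lemma hom_matvec: "comm_ring_hom h \<Longrightarrow> h (matvec M v i) = matvec (\<lambda>i j. h (M i j)) (\<lambda>i. h (v i)) i"
  by (simp add: matvec_def hom_plus hom_times)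

definition evXY :: "(nat \<Rightarrow> 'k::comm_ring_1) \<Rightarrow> 'k polyXY \<Rightarrow> 'k" where
  "evXY c R = poly (poly (poly (poly (poly (poly R [:[:[:[:[:c 5:]:]:]:]:]) [:[:[:[:c 4:]:]:]:])
     [:[:[:c 3:]:]:]) [:[:c 2:]:]) [:c 1:]) (c 0)"

lemma comm_ring_hom_evXY: "comm_ring_hom (evXY c)"
  by unfold_locales (auto simp: evXY_def)

lemma evXY_constXY: "evXY c (constXY a) = a"
  by (simp add: evXY_def constXY_def)

lemma evXY_varXY: "i < 6 \<Longrightarrow> evXY c (varXY i) = c i"
proof -
  assume "i < 6"
  then consider "i = 0" | "i = 1" | "i = 2" | "i = 3" | "i = 4" | "i = 5" by linarith
  then show ?thesis by cases (simp_all add: evXY_def varXY_def)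
qed

lemma comm_ring_hom_constXY: "comm_ring_hom (constXY :: 'k::comm_ring_1 \<Rightarrow> _)"
  by unfold_locales (auto simp: constXY_def pCons_one)

lemma comm_ring_hom_to_F: "comm_ring_hom (\<lambda>x. to_ac (to_fract x))"
  by unfold_locales (auto simp: hom_distribs)

lemma comm_ring_hom_embF: "comm_ring_hom (embF :: 'k::field \<Rightarrow> _)"
  unfolding embF_def [abs_def]
  by (rule comm_ring_hom_comp [OF comm_ring_hom_to_F comm_ring_hom_constXY])

lemma embF_eq_0_iff [simp]: "embF c = 0 \<longleftrightarrow> c = 0"
  by (simp add: embF_def constXY_def)

definition \<xi> :: "(nat \<Rightarrow> nat \<Rightarrow> 'k::field) \<Rightarrow> nat \<Rightarrow> 'k FF" where
  "\<xi> M = matvec (\<lambda>i j. embF (M i j)) (cross xF yF)"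

text \<open>Specializing x and y to vectors over K makes M (x \<times> y) run through all of K^3,
  since both the cross product and \<open>M\<close> are surjective. A polynomial vanishing at the
  generic point therefore vanishes on K^3, and K is infinite.\<close>

lemma \<xi>_independent:
  fixes M :: "nat \<Rightarrow> nat \<Rightarrow> 'k::field_char_0"
  assumes M: "det3 M \<noteq> 0" and p: "p \<noteq> 0"
  shows "ev3 embF (\<xi> M) p \<noteq> 0"
proof
  assume 0: "ev3 embF (\<xi> M) p = 0"
  define \<xi>' :: "nat \<Rightarrow> 'k polyXY" where
    "\<xi>' = matvec (\<lambda>i j. constXY (M i j)) (cross varXY (\<lambda>i. varXY (i + 3)))"
  have "\<xi> M = (\<lambda>i. to_ac (to_fract (\<xi>' i)))"
    unfolding \<xi>_def \<xi>'_def xF_def [abs_def] yF_def [abs_def] embF_def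
    by (intro ext) (simp only: hom_matvec [OF comm_ring_hom_to_F] hom_cross [OF comm_ring_hom_to_F])
  then have "ev3 embF (\<xi> M) p = to_ac (to_fract (ev3 constXY \<xi>' p))"
    unfolding embF_def [abs_def] by (simp only: hom_ev3 [OF comm_ring_hom_to_F comm_ring_hom_constXY])
  with 0 have "ev3 constXY \<xi>' p = 0" by simp
  have "eval3 p z0 z1 z2 = 0" for z0 z1 z2
  proof -
    obtain v where v: "matvec M v 0 = z0" "matvec M v 1 = z1" "matvec M v 2 = z2"
      using matvec_surj [OF M] by blast
    obtain x y where xy: "cross x y 0 = v 0" "cross x y 1 = v 1" "cross x y 2 = v 2"
      using cross_surj by blast
    define c where "c i = (if i < 3 then x i else y (i - 3))" for i
    have h: "comm_ring_hom (evXY c)" by (rule comm_ring_hom_evXY)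
    have "evXY c (\<xi>' i) = matvec M (cross (\<lambda>i. evXY c (varXY i)) (\<lambda>i. evXY c (varXY (i + 3)))) i" for i
      unfolding \<xi>'_def by (simp add: hom_matvec [OF h] hom_cross [OF h] evXY_constXY)
    moreover have "cross (\<lambda>i. evXY c (varXY i)) (\<lambda>i. evXY c (varXY (i + 3))) i = cross x y i" for i
      by (simp add: cross_def evXY_varXY c_def)
    ultimately have \<xi>': "evXY c (\<xi>' i) = matvec M (cross x y) i" for i by (simp add: matvec_def)
    have "0 = evXY c (ev3 constXY \<xi>' p)"
      unfolding \<open>ev3 constXY \<xi>' p = 0\<close> using hom_0 [OF h] by simp
    also have "\<dots> = ev3 (\<lambda>x. x) (\<lambda>i. evXY c (\<xi>' i)) p"
      by (simp add: hom_ev3 [OF h comm_ring_hom_constXY] evXY_constXY)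
    also have "\<dots> = eval3 p z0 z1 z2"
      using v xy unfolding ev3_id_eq_eval3 \<xi>' by (simp add: matvec_def)
    finally show ?thesis by simp
  qed
  with p show False using eval3_zero_imp_zero by blast
qed

lemma \<xi>_nonzero:
  fixes M :: "nat \<Rightarrow> nat \<Rightarrow> 'k::field_char_0"
  assumes "det3 M \<noteq> 0"
  shows "\<xi> M 2 \<noteq> 0"
proof -
  have "monom (monom (monom 1 0) 0) 1 \<noteq> (0 :: 'k poly poly poly)" by (simp add: monom_eq_0_iff)
  from \<xi>_independent [OF assms this] show ?thesis
    unfolding ev3_monom [OF comm_ring_hom_embF] by (simp add: hom_1 [OF comm_ring_hom_embF])
qed

lemma cross_nonzero: "cross xF yF 2 \<noteq> (0 :: 'k::field_char_0 FF)"
proof -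
  let ?M = "\<lambda>i j. if i = j then 1 else 0 :: 'k"
  have "det3 ?M \<noteq> 0" by (simp add: det3_def)
  moreover have "\<xi> ?M 2 = cross xF yF 2"
    by (simp add: \<xi>_def matvec_def hom_0 [OF comm_ring_hom_embF] hom_1 [OF comm_ring_hom_embF])
  ultimately show ?thesis using \<xi>_nonzero by metis
qed

subsection \<open>Linear dependence\<close>

text \<open>Gaussian elimination: a pivot \<open>i0\<close> clears the top coefficient of all
  others, at the cost of one index and one coefficient.\<close>

lemma poly_family_dependent:
  fixes u :: "'i \<Rightarrow> 'a::field poly"
  assumes "finite I" "card I > n" "\<And>i k. i \<in> I \<Longrightarrow> k \<ge> n \<Longrightarrow> coeff (u i) k = 0"
  shows "\<exists>c. (\<exists>i\<in>I. c i \<noteq> 0) \<and> (\<Sum>i\<in>I. smult (c i) (u i)) = 0"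
  using assms
proof (induction n arbitrary: I u)
  case 0
  then obtain i where "i \<in> I" by fastforce
  moreover have "u i = 0" if "i \<in> I" for i using 0(3) [OF that] by (intro poly_eqI) simp
  ultimately show ?case by (intro exI [of _ "\<lambda>_. 1"]) auto
next
  case (Suc n)
  show ?case
  proof (cases "\<forall>i\<in>I. coeff (u i) n = 0")
    case True
    with Suc.prems(3) have "coeff (u i) k = 0" if "i \<in> I" "k \<ge> n" for i k
      using that by (cases "k = n") auto
    then show ?thesis using Suc.IH [of I u] Suc.prems by simp
  next
    case False
    then obtain i0 where i0: "i0 \<in> I" "coeff (u i0) n \<noteq> 0" by blast
    define r where "r i = coeff (u i) n / coeff (u i0) n" for i
    let ?v = "\<lambda>i. u i - smult (r i) (u i0)"
    have "coeff (?v i) k = 0" if "i \<in> I - {i0}" "k \<ge> n" for i k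
      using that i0 Suc.prems(3) by (cases "k = n") (auto simp: r_def)
    moreover have "card (I - {i0}) > n" using Suc.prems i0 by simp
    ultimately obtain c where c: "\<exists>i\<in>I - {i0}. c i \<noteq> 0" "(\<Sum>i\<in>I - {i0}. smult (c i) (?v i)) = 0"
      using Suc.IH [of "I - {i0}" ?v] Suc.prems(1) by auto
    define c' where "c' i = (if i = i0 then - (\<Sum>i\<in>I - {i0}. c i * r i) else c i)" for i
    have "(\<Sum>i\<in>I. smult (c' i) (u i)) = smult (c' i0) (u i0) + (\<Sum>i\<in>I - {i0}. smult (c' i) (u i))"
      by (rule sum.remove [OF Suc.prems(1) i0(1)])
    also have "(\<Sum>i\<in>I - {i0}. smult (c' i) (u i)) = (\<Sum>i\<in>I - {i0}. smult (c i) (u i))"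
      by (intro sum.cong) (auto simp: c'_def)
    also have "smult (c' i0) (u i0) + \<dots> = (\<Sum>i\<in>I - {i0}. smult (c i) (?v i))"
      by (simp add: c'_def smult_diff_right sum_subtractf smult_sum)
    finally have "(\<Sum>i\<in>I. smult (c' i) (u i)) = 0" using c(2) by simp
    moreover have "\<exists>i\<in>I. c' i \<noteq> 0" using c(1) by (auto simp: c'_def)
    ultimately show ?thesis by blast
  qed
qed

text \<open>Three univariate polynomials parametrize at most a curve. There are (e + 1)^2 monomials
  of degree 2 e with first two exponents at most e, but their values have only 2 e d + 1
  coefficients. The relation is taken homogeneous because it is applied to values known only up to a
  factor \<open>l\<close>.\<close>

lemma algebraic_relation:
  fixes q :: "nat \<Rightarrow> 'a::field poly"
  assumes deg: "\<And>i. degree (q i) \<le> d"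
  obtains p :: "'a poly poly poly" and m where "p \<noteq> 0" "ev3 (\<lambda>c. [:c:]) q p = 0"
    "\<And>(\<sigma> :: 'a \<Rightarrow> 'b::comm_ring_1) \<xi> l. comm_ring_hom \<sigma> \<Longrightarrow> ev3 \<sigma> (\<lambda>i. l * \<xi> i) p = l ^ m * ev3 \<sigma> \<xi> p"
proof -
  define e where "e = 2 * d + 1"
  let ?I = "{..e} \<times> {..e}"
  define u where "u = (\<lambda>(i, j). q 0 ^ i * q 1 ^ j * q 2 ^ (2 * e - i - j))"
  have "degree (u ij) \<le> 2 * e * d" if I: "ij \<in> ?I" for ij
  proof -
    obtain i j where ij: "ij = (i, j)" "i \<le> e" "j \<le> e" using I by (cases ij) simp
    have "degree (u ij) \<le> degree (q 0 ^ i) + degree (q 1 ^ j) + degree (q 2 ^ (2 * e - i - j))"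
      unfolding u_def ij prod.case 
      by (rule order.trans [OF degree_mult_le add_right_mono [OF degree_mult_le]])
    also have "\<dots> \<le> d * i + d * j + d * (2 * e - i - j)"
      by (intro add_mono order.trans [OF degree_power_le] mult_right_mono deg) auto
    also have "\<dots> = d * (i + j + (2 * e - i - j))" by (simp add: algebra_simps)
    also have "i + j + (2 * e - i - j) = 2 * e" using ij by simp
    finally show ?thesis by (simp add: mult.commute)
  qed
  then have "coeff (u ij) k = 0" if "ij \<in> ?I" "k \<ge> Suc (2 * e * d)" for ij k
    using that by (intro coeff_eq_0) fastforce
  \<comment> \<open>The bound \<open>2 d + 1\<close> makes the number of monomials exceed that of the coefficients of \<open>u\<close>.\<close>
  moreover have "card ?I > Suc (2 * e * d)"
    by (simp add: e_def card_cartesian_product algebra_simps)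
  ultimately obtain c where c: "\<exists>i\<in>?I. c i \<noteq> 0" "(\<Sum>i\<in>?I. smult (c i) (u i)) = 0"
    using poly_family_dependent [of ?I "Suc (2 * e * d)" u] by auto
  define mon :: "nat \<times> nat \<Rightarrow> 'a poly poly poly" where
    "mon = (\<lambda>(i, j). monom (monom (monom (c (i, j)) i) j) (2 * e - i - j))"
  define p where "p = (\<Sum>ij\<in>?I. mon ij)"
  have ev: "ev3 \<sigma> \<xi> p = (\<Sum>(i, j)\<in>?I. \<sigma> (c (i, j)) * \<xi> 0 ^ i * \<xi> 1 ^ j * \<xi> 2 ^ (2 * e - i - j))"
    if \<sigma>: "comm_ring_hom \<sigma>" for \<sigma> :: "'a \<Rightarrow> 'c::comm_ring_1" and \<xi>
  proof -
    interpret comm_ring_hom "ev3 \<sigma> \<xi>" by (rule comm_ring_hom_ev3 [OF \<sigma>])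
    show ?thesis
      unfolding p_def hom_sum by (intro sum.cong) (auto simp: mon_def ev3_monom [OF \<sigma>])
  qed
  show ?thesis
  proof (rule that)
    obtain i0 j0 where ij: "(i0, j0) \<in> ?I" "c (i0, j0) \<noteq> 0" using c(1) by auto
    have "coeff (coeff (coeff p (2 * e - i0 - j0)) j0) i0
        = (\<Sum>ij\<in>?I. if ij = (i0, j0) then c (i0, j0) else 0)"
      unfolding p_def coeff_sum by (intro sum.cong) (auto simp: mon_def split: if_splits)
    also have "\<dots> = c (i0, j0)" using ij by simp
    finally show "p \<noteq> 0" using ij by auto
  next
    have "comm_ring_hom (\<lambda>c::'a. [:c:])" ..
    from ev [OF this, of q] show "ev3 (\<lambda>c. [:c:]) q p = 0"
      using c(2) by (simp add: u_def case_prod_unfold mult.assoc)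
  next
    fix \<sigma> :: "'a \<Rightarrow> 'b" and \<xi> and l :: 'b
    assume \<sigma>: "comm_ring_hom \<sigma>"
    show "ev3 \<sigma> (\<lambda>i. l * \<xi> i) p = l ^ (2 * e) * ev3 \<sigma> \<xi> p"
      unfolding ev [OF \<sigma>] sum_distrib_left
    proof (intro sum.cong refl)
      fix ij assume "ij \<in> ?I"
      then obtain i j where ij: "ij = (i, j)" "i \<le> e" "j \<le> e" by (cases ij) simp
      then have "2 * e = i + j + (2 * e - i - j)" by simp
      then have "l ^ (2 * e) = l ^ i * l ^ j * l ^ (2 * e - i - j)" by (metis power_add)
      then show "(case ij of (i, j) \<Rightarrow> \<sigma> (c (i, j)) * (l * \<xi> 0) ^ i * (l * \<xi> 1) ^ j * (l * \<xi> 2) ^ (2 * e - i - j))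
          = l ^ (2 * e) * (case ij of (i, j) \<Rightarrow> \<sigma> (c (i, j)) * \<xi> 0 ^ i * \<xi> 1 ^ j * \<xi> 2 ^ (2 * e - i - j))"
        unfolding ij prod.case
        by (simp add: power_mult_distrib mult_ac)
    qed
  qed
qed

subsection \<open>Specialization to an affine chart\<close>

lemma in_loc_ideal_change_basis:
  assumes F: "F1 = const2 \<alpha> * f + const2 \<beta> * g" "F2 = const2 \<gamma> * f + const2 \<delta> * g"
    and det: "\<alpha> * \<delta> - \<beta> * \<gamma> \<noteq> 0"
  shows "in_loc_ideal F1 F2 a b h \<longleftrightarrow> in_loc_ideal f g a b h"
proof
  assume "in_loc_ideal F1 F2 a b h"
  then obtain p q w where w: "eval2 w a b \<noteq> 0" "w * h = p * F1 + q * F2"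
    unfolding in_loc_ideal_def by blast
  have "w * h = (p * const2 \<alpha> + q * const2 \<gamma>) * f + (p * const2 \<beta> + q * const2 \<delta>) * g"
    unfolding w F by (simp only: algebra_simps)
  with w(1) show "in_loc_ideal f g a b h" unfolding in_loc_ideal_def by blast
next
  assume "in_loc_ideal f g a b h"
  then obtain p q w where w: "eval2 w a b \<noteq> 0" "w * h = p * f + q * g"
    unfolding in_loc_ideal_def by blast
  let ?D = "\<alpha> * \<delta> - \<beta> * \<gamma>"
  have 1: "const2 \<delta> * F1 - const2 \<beta> * F2 = const2 ?D * f"
    unfolding F const2_diff const2_mult by (simp only: algebra_simps)
  have 2: "const2 \<alpha> * F2 - const2 \<gamma> * F1 = const2 ?D * g"
    unfolding F const2_diff const2_mult by (simp only: algebra_simps)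
  have "(const2 ?D * w) * h = p * (const2 ?D * f) + q * (const2 ?D * g)"
    by (simp only: mult.assoc w(2)) (simp only: algebra_simps)
  also have "\<dots> = (p * const2 \<delta> - q * const2 \<gamma>) * F1 + (q * const2 \<alpha> - p * const2 \<beta>) * F2"
    unfolding 1 [symmetric] 2 [symmetric] by (simp only: algebra_simps)
  finally show "in_loc_ideal F1 F2 a b h"
    unfolding in_loc_ideal_def using w(1) det
    by (intro exI [of _ "p * const2 \<delta> - q * const2 \<gamma>"] exI [of _ "q * const2 \<alpha> - p * const2 \<beta>"]
        exI [of _ "const2 ?D * w"]) (simp add: eval2_mult)
qed

lemma homogeneous3_degree_le:
  "homogeneous3 s d \<Longrightarrow> degree s \<le> d"
proof (rule degree_le, intro allI impI)
  fix k assume "homogeneous3 s d" "k > d"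
  then have "coeff (coeff (coeff s k) j) i = 0" for i j
    unfolding homogeneous3_def coeff3_def by (metis add_lessD1 not_add_less2 less_irrefl)
  then show "coeff s k = 0" by (intro poly_eqI) simp
qed

text \<open>By degree, the coefficient of t3^d is free of t1 and t2. When nonzero it survives every
  specialization of t1 and t2, so that degrees in t3 are kept and resultants commute with
  specialization.\<close>

lemma homogeneous3_top_coeff:
  fixes s :: "'a::comm_ring_1 poly poly poly"
  assumes "homogeneous3 s d"
  shows "coeff s d = [:[:eval3 s 0 0 1:]:]"
proof -
  have c: "coeff (coeff (coeff s k) j) i = 0" if "i + j + k \<noteq> d" for i j k
    using assms that unfolding homogeneous3_def coeff3_def by blast
  have "eval3 s 0 0 1 = (\<Sum>k\<le>d. coeff (map_poly (\<lambda>q. poly (map_poly (\<lambda>r. poly r 0) q) 0) s) k * 1 ^ k)"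
    unfolding eval3_def
    by (intro poly_eq_sum_atMost order.trans [OF degree_map_poly_le homogeneous3_degree_le [OF assms]])
  also have "\<dots> = (\<Sum>k\<le>d. coeff (coeff (coeff s k) 0) 0)"
    by (simp add: coeff_map_poly poly_0_coeff_0)
  also have "\<dots> = (\<Sum>k\<le>d. if k = d then coeff (coeff (coeff s d) 0) 0 else 0)"
    using c by (intro sum.cong) auto
  finally have "eval3 s 0 0 1 = coeff (coeff (coeff s d) 0) 0" by simp
  then show ?thesis
    using c by (intro poly_eqI) (auto simp: coeff_pCons split: nat.split)
qed

text \<open>Over K the polynomial splits into linear factors, and the embedding preserves this
  factorization, so F adds no roots.\<close>

lemma root_map_poly_embF:
  fixes q :: "'k::alg_closed_field poly"
  assumes "q \<noteq> 0" "poly (map_poly embF q) b = 0"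
  shows "\<exists>b'. b = embF b' \<and> poly q b' = 0"
  using assms
proof (induction "degree q" arbitrary: q)
  case 0
  then obtain c where "q = [:c:]" by (metis degree_eq_zeroE)
  with 0 show ?case by (simp add: Polynomial.map_poly_pCons)
next
  case (Suc n)
  interpret m: map_poly_comm_ring_hom "embF :: 'k \<Rightarrow> _"
    using comm_ring_hom_embF by (rule map_poly_comm_ring_hom.intro)
  obtain r where r: "poly q r = 0" using Suc.hyps(2) alg_closed_imp_poly_has_root [of q] by auto
  then obtain q' where q': "q = [:-r, 1:] * q'" by (metis poly_eq_0_iff_dvd dvdE)
  have "q' \<noteq> 0" using Suc q' by auto
  have deg: "n = degree q'"
    using Suc.hyps(2) \<open>q' \<noteq> 0\<close> unfolding q' by (subst (asm) degree_mult_eq) auto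
  have "poly (map_poly embF q) b = poly (map_poly embF [:-r, 1:]) b * poly (map_poly embF q') b"
    unfolding q' m.hom_mult by (rule poly_mult)
  also have "poly (map_poly embF [:-r, 1:]) b = b - embF r"
    using hom_diff [OF comm_ring_hom_embF, of 0 r] hom_0 [OF comm_ring_hom_embF] hom_1 [OF comm_ring_hom_embF]
    by (simp add: Polynomial.map_poly_pCons)
  finally consider "b = embF r" | "poly (map_poly embF q') b = 0"
    using Suc.prems(2) by auto
  then show ?case
  proof cases
    case 1
    then show ?thesis using r by blast
  next
    case 2
    from Suc.hyps(1) [OF deg \<open>q' \<noteq> 0\<close> this] show ?thesis unfolding q' by auto
  qed
qed

section \<open>The forms of the net over the generic point\<close>

locale net =
  fixes s1 s2 s3 :: "'k::{alg_closed_field, field_char_0, field_gcd} poly poly poly" and d :: nat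
    and M :: "nat \<Rightarrow> nat \<Rightarrow> 'k"
  assumes hom1: "homogeneous3 s1 d" and hom2: "homogeneous3 s2 d" and hom3: "homogeneous3 s3 d"
    and top1: "eval3 s1 0 0 1 \<noteq> 0"
    and det_M: "det3 M \<noteq> 0"
    and top_L: "M 2 0 * eval3 s1 0 0 1 + M 2 1 * eval3 s2 0 0 1 + M 2 2 * eval3 s3 0 0 1 \<noteq> 0"
begin

definition R where "R = resultant (J1 M s1 s2 s3) (J2 M s1 s2 s3)"

definition c_top :: "nat \<Rightarrow> 'k" where
  "c_top j = (if j = 0 then eval3 s1 0 0 1 else if j = 1 then eval3 s2 0 0 1 else eval3 s3 0 0 1)"

text \<open>Coordinates, with respect to s1, s2, s3, of \<open>J1\<close> with the generic point
  substituted for x; \<open>\<mu>2\<close> does the same for \<open>J2\<close>.\<close>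

definition \<mu>1 :: "nat \<Rightarrow> 'k FF" where "\<mu>1 j = \<xi> M 2 * embF (M 0 j) - \<xi> M 0 * embF (M 2 j)"
definition \<mu>2 :: "nat \<Rightarrow> 'k FF" where "\<mu>2 j = \<xi> M 2 * embF (M 1 j) - \<xi> M 1 * embF (M 2 j)"

text \<open>With l = M c_top, the coefficient of t3^d in \<open>J1\<close> is the linear form x3 l_0
  - x1 l_2 at the generic point (indices of l from 0), and similarly for \<open>J2\<close>. By
  \<open>top_L\<close> the entry l_2, the value of L_3(S) at (0,0,1), is nonzero, so both linear
  forms are nonzero.\<close>

lemma top_\<mu>:
  "\<mu>1 0 * embF (c_top 0) + \<mu>1 1 * embF (c_top 1) + \<mu>1 2 * embF (c_top 2) \<noteq> 0" (is "?t1 \<noteq> 0")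
  "\<mu>2 0 * embF (c_top 0) + \<mu>2 1 * embF (c_top 1) + \<mu>2 2 * embF (c_top 2) \<noteq> 0" (is "?t2 \<noteq> 0")
proof -
  interpret comm_ring_hom "embF :: 'k \<Rightarrow> _" by (rule comm_ring_hom_embF)
  interpret ev: comm_ring_hom "ev3 embF (\<xi> M)" by (rule comm_ring_hom_ev3) (rule comm_ring_hom_embF)
  let ?l = "\<lambda>i. matvec M c_top i"
  have l2: "?l 2 \<noteq> 0" using top_L by (simp add: matvec_def c_top_def)
  have emb_l: "embF (?l i) = embF (M i 0) * embF (c_top 0) + embF (M i 1) * embF (c_top 1) + embF (M i 2) * embF (c_top 2)" for i
    by (simp add: matvec_def hom_add hom_mult)
  let ?p = "monom (monom (monom (?l 0) 0) 0) 1 - monom (monom (monom (?l 2) 1) 0) 0"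
  have "coeff (coeff (coeff ?p 0) 0) 1 \<noteq> 0" using l2 by simp
  then have "?p \<noteq> 0" by (metis coeff_0)
  from \<xi>_independent [OF det_M this] have "\<xi> M 2 * embF (?l 0) - \<xi> M 0 * embF (?l 2) \<noteq> 0"
    unfolding ev.hom_minus ev3_monom [OF comm_ring_hom_embF] by (simp add: mult.commute)
  then show "?t1 \<noteq> 0" unfolding emb_l \<mu>1_def by (simp add: algebra_simps)
  let ?p = "monom (monom (monom (?l 1) 0) 0) 1 - monom (monom (monom (?l 2) 0) 1) 0"
  have "coeff (coeff (coeff ?p 0) 1) 0 \<noteq> 0" using l2 by simp
  then have "?p \<noteq> 0" by (metis coeff_0)
  from \<xi>_independent [OF det_M this] have "\<xi> M 2 * embF (?l 1) - \<xi> M 1 * embF (?l 2) \<noteq> 0"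
    unfolding ev.hom_minus ev3_monom [OF comm_ring_hom_embF] by (simp add: mult.commute)
  then show "?t2 \<noteq> 0" unfolding emb_l \<mu>2_def by (simp add: algebra_simps)
qed

text \<open>With n = x \<times> y and \<xi> = M n, both \<mu> are orthogonal to n, hence lie in the
  span of x and y. \<open>A\<close> and \<open>B\<close> solve for the first two coordinates by
  Cramer's rule with determinant \<open>n 2\<close>; orthogonality yields the third.\<close>

lemma \<mu>_span:
  obtains \<alpha> \<beta> \<gamma> \<delta> where
    "\<And>j. j < 3 \<Longrightarrow> \<mu>1 j = \<alpha> * xF j + \<beta> * yF j"
    "\<And>j. j < 3 \<Longrightarrow> \<mu>2 j = \<gamma> * xF j + \<delta> * yF j" "\<alpha> * \<delta> - \<beta> * \<gamma> \<noteq> 0"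
proof -
  interpret comm_ring_hom "embF :: 'k \<Rightarrow> _" by (rule comm_ring_hom_embF)
  define n where "n = (cross xF yF :: nat \<Rightarrow> 'k FF)"
  have n: "n 0 = xF 1 * yF 2 - xF 2 * yF 1" "n 1 = xF 2 * yF 0 - xF 0 * yF 2" "n 2 = xF 0 * yF 1 - xF 1 * yF 0"
    by (simp_all add: n_def cross_def)
  have n2: "n 2 \<noteq> 0" unfolding n_def by (rule cross_nonzero)
  have \<xi>: "\<xi> M i = embF (M i 0) * n 0 + embF (M i 1) * n 1 + embF (M i 2) * n 2" for i
    by (simp add: \<xi>_def matvec_def n_def)
  have orth: "\<mu> 2 * n 2 = - \<mu> 0 * n 0 - \<mu> 1 * n 1" if "\<mu> = \<mu>1 \<or> \<mu> = \<mu>2" for \<mu>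
    using that unfolding \<mu>1_def [abs_def] \<mu>2_def [abs_def] \<xi> by (elim disjE) (simp_all add: algebra_simps)
  define A where "A \<mu> = (\<mu> 0 * yF 1 - \<mu> 1 * yF 0) / n 2" for \<mu> :: "nat \<Rightarrow> 'k FF"
  define B where "B \<mu> = (xF 0 * \<mu> 1 - xF 1 * \<mu> 0) / n 2" for \<mu> :: "nat \<Rightarrow> 'k FF"
  have span: "\<mu> j = A \<mu> * xF j + B \<mu> * yF j" if \<mu>: "\<mu> = \<mu>1 \<or> \<mu> = \<mu>2" and j: "j < 3" for \<mu> j
  proof -
    have AB: "A \<mu> * n 2 = \<mu> 0 * yF 1 - \<mu> 1 * yF 0" "B \<mu> * n 2 = xF 0 * \<mu> 1 - xF 1 * \<mu> 0"
      using n2 by (simp_all add: A_def B_def)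
    have "(A \<mu> * xF j + B \<mu> * yF j) * n 2 = (A \<mu> * n 2) * xF j + (B \<mu> * n 2) * yF j"
      by (simp add: algebra_simps)
    also have "\<dots> = (\<mu> 0 * yF 1 - \<mu> 1 * yF 0) * xF j + (xF 0 * \<mu> 1 - xF 1 * \<mu> 0) * yF j"
      unfolding AB ..
    also have "\<dots> = \<mu> j * n 2"
    proof -
      consider "j = 0" | "j = 1" | "j = 2" using j by linarith
      then show ?thesis
      proof cases
        case 3
        show ?thesis unfolding 3 orth [OF \<mu>] n(1,2) by (simp add: algebra_simps)
      qed (unfold n(3), simp_all add: algebra_simps)
    qed
    finally show ?thesis using n2 by simp
  qed
  have "(A \<mu>1 * B \<mu>2 - B \<mu>1 * A \<mu>2) * (n 2 * n 2) = (\<mu>1 0 * \<mu>2 1 - \<mu>1 1 * \<mu>2 0) * n 2"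
  proof -
    have "(A \<mu>1 * B \<mu>2 - B \<mu>1 * A \<mu>2) * (n 2 * n 2)
        = (A \<mu>1 * n 2) * (B \<mu>2 * n 2) - (B \<mu>1 * n 2) * (A \<mu>2 * n 2)" by (simp add: algebra_simps)
    also have "\<dots> = (\<mu>1 0 * yF 1 - \<mu>1 1 * yF 0) * (xF 0 * \<mu>2 1 - xF 1 * \<mu>2 0)
        - (xF 0 * \<mu>1 1 - xF 1 * \<mu>1 0) * (\<mu>2 0 * yF 1 - \<mu>2 1 * yF 0)"
      using n2 by (simp add: A_def B_def)
    also have "\<dots> = (\<mu>1 0 * \<mu>2 1 - \<mu>1 1 * \<mu>2 0) * n 2"
      unfolding n by (simp add: algebra_simps)
    finally show ?thesis .
  qed
  \<comment> \<open>So the base change from x, y to the two \<mu> has determinant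
    \<open>\<xi> M 2\<close> times \<open>det3 M\<close>, which is nonzero.\<close>
  moreover have "\<mu>1 0 * \<mu>2 1 - \<mu>1 1 * \<mu>2 0 = \<xi> M 2 * (embF (det3 M) * n 2)"
  proof -
    have det: "embF (det3 M) = det3 (\<lambda>i j. embF (M i j))"
      by (simp add: det3_def hom_add hom_mult hom_minus)
    have *: "embF (det3 M) * n 2 = \<xi> M 2 * (embF (M 0 0) * embF (M 1 1) - embF (M 0 1) * embF (M 1 0))
        - \<xi> M 1 * (embF (M 0 0) * embF (M 2 1) - embF (M 0 1) * embF (M 2 0))
        - \<xi> M 0 * (embF (M 2 0) * embF (M 1 1) - embF (M 2 1) * embF (M 1 0))"
      unfolding det unfolding \<xi> det3_def by (simp only: algebra_simps)
    show ?thesis unfolding * \<mu>1_def \<mu>2_def by (simp add: algebra_simps)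
  qed
  moreover have "\<xi> M 2 * (embF (det3 M) * n 2) \<noteq> 0"
    using \<xi>_nonzero [OF det_M] det_M n2 by simp
  ultimately have "(A \<mu>1 * B \<mu>2 - B \<mu>1 * A \<mu>2) * (n 2 * n 2) \<noteq> 0"
    using n2 by simp
  then have "A \<mu>1 * B \<mu>2 - B \<mu>1 * A \<mu>2 \<noteq> 0" by auto
  with span [of \<mu>1] span [of \<mu>2] show ?thesis by (intro that) auto
qed

lemma degree_J: "degree (J1 M s1 s2 s3) \<le> d" "degree (J2 M s1 s2 s3) \<le> d"
proof -
  have "coeff s k = 0" if "k > d" "s = s1 \<or> s = s2 \<or> s = s3" for s k
    using that homogeneous3_degree_le [OF hom1] homogeneous3_degree_le [OF hom2]
      homogeneous3_degree_le [OF hom3] by (auto intro!: coeff_eq_0)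
  then have "coeff (J1 M s1 s2 s3) k = 0" "coeff (J2 M s1 s2 s3) k = 0" if "k > d" for k
    using that
    by (simp_all add: J1_def J2_def liftJ_def LS_def const3_def coeff_map_poly liftTX_def)
  then show "degree (J1 M s1 s2 s3) \<le> d" "degree (J2 M s1 s2 s3) \<le> d"
    by (auto intro: degree_le)
qed

end

section \<open>Specialization in one chart, for both dehomogenizations at once\<close>

locale chart = net +
  fixes \<delta> :: "'a poly poly \<Rightarrow> 'a poly"
  assumes \<delta>: "comm_ring_hom \<delta>" and \<delta>_const: "\<And>c. \<delta> [:[:c:]:] = [:c:]"
begin

text \<open>\<open>\<sigma>\<close> takes K[t1, t2] to F[u], and t3 plays the role of v.
  \<open>\<psi>\<close> also sends x to the generic point and so carries the coefficient ring of
  \<open>J1\<close> and \<open>J2\<close> to F[u].\<close>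

definition \<sigma> :: "'a poly poly \<Rightarrow> 'a FF poly" where "\<sigma> q = map_poly embF (\<delta> q)"
definition P :: "'a poly poly poly \<Rightarrow> 'a FF poly poly" where "P s = map_poly \<sigma> s"
definition \<psi> :: "'a polyTX \<Rightarrow> 'a FF poly" where "\<psi> = ev3 \<sigma> (\<lambda>i. [:\<xi> M i:])"
definition V :: "(nat \<Rightarrow> 'a FF) \<Rightarrow> 'a FF poly poly" where
  "V x = const2 (x 0) * P s1 + const2 (x 1) * P s2 + const2 (x 2) * P s3"
text \<open>Restriction to the K-rational line u = a; \<open>Z a\<close> collects the base points on
  that line.\<close>

definition sec :: "'a \<Rightarrow> 'a poly poly poly \<Rightarrow> 'a poly" where
  "sec a s = map_poly (\<lambda>q. poly (\<delta> q) a) s"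
definition Z :: "'a \<Rightarrow> 'a set" where
  "Z a = {b. poly (sec a s1) b = 0 \<and> poly (sec a s2) b = 0 \<and> poly (sec a s3) b = 0}"

lemma \<sigma>: "comm_ring_hom \<sigma>"
proof -
  interpret m: map_poly_comm_ring_hom "embF :: 'a \<Rightarrow> _"
    using comm_ring_hom_embF by (rule map_poly_comm_ring_hom.intro)
  show ?thesis unfolding \<sigma>_def [abs_def] by (rule comm_ring_hom_comp [OF _ \<delta>]) unfold_locales
qed

lemma \<psi>: "comm_ring_hom \<psi>"
  unfolding \<psi>_def by (rule comm_ring_hom_ev3 [OF \<sigma>])

lemma \<sigma>_const: "\<sigma> [:[:c:]:] = [:embF c:]"
  by (simp add: \<sigma>_def \<delta>_const Polynomial.map_poly_pCons hom_0 [OF comm_ring_hom_embF])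

lemma \<psi>_liftTX: "\<psi> (liftTX q) = \<sigma> q"
  unfolding \<psi>_def liftTX_def by (rule ev3_const [OF \<sigma>])

lemma \<psi>_varX: "\<psi> (varX 0) = [:\<xi> M 0:]" "\<psi> (varX 1) = [:\<xi> M 1:]" "\<psi> (varX 2) = [:\<xi> M 2:]"
proof -
  have 0: "varX 0 = monom (monom (monom (1 :: 'a poly poly) 1) 0) 0"
    and 1: "varX 1 = monom (monom (monom (1 :: 'a poly poly) 0) 1) 0"
    and 2: "varX 2 = monom (monom (monom (1 :: 'a poly poly) 0) 0) 1"
    by (simp_all add: varX_def monom_0 monom_Suc pCons_one)
  show "\<psi> (varX 0) = [:\<xi> M 0:]" "\<psi> (varX 1) = [:\<xi> M 1:]" "\<psi> (varX 2) = [:\<xi> M 2:]"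
    unfolding 0 1 2 \<psi>_def ev3_monom [OF \<sigma>] by (simp_all add: hom_1 [OF \<sigma>])
qed

lemma P_add: "P (x + y) = P x + P y" and P_mult: "P (x * y) = P x * P y"
proof -
  interpret m: map_poly_comm_ring_hom \<sigma> using \<sigma> by (rule map_poly_comm_ring_hom.intro)
  show "P (x + y) = P x + P y" "P (x * y) = P x * P y"
    unfolding P_def by (simp_all add: m.hom_add m.hom_mult)
qed

lemma P_const3: "P (const3 c) = const2 (embF c)"
  by (simp add: P_def const3_def const2_def Polynomial.map_poly_pCons hom_0 [OF \<sigma>] \<sigma>_const)

lemma \<psi>_liftJ: "map_poly \<psi> (liftJ s) = P s"
proof -
  have "liftTX 0 = (0 :: 'a polyTX)" by (simp add: liftTX_def)
  then show ?thesis
    by (intro poly_eqI) (simp add: liftJ_def P_def coeff_map_poly hom_0 [OF \<psi>] hom_0 [OF \<sigma>] \<psi>_liftTX)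
qed

lemma \<psi>_J: "map_poly \<psi> (J1 M s1 s2 s3) = V \<mu>1" "map_poly \<psi> (J2 M s1 s2 s3) = V \<mu>2"
proof -
  interpret m: map_poly_comm_ring_hom \<psi> using \<psi> by (rule map_poly_comm_ring_hom.intro)
  have c: "map_poly \<psi> [:x:] = [:\<psi> x:]" for x
    by (simp add: Polynomial.map_poly_pCons hom_0 [OF \<psi>])
  have L: "P (LS M i s1 s2 s3) = const2 (embF (M i 0)) * P s1 + const2 (embF (M i 1)) * P s2 + const2 (embF (M i 2)) * P s3" for i
    by (simp add: LS_def P_add P_mult P_const3)
  show "map_poly \<psi> (J1 M s1 s2 s3) = V \<mu>1" "map_poly \<psi> (J2 M s1 s2 s3) = V \<mu>2"
    unfolding J1_def J2_def V_def \<mu>1_def \<mu>2_def m.hom_minus m.hom_mult c \<psi>_liftJ L \<psi>_varX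
      const2_diff const2_mult const2_def [symmetric]
    by (simp_all only: algebra_simps)
qed

lemma V_linear:
  assumes "\<And>j. j < 3 \<Longrightarrow> z j = \<alpha> * x j + \<beta> * y j"
  shows "V z = const2 \<alpha> * V x + const2 \<beta> * V y"
proof -
  have z: "z 0 = \<alpha> * x 0 + \<beta> * y 0" "z 1 = \<alpha> * x 1 + \<beta> * y 1" "z 2 = \<alpha> * x 2 + \<beta> * y 2"
    using assms by simp_all
  show ?thesis unfolding V_def z const2_add const2_mult by (simp only: algebra_simps)
qed

lemma int_mult_aff_V: "int_mult_aff (V \<mu>1) (V \<mu>2) a b = int_mult_aff (V xF) (V yF) a b"
proof -
  obtain \<alpha> \<beta> \<gamma> \<delta> where *:
    "\<And>j. j < 3 \<Longrightarrow> \<mu>1 j = \<alpha> * xF j + \<beta> * yF j"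
    "\<And>j. j < 3 \<Longrightarrow> \<mu>2 j = \<gamma> * xF j + \<delta> * yF j" "\<alpha> * \<delta> - \<beta> * \<gamma> \<noteq> 0"
    using \<mu>_span by blast
  have V1: "V \<mu>1 = const2 \<alpha> * V xF + const2 \<beta> * V yF" by (rule V_linear) (rule *(1))
  have V2: "V \<mu>2 = const2 \<gamma> * V xF + const2 \<delta> * V yF" by (rule V_linear) (rule *(2))
  show ?thesis
    unfolding int_mult_aff_eq_codim in_loc_ideal_change_basis [OF V1 V2 *(3)] ..
qed

lemma coeff_P_top:
  assumes "homogeneous3 s d"
  shows "coeff (P s) d = [:embF (eval3 s 0 0 1):]" "k > d \<Longrightarrow> coeff (P s) k = 0"
proof -
  show "coeff (P s) d = [:embF (eval3 s 0 0 1):]"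
    by (simp add: P_def coeff_map_poly hom_0 [OF \<sigma>] homogeneous3_top_coeff [OF assms] \<sigma>_const)
  show "coeff (P s) k = 0" if "k > d"
    using homogeneous3_degree_le [OF assms] that
    by (simp add: P_def coeff_map_poly hom_0 [OF \<sigma>] coeff_eq_0)
qed

lemma degree_V:
  assumes "x 0 * embF (c_top 0) + x 1 * embF (c_top 1) + x 2 * embF (c_top 2) \<noteq> 0" (is "?c \<noteq> 0")
  shows "degree (V x) = d" "lead_coeff (V x) = [:?c:]"
proof -
  have c: "coeff (V x) d = [:?c:]"
    by (simp add: V_def const2_def coeff_P_top(1) hom1 hom2 hom3 c_top_def)
  have "degree (V x) \<le> d"
    by (rule degree_le) (simp add: V_def const2_def coeff_P_top(2) hom1 hom2 hom3)
  moreover have "d \<le> degree (V x)" using c assms by (intro le_degree) simp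
  ultimately show "degree (V x) = d" by simp
  with c show "lead_coeff (V x) = [:?c:]" by simp
qed

lemma degree_J_eq: "degree (J1 M s1 s2 s3) = d" "degree (J2 M s1 s2 s3) = d"
proof -
  have "degree (map_poly \<psi> (J1 M s1 s2 s3)) = d" "degree (map_poly \<psi> (J2 M s1 s2 s3)) = d"
    unfolding \<psi>_J by (intro degree_V top_\<mu>)+
  then have "d \<le> degree (J1 M s1 s2 s3)" "d \<le> degree (J2 M s1 s2 s3)"
    by (metis degree_map_poly_le)+
  with degree_J show "degree (J1 M s1 s2 s3) = d" "degree (J2 M s1 s2 s3) = d" by auto
qed

text \<open>Substitution commutes with the resultant because neither degree in t3 drops, by
  \<open>top_\<mu>\<close>.\<close>

lemma resultant_V: "resultant (V \<mu>1) (V \<mu>2) = \<psi> R"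
  unfolding R_def \<psi>_J [symmetric]
  by (rule comm_ring_hom.resultant_map_poly [OF \<psi>])
     (simp_all only: \<psi>_J degree_J_eq degree_V(1) [OF top_\<mu>(1)] degree_V(1) [OF top_\<mu>(2)])

lemma eval2_P: "eval2 (P s) (embF a) b = poly (map_poly embF (sec a s)) b"
proof -
  interpret comm_ring_hom "embF :: 'a \<Rightarrow> _" by (rule comm_ring_hom_embF)
  have "map_poly (\<lambda>r. poly r (embF a)) (P s) = map_poly embF (sec a s)"
    by (intro poly_eqI) (simp add: P_def sec_def coeff_map_poly hom_0 [OF \<sigma>] hom_0 [OF \<delta>] \<sigma>_def)
  then show ?thesis by (simp add: eval2_def)
qed

lemma coeff_sec_top: "homogeneous3 s d \<Longrightarrow> coeff (sec a s) d = eval3 s 0 0 1"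
  by (simp add: sec_def coeff_map_poly hom_0 [OF \<delta>] homogeneous3_top_coeff \<delta>_const)

lemma sec_s1_nonzero: "sec a s1 \<noteq> 0"
  using coeff_sec_top [OF hom1, of a] top1 by auto

lemma finite_Z: "finite (Z a)"
  by (rule finite_subset [OF _ poly_roots_finite [OF sec_s1_nonzero, of a]]) (auto simp: Z_def)

lemma degree_sec: "homogeneous3 s d \<Longrightarrow> degree (sec a s) \<le> d"
  unfolding sec_def by (rule order.trans [OF degree_map_poly_le homogeneous3_degree_le])

text \<open>On a \<open>K\<close>-rational line the map is given by univariate forms, which satisfy an algebraic
  relation over \<open>K\<close>; a generic point does not, so that all common zeros on the line are base points.\<close>

lemma common_zero:
  assumes "eval2 (V \<mu>1) (embF a) b = 0" "eval2 (V \<mu>2) (embF a) b = 0"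
  shows "b \<in> embF ` Z a"
proof -
  interpret comm_ring_hom "embF :: 'a \<Rightarrow> _" by (rule comm_ring_hom_embF)
  interpret m: map_poly_comm_ring_hom "embF :: 'a \<Rightarrow> _"
    using comm_ring_hom_embF by (rule map_poly_comm_ring_hom.intro)
  define t where "t j = (if j = 0 then s1 else if j = 1 then s2 else s3)" for j :: nat
  define S where "S j = eval2 (P (t j)) (embF a) b" for j
  define \<Lambda> where "\<Lambda> = matvec (\<lambda>i j. embF (M i j)) S"
  have V: "eval2 (V x) (embF a) b = x 0 * S 0 + x 1 * S 1 + x 2 * S 2" for x
    by (simp add: V_def S_def t_def eval2_add eval2_mult)
  \<comment> \<open>The two equations say that L(S) at the common zero is a multiple
    \<open>l\<close> of the generic point.\<close>
  have "\<xi> M 2 * \<Lambda> 0 = \<xi> M 0 * \<Lambda> 2" "\<xi> M 2 * \<Lambda> 1 = \<xi> M 1 * \<Lambda> 2"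
    using assms unfolding V \<mu>1_def \<mu>2_def \<Lambda>_def matvec_def by (simp_all add: algebra_simps)
  define l where "l = \<Lambda> 2 / \<xi> M 2"
  have \<Lambda>: "\<Lambda> i = l * \<xi> M i" if "i < 3" for i
  proof -
    consider "i = 0" | "i = 1" | "i = 2" using \<open>i < 3\<close> by linarith
    then show ?thesis
      using \<open>\<xi> M 2 * \<Lambda> 0 = \<xi> M 0 * \<Lambda> 2\<close> \<open>\<xi> M 2 * \<Lambda> 1 = \<xi> M 1 * \<Lambda> 2\<close> \<xi>_nonzero [OF det_M]
      by cases (simp_all add: l_def field_simps)
  qed
  define q where "q i = smult (M i 0) (sec a s1) + smult (M i 1) (sec a s2) + smult (M i 2) (sec a s3)" for i
  have "degree (q i) \<le> d" for i
    unfolding q_def using degree_sec [OF hom1, of a] degree_sec [OF hom2, of a] degree_sec [OF hom3, of a]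
    by (intro degree_add_le) (auto intro: order.trans [OF degree_smult_le])
  then obtain p m where p: "p \<noteq> 0" "ev3 (\<lambda>c. [:c:]) q p = 0"
      "\<And>(\<sigma> :: 'a \<Rightarrow> 'a FF) \<xi> l. comm_ring_hom \<sigma> \<Longrightarrow> ev3 \<sigma> (\<lambda>i. l * \<xi> i) p = l ^ m * ev3 \<sigma> \<xi> p"
    using algebraic_relation by metis
  have q\<Lambda>: "poly (map_poly embF (q i)) b = \<Lambda> i" for i
    by (simp add: q_def \<Lambda>_def S_def t_def matvec_def eval2_P m.hom_add map_poly_hom_smult)
  have h: "comm_ring_hom (\<lambda>q. poly (map_poly embF q) b)"
    by (rule comm_ring_hom_poly_map_poly) (rule comm_ring_hom_embF)
  have h': "comm_ring_hom (\<lambda>c. [:c:] :: 'a poly)" ..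
  \<comment> \<open>The relation among the \<open>q i\<close>, evaluated at \<open>b\<close>,
    becomes \<open>l ^ m\<close> times its value at the generic point, which is nonzero. So
    \<open>l = 0\<close>, and invertibility of \<open>M\<close> makes all three forms
    vanish.\<close>
  have "0 = poly (map_poly embF (ev3 (\<lambda>c. [:c:]) q p)) b" by (simp add: p(2))
  also have "\<dots> = ev3 embF \<Lambda> p"
    unfolding hom_ev3 [OF h h'] q\<Lambda> by (simp add: Polynomial.map_poly_pCons)
  also have "\<dots> = ev3 embF (\<lambda>i. l * \<xi> M i) p"
    unfolding ev3_def using \<Lambda> by simp
  also have "\<dots> = l ^ m * ev3 embF (\<xi> M) p"
    by (rule p(3)) (rule comm_ring_hom_embF)
  finally have "l = 0" using \<xi>_independent [OF det_M p(1)] by auto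
  then have "\<Lambda> 0 = 0" "\<Lambda> 1 = 0" "\<Lambda> 2 = 0" using \<Lambda> by simp_all
  moreover have "det3 (\<lambda>i j. embF (M i j)) \<noteq> 0"
  proof -
    have "embF (det3 M) = det3 (\<lambda>i j. embF (M i j))"
      by (simp add: det3_def hom_add hom_mult hom_minus)
    then show ?thesis using det_M by (metis embF_eq_0_iff)
  qed
  ultimately have S: "S 0 = 0" "S 1 = 0" "S 2 = 0"
    unfolding \<Lambda>_def using matvec_eq_0 by blast+
  have "poly (map_poly embF (sec a s1)) b = 0"
    using S(1) by (simp add: S_def t_def eval2_P)
  then obtain b' where b': "b = embF b'" "poly (sec a s1) b' = 0"
    using root_map_poly_embF [OF sec_s1_nonzero] by blast
  have "poly (sec a s2) b' = 0" "poly (sec a s3) b' = 0"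
    using S(2,3) unfolding S_def t_def eval2_P b'(1) by simp_all
  with b' show ?thesis by (auto simp: Z_def)
qed

lemma inj_embF: "inj (embF :: 'a \<Rightarrow> _)"
  by (rule injI) (metis embF_eq_0_iff eq_iff_diff_eq_0 hom_diff [OF comm_ring_hom_embF])

lemma sum_int_mult:
  assumes "\<psi> R \<noteq> 0"
  shows "(\<Sum>b\<in>Z a. int_mult_aff (V xF) (V yF) (embF a) (embF b)) = enat (order (embF a) (\<psi> R))"
proof -
  have "(\<Sum>b\<in>embF ` Z a. int_mult_aff (V \<mu>1) (V \<mu>2) (embF a) b) = enat (order (embF a) (resultant (V \<mu>1) (V \<mu>2)))"
  proof (rule sum_int_mult_aff_eq_order_resultant)
    show "lead_coeff (V \<mu>1) = [:\<mu>1 0 * embF (c_top 0) + \<mu>1 1 * embF (c_top 1) + \<mu>1 2 * embF (c_top 2):]"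
      by (rule degree_V(2)) (rule top_\<mu>)
  qed (use assms top_\<mu>(1) finite_Z common_zero in \<open>auto simp: resultant_V\<close>)
  then show ?thesis
    unfolding resultant_V int_mult_aff_V
    by (subst (asm) sum.reindex) (auto intro: inj_on_subset [OF inj_embF])
qed

text \<open>At u = a the cofactor \<open>Q\<close> is a nonzero polynomial in x over K, so it does
  not vanish at the generic point: u - a does not divide \<open>\<psi> Q\<close>, and the order
  comes from \<open>C\<close> alone.\<close>

lemma order_\<psi>_R:
  assumes R: "R = liftTX C * Q" and C: "\<delta> C \<noteq> 0"
    and Q: "poly (\<delta> (coeffX Q i j k)) a \<noteq> 0"
  shows "\<psi> R \<noteq> 0" "order (embF a) (\<psi> R) = order a (\<delta> C)"
proof -
  interpret e: comm_ring_hom "embF :: 'a \<Rightarrow> _" by (rule comm_ring_hom_embF)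
  have ea: "comm_ring_hom (\<lambda>q. poly q (embF a))" ..
  let ?\<kappa> = "\<lambda>c. poly (\<delta> c) a"
  have "comm_ring_hom (\<lambda>q. poly q a)" ..
  then have \<kappa>: "comm_ring_hom ?\<kappa>" by (rule comm_ring_hom_comp [OF _ \<delta>])
  let ?Q = "map_poly (map_poly (map_poly ?\<kappa>)) Q"
  have "coeff (coeff (coeff ?Q i) j) k \<noteq> 0" using Q by (simp add: coeff_map_poly hom_0 [OF \<delta>])
  then have "?Q \<noteq> 0" by auto
  have "poly (\<psi> Q) (embF a) = ev3 (\<lambda>c. embF (?\<kappa> c)) (\<xi> M) Q"
    unfolding \<psi>_def hom_ev3 [OF ea \<sigma>] by (simp add: \<sigma>_def)
  also have "\<dots> = ev3 embF (\<xi> M) ?Q"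
    by (rule ev3_map_poly [OF \<kappa> comm_ring_hom_embF, symmetric])
  finally have \<psi>Q: "poly (\<psi> Q) (embF a) \<noteq> 0"
    using \<xi>_independent [OF det_M \<open>?Q \<noteq> 0\<close>] by simp
  have eq: "\<psi> R = map_poly embF (\<delta> C) * \<psi> Q"
    unfolding R hom_times [OF \<psi>] \<psi>_liftTX \<sigma>_def ..
  have emb: "map_poly embF (\<delta> C) \<noteq> 0"
  proof
    assume "map_poly embF (\<delta> C) = 0"
    then have "coeff (map_poly embF (\<delta> C)) n = 0" for n by simp
    then have "\<delta> C = 0" by (intro poly_eqI) (simp add: coeff_map_poly)
    with C show False ..
  qed
  show nz: "\<psi> R \<noteq> 0" using emb \<psi>Q unfolding eq by auto
  have "order (embF a) (\<psi> R) = order (embF a) (map_poly embF (\<delta> C))"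
    using order_mult [OF nz [unfolded eq], of "embF a"] order_0I [OF \<psi>Q] unfolding eq by simp
  also have "\<dots> = order a (\<delta> C)"
  proof -
    obtain w where w: "\<delta> C = [:-a, 1:] ^ order a (\<delta> C) * w" "poly w a \<noteq> 0"
      using order_decomp [OF C, of a] by (metis poly_eq_0_iff_dvd)
    interpret m: map_poly_comm_ring_hom "embF :: 'a \<Rightarrow> _"
      using comm_ring_hom_embF by (rule map_poly_comm_ring_hom.intro)
    have X: "map_poly embF [:-a, 1:] = [:-embF a, 1:]"
      using e.hom_uminus by (simp add: Polynomial.map_poly_pCons)
    have "map_poly embF (\<delta> C) = [:-embF a, 1:] ^ order a (\<delta> C) * map_poly embF w"
      by (subst w(1)) (simp only: m.hom_mult m.hom_power X)
    moreover have "poly (map_poly embF w) (embF a) \<noteq> 0" using w(2) by simp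
    ultimately show ?thesis
      using emb order_power_n_n [of "embF a" "order a (\<delta> C)"] by (simp add: order_mult order_0I)
  qed
  finally show "order (embF a) (\<psi> R) = order a (\<delta> C)" .
qed

text \<open>The leading coefficients in v are constants, so the resultant is still zero after
  restriction to u = a. This gives a common zero over F, which \<open>common_zero\<close> turns into
  a base point.\<close>

lemma Z_nonempty_if_R_0:
  assumes "R = 0"
  shows "Z a \<noteq> {}"
proof -
  let ?h = "\<lambda>r. poly r (embF a)"
  have h: "comm_ring_hom ?h" ..
  have c: "coeff (map_poly ?h (V x)) d \<noteq> 0 \<and> degree (map_poly ?h (V x)) = degree (V x)"
    if "x 0 * embF (c_top 0) + x 1 * embF (c_top 1) + x 2 * embF (c_top 2) \<noteq> 0" for x
  proof -
    have "coeff (map_poly ?h (V x)) d \<noteq> 0"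
      using degree_V [OF that] that by (simp add: coeff_map_poly)
    moreover from this have "d \<le> degree (map_poly ?h (V x))" by (rule le_degree)
    moreover have "degree (map_poly ?h (V x)) \<le> degree (V x)" by (rule degree_map_poly_le)
    ultimately show ?thesis using degree_V(1) [OF that] by simp
  qed
  have "resultant (map_poly ?h (V \<mu>1)) (map_poly ?h (V \<mu>2)) = ?h (resultant (V \<mu>1) (V \<mu>2))"
    using c [OF top_\<mu>(1)] c [OF top_\<mu>(2)] by (intro comm_ring_hom.resultant_map_poly [OF h]) auto
  also have "\<dots> = 0" unfolding resultant_V assms by (simp add: hom_0 [OF \<psi>])
  finally have "degree (gcd (map_poly ?h (V \<mu>1)) (map_poly ?h (V \<mu>2))) \<noteq> 0"
    by (simp add: resultant_0_gcd)
  then obtain b where b: "poly (gcd (map_poly ?h (V \<mu>1)) (map_poly ?h (V \<mu>2))) b = 0"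
    using alg_closed_imp_poly_has_root by blast
  then have "eval2 (V \<mu>1) (embF a) b = 0" "eval2 (V \<mu>2) (embF a) b = 0"
    unfolding eval2_def poly_eq_0_iff_dvd by (rule dvd_trans [OF _ gcd_dvd1], rule dvd_trans [OF _ gcd_dvd2])
  then show ?thesis using common_zero by blast
qed

end

subsection \<open>Finiteness of the base locus\<close>

lemma homogeneous3_iff: "homogeneous3 s d \<longleftrightarrow> gr_poly 1 hom2 (int d) s"
proof -
  have "int i + int j = int d - int (1 * k) \<longleftrightarrow> i + j + k = d" for i j k by auto
  then show ?thesis
    unfolding homogeneous3_def gr_poly_def hom2_iff coeff3_def by blast
qed

lemma gr_poly_const: "graded P \<Longrightarrow> P e c \<Longrightarrow> gr_poly w P e [:c:]"
  unfolding gr_poly_def by (auto simp: coeff_pCons graded_0 split: nat.split)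

lemma gr_poly_var: "graded P \<Longrightarrow> gr_poly 0 P 0 [:0, 1:]"
  unfolding gr_poly_def by (auto simp: coeff_pCons graded_0 graded_1 split: nat.split)

lemma homogeneous3_const3_mult:
  fixes s :: "'a::comm_ring_1 poly poly poly"
  assumes "homogeneous3 s d"
  shows "homogeneous3 (const3 c * s) d"
proof -
  have g: "graded (gr_poly 1 hom2 :: int \<Rightarrow> 'a poly poly poly \<Rightarrow> bool)"
    by (intro graded_gr_poly graded_hom2)
  have "gr_poly 1 hom2 0 (const3 c)"
    unfolding const3_def hom2_def
    by (intro gr_poly_const graded_gr_poly graded_gr0) (simp add: gr0_def)
  from graded_mult [OF g this assms [unfolded homogeneous3_iff]] show ?thesis
    unfolding homogeneous3_iff by simp
qed

lemma homogeneous3_add: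
  fixes s t :: "'a::comm_ring_1 poly poly poly"
  assumes "homogeneous3 s d" "homogeneous3 t d"
  shows "homogeneous3 (s + t) d"
  using assms unfolding homogeneous3_iff
  by (rule graded_add [OF graded_gr_poly [OF graded_hom2]])

lemma homogeneous3_degree_eq:
  fixes s :: "'a::comm_ring_1 poly poly poly"
  assumes "homogeneous3 s d" "eval3 s 0 0 1 \<noteq> 0"
  shows "degree s = d"
  using homogeneous3_degree_le [OF assms(1)] le_degree [of s d] homogeneous3_top_coeff [OF assms(1)] assms(2)
  by auto

lemma comm_ring_hom_eval3: "comm_ring_hom (\<lambda>p. eval3 p a b (c :: 'a::comm_ring_1))"
proof -
  have "comm_ring_hom (\<lambda>x::'a. x)" by unfold_locales auto
  from comm_ring_hom_ev3 [OF this, of "\<lambda>i. if i = 0 then a else if i = 1 then b else c"]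
  show ?thesis unfolding ev3_id_eq_eval3 [abs_def] by simp
qed

lemma eval3_const3: "eval3 (const3 c) a1 a2 a3 = (c :: 'a::comm_ring_1)"
  by (simp add: eval3_def const3_def Polynomial.map_poly_pCons)

lemma comm_ring_hom_\<delta>1: "comm_ring_hom (\<delta>1 :: 'a::comm_ring_1 poly poly \<Rightarrow> _)"
proof -
  interpret map_poly_comm_ring_hom "\<lambda>r::'a poly. poly r 1" ..
  show ?thesis unfolding \<delta>1_def [abs_def] ..
qed

lemma comm_ring_hom_\<delta>2: "comm_ring_hom (\<delta>2 :: 'a::comm_ring_1 poly poly \<Rightarrow> _)"
  unfolding \<delta>2_def [abs_def] ..

lemma \<delta>_const: "\<delta>1 [:[:c:]:] = [:c:]" "\<delta>2 [:[:c:]:] = [:c:]"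
  by (simp_all add: \<delta>1_def \<delta>2_def Polynomial.map_poly_pCons)

text \<open>With infinitely many base points, \<open>s1\<close> and \<open>s2 + z s3\<close> share a prime factor for almost all \<open>z\<close>;
  as \<open>s1\<close> has finitely many prime factors, two values of \<open>z\<close> give the same one, which divides \<open>s3\<close>.\<close>

lemma finite_base_lines:
  fixes s1 s2 s3 :: "'k::{field_char_0, field_gcd} poly poly poly"
  assumes hom: "homogeneous3 s1 d" "homogeneous3 s2 d" "homogeneous3 s3 d"
    and gcd: "gcd s1 (gcd s2 s3) = 1"
    and top: "eval3 s1 0 0 1 \<noteq> 0" "eval3 s3 0 0 1 \<noteq> 0"
  shows "finite {a. \<exists>b. eval3 s1 1 a b = 0 \<and> eval3 s2 1 a b = 0 \<and> eval3 s3 1 a b = 0}"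
    (is "finite ?A")
proof (rule ccontr)
  assume inf: "infinite ?A"
  define S where "S z = s2 + const3 z * s3" for z
  have evS: "eval3 (S z) a b c = eval3 s2 a b c + z * eval3 s3 a b c" for z a b c
    unfolding S_def hom_plus [OF comm_ring_hom_eval3] hom_times [OF comm_ring_hom_eval3] eval3_const3 ..
  \<comment> \<open>Those z for which \<open>S z\<close> has full degree d in t3; since
    \<open>s3\<close> does not vanish at (0,0,1), at most one z is excluded.\<close>
  define W where "W = {z. eval3 (S z) 0 0 1 \<noteq> 0}"
  have "infinite W"
  proof -
    have "- W \<subseteq> {- eval3 s2 0 0 1 / eval3 s3 0 0 1}"
      unfolding W_def evS using top by (auto simp: field_simps add_eq_0_iff)
    then have "finite (- W)" by (rule finite_subset) simp
    then show ?thesis using infinite_UNIV_char_0 [where 'a = 'k] by (metis Compl_partition finite_UnI finite_compl)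
  qed
  have "\<exists>p. p \<in> prime_factors s1 \<and> p dvd S z" if "z \<in> W" for z
  proof -
    have homS: "homogeneous3 (S z) d"
      unfolding S_def by (intro homogeneous3_add homogeneous3_const3_mult hom)
    have topS: "eval3 (S z) 0 0 1 \<noteq> 0" using that by (simp add: W_def)
    have deg: "degree s1 = d" "degree (S z) = d"
      using homogeneous3_degree_eq hom(1) top(1) homS topS by auto
    \<comment> \<open>This is a form in t1, t2 whose value at (1, a) vanishes for each of the
      infinitely many \<open>a\<close>. Hence it is zero, and \<open>s1\<close> and
      \<open>S z\<close> share a factor of positive degree in t3.\<close>
    let ?\<rho> = "resultant s1 (S z)"
    have "hom2 (int (degree s1 * degree (S z))) ?\<rho>"
      by (rule graded_resultant [OF graded_hom2])
         (simp_all only: deg hom2_coeff_homogeneous3 hom(1) homS)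
    moreover have "\<delta>1 ?\<rho> = 0"
    proof -
      have "poly (\<delta>1 ?\<rho>) a = 0" if "a \<in> ?A" for a
      proof -
        from that obtain b where b: "eval3 s1 1 a b = 0" "eval3 s2 1 a b = 0" "eval3 s3 1 a b = 0" by blast
        let ?\<kappa> = "\<lambda>q. poly (\<delta>1 q) a"
        have "comm_ring_hom (\<lambda>q. poly q a)" ..
        then have \<kappa>: "comm_ring_hom ?\<kappa>" by (rule comm_ring_hom_comp [OF _ comm_ring_hom_\<delta>1])
        have ev: "eval3 s 1 a b = poly (map_poly ?\<kappa> s) b" for s
          by (simp add: eval3_def \<delta>1_def)
        have top\<kappa>: "coeff (map_poly ?\<kappa> s) d = eval3 s 0 0 1" if "homogeneous3 s d" for s
          using homogeneous3_top_coeff [OF that] by (simp add: coeff_map_poly hom_0 [OF comm_ring_hom_\<delta>1] \<delta>_const)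
        have deg\<kappa>: "degree (map_poly ?\<kappa> s) = d" if "homogeneous3 s d" "eval3 s 0 0 1 \<noteq> 0" for s
          using le_degree [of "map_poly ?\<kappa> s" d] top\<kappa> [OF that(1)] that(2)
            degree_map_poly_le [of ?\<kappa> s] homogeneous3_degree_le [OF that(1)] by simp
        have "?\<kappa> ?\<rho> = resultant (map_poly ?\<kappa> s1) (map_poly ?\<kappa> (S z))"
          using deg deg\<kappa> [OF hom(1) top(1)] deg\<kappa> [OF homS topS]
          by (intro comm_ring_hom.resultant_map_poly [OF \<kappa>, symmetric]) simp_all
        also have "\<dots> = 0"
        proof -
          let ?g = "gcd (map_poly ?\<kappa> s1) (map_poly ?\<kappa> (S z))"
          have nz: "map_poly ?\<kappa> s1 \<noteq> 0" using top\<kappa> [OF hom(1)] top(1) by auto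
          have "poly (map_poly ?\<kappa> s1) b = 0" "poly (map_poly ?\<kappa> (S z)) b = 0"
            unfolding ev [symmetric] evS by (simp_all add: b)
          then have "[:-b, 1:] dvd ?g" by (simp add: poly_eq_0_iff_dvd)
          moreover have "?g \<noteq> 0" using nz by simp
          ultimately have "degree [:-b, 1:] \<le> degree ?g" by (rule dvd_imp_degree_le)
          then show ?thesis by (simp add: resultant_0_gcd)
        qed
        finally show ?thesis .
      qed
      then have "?A \<subseteq> {a. poly (\<delta>1 ?\<rho>) a = 0}" by blast
      then show ?thesis using inf poly_roots_finite finite_subset by blast
    qed
    ultimately have "?\<rho> = 0" using \<delta>1_nonzero by blast
    then have g: "degree (gcd s1 (S z)) \<noteq> 0" by (simp add: resultant_0_gcd)
    then have "gcd s1 (S z) \<noteq> 0" "\<not> is_unit (gcd s1 (S z))"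
      by (auto simp: is_unit_poly_iff simp del: is_unit_gcd)
    then obtain p where p: "prime p" "p dvd gcd s1 (S z)"
      using prime_divisor_exists by blast
    moreover have "s1 \<noteq> 0" using top(1) by (auto simp: eval3_def)
    ultimately have "p \<in> prime_factors s1" "p dvd S z"
      by (auto simp: prime_factors_dvd)
    then show ?thesis by blast
  qed
  then obtain \<pi> where \<pi>: "\<And>z. z \<in> W \<Longrightarrow> \<pi> z \<in> prime_factors s1 \<and> \<pi> z dvd S z" by metis
  then have "\<pi> ` W \<subseteq> prime_factors s1" by blast
  then have "finite (\<pi> ` W)" by (rule finite_subset) simp
  then have "\<not> inj_on \<pi> W" using \<open>infinite W\<close> finite_imageD by blast
  then obtain z z' where z: "z \<in> W" "z' \<in> W" "z \<noteq> z'" "\<pi> z = \<pi> z'" by (auto simp: inj_on_def)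
  have p: "prime (\<pi> z)" "\<pi> z dvd s1" using \<pi> [OF z(1)] by auto
  have dvd: "\<pi> z dvd S z" "\<pi> z dvd S z'" using \<pi> [OF z(1)] \<pi> [OF z(2)] z(4) by auto
  have "S z - S z' = const3 (z - z') * s3"
    by (simp add: S_def const3_def smult_diff_left [symmetric])
  then have "\<pi> z dvd const3 (z - z') * s3" using dvd by (metis dvd_diff)
  moreover have "is_unit (const3 (z - z'))"
    using z(3) by (simp add: const3_def is_unit_const_poly_iff)
  ultimately have 3: "\<pi> z dvd s3" by (simp add: dvd_mult_unit_iff')
  have "s2 = S z - const3 z * s3" by (simp add: S_def)
  then have "\<pi> z dvd s2" using dvd(1) 3 by (metis dvd_diff dvd_mult)
  with p 3 have "\<pi> z dvd gcd s1 (gcd s2 s3)" by simp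
  then have "is_unit (\<pi> z)" unfolding gcd .
  with p(1) show False using not_prime_unit by blast
qed

text \<open>Non-roots contribute 0, so \<open>A\<close> may be larger than the set of roots; the sum
  over lines below also includes all lines carrying base points.\<close>

lemma sum_order_eq_degree:
  fixes p :: "'a::alg_closed_field poly"
  assumes "p \<noteq> 0" "finite A" "{a. poly p a = 0} \<subseteq> A"
  shows "(\<Sum>a\<in>A. order a p) = degree p"
  using assms(1,3)
proof (induction "degree p" arbitrary: p)
  case 0
  then obtain c where "p = [:c:]" by (metis degree_eq_zeroE)
  with 0 show ?case by (auto simp: order_0I)
next
  case (Suc n)
  obtain r where r: "poly p r = 0" using Suc.hyps(2) alg_closed_imp_poly_has_root [of p] by auto
  then obtain q where q: "p = [:-r, 1:] * q" by (metis poly_eq_0_iff_dvd dvdE)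
  have "q \<noteq> 0" using Suc q by auto
  have deg: "n = degree q"
    using Suc.hyps(2) \<open>q \<noteq> 0\<close> unfolding q by (subst (asm) degree_mult_eq) auto
  have IH: "(\<Sum>a\<in>A. order a q) = degree q"
    using Suc.prems(2) by (intro Suc.hyps(1) [OF deg \<open>q \<noteq> 0\<close>]) (auto simp: q)
  have "order a p = (if a = r then 1 else 0) + order a q" for a
  proof -
    have "order a p = order a [:-r, 1:] + order a q"
      using order_mult [of "[:-r, 1:]" q a] Suc.prems(1) unfolding q by blast
    also have "order a [:-r, 1:] = (if a = r then 1 else 0)"
      using order_power_n_n [of r 1] order_0I [of "[:-r, 1:]" a] by auto
    finally show ?thesis .
  qed
  then show ?case
    using r Suc.prems(2) \<open>finite A\<close> IH deg Suc.hyps(2) by (auto simp: sum.distrib)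
qed

lemma sum_enat: "(\<Sum>a\<in>A. enat (h a)) = enat (\<Sum>a\<in>A. h a)"
  by (induction A rule: infinite_finite_induct) (auto simp: zero_enat_def)

subsection \<open>The main theorem\<close>

text \<open>The equation of the complement of the open set: a linear form in the third row of the
  matrix. With the values of s1, s2, s3 at (0,0,1) as coefficients it is the value of L_3(S)
  there.\<close>

definition top_form :: "'a::comm_semiring_1 \<Rightarrow> 'a \<Rightarrow> 'a \<Rightarrow> ((nat \<times> nat) \<Rightarrow>\<^sub>0 nat) \<Rightarrow>\<^sub>0 'a" where
  "top_form c0 c1 c2 = Poly_Mapping.single (Poly_Mapping.single (2, 0) 1) c0
     + Poly_Mapping.single (Poly_Mapping.single (2, 1) 1) c1
     + Poly_Mapping.single (Poly_Mapping.single (2, 2) 1) c2"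

lemma eval_mat_poly_top_form:
  "eval_mat_poly (top_form c0 c1 c2) M = M 2 0 * c0 + M 2 1 * c1 + M 2 2 * c2"
proof -
  define e where "e j = Poly_Mapping.single (2::nat, j::nat) (1::nat)" for j
  have e_inj: "e i = e j \<longleftrightarrow> i = j" for i j
    unfolding e_def by (metis lookup_single_eq lookup_single_not_eq prod.inject zero_neq_one)
  let ?P = "top_form c0 c1 c2"
  let ?m = "\<lambda>k. (\<Prod>ij\<in>{0..<3} \<times> {0..<3}. M (fst ij) (snd ij) ^ Poly_Mapping.lookup k ij)"
  have P: "?P = Poly_Mapping.single (e 0) c0 + Poly_Mapping.single (e 1) c1 + Poly_Mapping.single (e 2) c2"
    by (simp add: top_form_def e_def)
  have look: "Poly_Mapping.lookup ?P k = (if k = e 0 then c0 else 0) + (if k = e 1 then c1 else 0) + (if k = e 2 then c2 else 0)" for k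
    unfolding P by (auto simp: lookup_add lookup_single when_def)
  have m: "?m (e j) = M 2 j" if "j < 3" for j
  proof -
    have "?m (e j) = (\<Prod>ij\<in>{0..<3::nat} \<times> {0..<3}. if ij = (2, j) then M 2 j else 1)"
      by (intro prod.cong) (auto simp: e_def lookup_single when_def)
    also have "\<dots> = M 2 j" using that by (subst prod.delta) auto
    finally show ?thesis .
  qed
  have "eval_mat_poly ?P M = (\<Sum>k\<in>{e 0, e 1, e 2}. Poly_Mapping.lookup ?P k * ?m k)"
    unfolding eval_mat_poly_def
  proof (intro sum.mono_neutral_left)
    show "Poly_Mapping.keys ?P \<subseteq> {e 0, e 1, e 2}"
      by (auto simp: in_keys_iff look split: if_splits)
  qed (auto simp: in_keys_iff)
  also have "\<dots> = c0 * M 2 0 + c1 * M 2 1 + c2 * M 2 2"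
    by (simp add: e_inj look m add.assoc)
  finally show ?thesis by (simp add: mult.commute)
qed

context net
begin

text \<open>Giving x weight 0, the coefficient of t3^k in \<open>J1\<close> and \<open>J2\<close>
  has degree d - k in t1, t2, so \<open>graded_resultant\<close> applies.\<close>

lemma hom2_coeff_R:
  assumes deg: "degree (J1 M s1 s2 s3) = d" "degree (J2 M s1 s2 s3) = d"
  shows "hom2 (int (d * d)) (coeffX R i j k)"
proof -
  let ?P = "gr_poly 0 (gr_poly 0 (gr_poly 0 hom2)) :: int \<Rightarrow> 'k polyTX \<Rightarrow> bool"
  have g: "graded ?P" by (intro graded_gr_poly graded_hom2)
  have LS: "homogeneous3 (LS M i s1 s2 s3) d" for i
    unfolding LS_def by (intro homogeneous3_add homogeneous3_const3_mult hom1 hom2 hom3)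
  have lift: "?P e (liftTX q)" if "hom2 e q" for e q
    unfolding liftTX_def using that by (intro gr_poly_const graded_gr_poly graded_hom2)
  have var: "?P 0 (varX n)" for n
    unfolding varX_def
    by (simp only: split: if_split)
       (intro conjI impI gr_poly_const gr_poly_var graded_gr_poly graded_hom2)
  have summand: "?P (int d - int k) (varX n * liftTX (coeff (LS M i s1 s2 s3) k))" for n i k
    using graded_mult [OF g var lift [OF hom2_coeff_homogeneous3 [OF LS]]] by simp
  have lift0: "liftTX 0 = (0 :: 'k polyTX)" by (simp add: liftTX_def)
  have J: "?P (int d - int k) (coeff (J1 M s1 s2 s3) k)" "?P (int d - int k) (coeff (J2 M s1 s2 s3) k)" for k
    unfolding J1_def J2_def using graded_diff [OF g summand summand]
    by (simp_all add: liftJ_def coeff_map_poly lift0)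
  have "?P (int (d * d)) R"
    using graded_resultant [OF g, of "J1 M s1 s2 s3" "J2 M s1 s2 s3"] J unfolding deg R_def by simp
  then show ?thesis by (simp add: gr_poly_def)
qed

end

text \<open>Dehomogenizing over F after embedding equals embedding after dehomogenizing over K. This
  identifies the forms in the definition of the multiplicity with \<open>V xF\<close> and
  \<open>V yF\<close>.\<close>

lemma (in chart) map_poly_V:
  fixes \<delta>F :: "'a FF poly poly \<Rightarrow> 'a FF poly"
  assumes h: "comm_ring_hom \<delta>F" and c: "\<And>c. \<delta>F [:[:c:]:] = [:c:]"
    and comm: "\<And>q. \<delta>F (map_poly (map_poly embF) q) = map_poly embF (\<delta> q)"
  shows "map_poly \<delta>F (V1 s1 s2 s3) = V xF" "map_poly \<delta>F (V2 s1 s2 s3) = V yF"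
proof -
  interpret m: map_poly_comm_ring_hom \<delta>F using h by (rule map_poly_comm_ring_hom.intro)
  have 1: "map_poly \<delta>F (liftF s) = P s" for s
  proof (rule poly_eqI)
    fix n
    have "coeff (P s) n = \<sigma> (coeff s n)" by (simp add: P_def coeff_map_poly hom_0 [OF \<sigma>])
    then show "coeff (map_poly \<delta>F (liftF s)) n = coeff (P s) n"
      by (simp add: liftF_def coeff_map_poly hom_0 [OF h] comm \<sigma>_def)
  qed
  have 2: "map_poly \<delta>F (const3 c) = const2 c" for c
    by (simp add: const3_def const2_def Polynomial.map_poly_pCons hom_0 [OF h] c)
  show "map_poly \<delta>F (V1 s1 s2 s3) = V xF" "map_poly \<delta>F (V2 s1 s2 s3) = V yF"
    unfolding V1_def V2_def V_def by (simp_all add: m.hom_add m.hom_mult 1 2)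
qed

theorem (in net) mult_base_eq_deg_content:
  assumes gcd: "gcd s1 (gcd s2 s3) = 1" and top3: "eval3 s3 0 0 1 \<noteq> 0"
  shows "mult_base s1 s2 s3 = enat (deg_t (content_x R))"
proof -
  interpret e: comm_ring_hom "embF :: 'k \<Rightarrow> _" by (rule comm_ring_hom_embF)
  interpret me: map_poly_comm_ring_hom "embF :: 'k \<Rightarrow> _"
    using comm_ring_hom_embF by (rule map_poly_comm_ring_hom.intro)
  interpret c1: chart s1 s2 s3 d M \<delta>1
    by (intro chart.intro chart_axioms.intro net_axioms comm_ring_hom_\<delta>1 \<delta>_const)
  interpret c2: chart s1 s2 s3 d M \<delta>2
    by (intro chart.intro chart_axioms.intro net_axioms comm_ring_hom_\<delta>2 \<delta>_const)
  have ev1: "eval3 s 1 a b = poly (c1.sec a s) b" for s a b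
    by (simp add: eval3_def c1.sec_def \<delta>1_def)
  have ev2: "eval3 s 0 1 b = poly (c2.sec 0 s) b" for s b
  proof -
    have "poly (map_poly (\<lambda>r. poly r 0) q) 1 = poly (\<delta>2 q) 0" for q :: "'k poly poly"
      using eval2_altdef [of q 0 1] by (simp add: eval2_def \<delta>2_def pCons_one)
    then show ?thesis by (simp add: eval3_def c2.sec_def)
  qed
  \<comment> \<open>The slopes of the lines t2 = a t1 that carry a base point.\<close>
  define A0 where "A0 = {a. c1.Z a \<noteq> {}}"
  have finA0: "finite A0"
    using finite_base_lines [OF hom1 hom2 hom3 gcd top1 top3]
    by (rule finite_subset [rotated]) (auto simp: A0_def c1.Z_def ev1)
  have "R \<noteq> 0"
  proof
    assume "R = 0"
    then have "A0 = UNIV" using c1.Z_nonempty_if_R_0 by (auto simp: A0_def)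
    with finA0 show False using infinite_UNIV_char_0 [where 'a = 'k] by simp
  qed
  define C where "C = content_x R"
  obtain n Q where RQ: "R = liftTX C * Q" and C: "C \<noteq> 0" "hom2 (int n) C"
    and Q1: "\<And>a. \<exists>i j k. poly (\<delta>1 (coeffX Q i j k)) a \<noteq> 0"
    and Q2: "\<exists>i j k. poly (\<delta>2 (coeffX Q i j k)) 0 \<noteq> 0"
    using content_x_factor [OF \<open>R \<noteq> 0\<close> hom2_coeff_R [OF c1.degree_J_eq]] unfolding C_def by metis
  have C1: "\<delta>1 C \<noteq> 0" by (rule \<delta>1_nonzero [OF C(2,1)])
  have C2: "\<delta>2 C \<noteq> 0" "n = degree (\<delta>1 C) + order 0 (\<delta>2 C)"
    using hom2_degree_eq [OF C(2,1)] by auto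
  let ?I1 = "\<lambda>a b. int_mult_aff (c1.V xF) (c1.V yF) (embF a) (embF b)"
  let ?I2 = "\<lambda>b. int_mult_aff (c2.V xF) (c2.V yF) (embF 0) (embF b)"
  have sum1: "(\<Sum>b\<in>c1.Z a. ?I1 a b) = enat (order a (\<delta>1 C))" for a
  proof -
    obtain i j k where "poly (\<delta>1 (coeffX Q i j k)) a \<noteq> 0" using Q1 by blast
    from c1.order_\<psi>_R [OF RQ C1 this] show ?thesis using c1.sum_int_mult by metis
  qed
  have sum2: "(\<Sum>b\<in>c2.Z 0. ?I2 b) = enat (order 0 (\<delta>2 C))"
  proof -
    obtain i j k where "poly (\<delta>2 (coeffX Q i j k)) 0 \<noteq> 0" using Q2 by blast
    from c2.order_\<psi>_R [OF RQ C2(1) this] show ?thesis using c2.sum_int_mult by metis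
  qed
  have V1: "map_poly \<delta>1 (V1 s1 s2 s3) = c1.V xF" "map_poly \<delta>1 (V2 s1 s2 s3) = c1.V yF"
  proof -
    have "\<delta>1 (map_poly (map_poly embF) q) = map_poly embF (\<delta>1 q)" for q :: "'k poly poly"
    proof (rule poly_eqI)
      fix i
      show "coeff (\<delta>1 (map_poly (map_poly embF) q)) i = coeff (map_poly embF (\<delta>1 q)) i"
        using e.poly_map_poly [of "coeff q i" 1] by (simp add: \<delta>1_def coeff_map_poly)
    qed
    then show "map_poly \<delta>1 (V1 s1 s2 s3) = c1.V xF" "map_poly \<delta>1 (V2 s1 s2 s3) = c1.V yF"
      using c1.map_poly_V [OF comm_ring_hom_\<delta>1 \<delta>_const(1)] by blast+
  qed
  have V2: "map_poly \<delta>2 (V1 s1 s2 s3) = c2.V xF" "map_poly \<delta>2 (V2 s1 s2 s3) = c2.V yF"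
  proof -
    have "\<delta>2 (map_poly (map_poly embF) q) = map_poly embF (\<delta>2 q)" for q :: "'k poly poly"
      using me.poly_map_poly [of q 1] by (simp add: \<delta>2_def)
    then show "map_poly \<delta>2 (V1 s1 s2 s3) = c2.V xF" "map_poly \<delta>2 (V2 s1 s2 s3) = c2.V yF"
      using c2.map_poly_V [OF comm_ring_hom_\<delta>2 \<delta>_const(2)] by blast+
  qed
  have dehom1: "dehom1 F = map_poly \<delta>1 F" for F :: "'k FF poly poly poly"
    by (simp add: dehom1_def \<delta>1_def [abs_def])
  have dehom2: "dehom2 F = map_poly \<delta>2 F" for F :: "'k FF poly poly poly"
    by (simp add: dehom2_def \<delta>2_def [abs_def])
  let ?g = "\<lambda>(a1, a2, a3). int_mult_proj (V1 s1 s2 s3) (V2 s1 s2 s3) (embF a1) (embF a2) (embF a3)"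
  let ?B1 = "(\<lambda>(a, b). (1 :: 'k, a, b)) ` Sigma A0 c1.Z"
  let ?B2 = "(\<lambda>b. (0 :: 'k, 1 :: 'k, b)) ` c2.Z 0"
  \<comment> \<open>The remaining normalized point (0, 0, 1) is excluded by
    \<open>top1\<close>.\<close>
  have "base_points s1 s2 s3 = ?B1 \<union> ?B2"
    unfolding base_points_def proj_rep_def A0_def c1.Z_def c2.Z_def
    using top1 by (auto simp: ev1 ev2 image_iff)
  moreover have "?B1 \<inter> ?B2 = {}" by auto
  moreover have "finite ?B1" using finA0 c1.finite_Z by auto
  moreover have "finite ?B2" using c2.finite_Z by auto
  ultimately have "mult_base s1 s2 s3 = sum ?g ?B1 + sum ?g ?B2"
    unfolding mult_base_def by (simp add: sum.union_disjoint)
  also have "sum ?g ?B1 = (\<Sum>(a, b)\<in>Sigma A0 c1.Z. ?I1 a b)"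
    by (subst sum.reindex)
       (auto simp: inj_on_def int_mult_proj_def dehom1 V1 intro!: sum.cong)
  also have "\<dots> = (\<Sum>a\<in>A0. \<Sum>b\<in>c1.Z a. ?I1 a b)"
    using finA0 c1.finite_Z by (simp add: sum.Sigma)
  \<comment> \<open>Lines outside \<open>A0\<close> contribute empty sums. With all roots of
    \<open>\<delta>1 C\<close> included, the orders add up to its degree.\<close>
  also have "\<dots> = (\<Sum>a\<in>A0 \<union> {a. poly (\<delta>1 C) a = 0}. \<Sum>b\<in>c1.Z a. ?I1 a b)"
    using finA0 poly_roots_finite [OF C1] by (intro sum.mono_neutral_left) (auto simp: A0_def)
  also have "\<dots> = enat (\<Sum>a\<in>A0 \<union> {a. poly (\<delta>1 C) a = 0}. order a (\<delta>1 C))"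
    unfolding sum1 by (simp add: sum_enat)
  also have "(\<Sum>a\<in>A0 \<union> {a. poly (\<delta>1 C) a = 0}. order a (\<delta>1 C)) = degree (\<delta>1 C)"
    using finA0 poly_roots_finite [OF C1] by (intro sum_order_eq_degree C1) auto
  also have "sum ?g ?B2 = (\<Sum>b\<in>c2.Z 0. ?I2 b)"
    by (subst sum.reindex)
       (auto simp: inj_on_def int_mult_proj_def dehom2 V2 intro!: sum.cong)
  also have "\<dots> = enat (order 0 (\<delta>2 C))" by (rule sum2)
  finally show ?thesis
    using deg_t_hom2 [OF C(2,1)] C2(2) by (simp add: C_def)
qed

theorem theorem3p4:
  fixes s1 s2 s3 :: "'k::{alg_closed_field, field_char_0, field_gcd} poly poly poly" and d :: nat
  assumes "homogeneous3 s1 d" and "homogeneous3 s2 d" and "homogeneous3 s3 d"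
    and "gcd s1 (gcd s2 s3) = 1"
    and "eval3 s1 0 0 1 \<noteq> 0" and "eval3 s2 0 0 1 \<noteq> 0" and "eval3 s3 0 0 1 \<noteq> 0"
    and "dominant3 s1 s2 s3"
  shows "\<exists>P :: ((nat \<times> nat) \<Rightarrow>\<^sub>0 nat) \<Rightarrow>\<^sub>0 'k.
           (\<exists>M. det3 M \<noteq> 0 \<and> eval_mat_poly P M \<noteq> 0) \<and>
           (\<forall>M. det3 M \<noteq> 0 \<and> eval_mat_poly P M \<noteq> 0 \<longrightarrow>
              mult_base s1 s2 s3 =
                enat (deg_t (content_x (resultant (J1 M s1 s2 s3) (J2 M s1 s2 s3)))))"
proof -
  define P where "P = top_form (eval3 s1 0 0 1) (eval3 s2 0 0 1) (eval3 s3 0 0 1)"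
  have "det3 (\<lambda>i j. if i = j then 1 else 0 :: 'k) \<noteq> 0"
    by (simp add: det3_def)
  \<comment> \<open>At the identity the form takes the value of \<open>s3\<close> at (0,0,1), so the
    open set is non-empty.\<close>
  moreover have "eval_mat_poly P (\<lambda>i j. if i = j then 1 else 0) \<noteq> 0"
    using assms(7) by (simp add: P_def eval_mat_poly_top_form)
  moreover have "mult_base s1 s2 s3 = enat (deg_t (content_x (resultant (J1 M s1 s2 s3) (J2 M s1 s2 s3))))"
    if "det3 M \<noteq> 0" "eval_mat_poly P M \<noteq> 0" for M
  proof -
    interpret net s1 s2 s3 d M
      by unfold_locales (use assms that in \<open>simp_all add: P_def eval_mat_poly_top_form\<close>)
    show ?thesis using mult_base_eq_deg_content [OF assms(4,7)] unfolding R_def .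
  qed
  ultimately show ?thesis by blast
qed

end
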